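(* Let $C$ be a constant such that for all integers $N\ge1$, $m\ge 1$, all real $p\in[1,\infty)$, all $q\in[1,\infty]$ and all scalars $b_1,\dots,b_m\in\mathbb{C}$, $$\mathbb{E}\Big\|\sum_{j=1}^m b_j\,(U_j^{(N)}\otimes\bar U_j^{(N)})(1-P_N)\Big\|_q^p\le C^p\,\mathbb{E}\Big\|\sum_{j=1}^m b_j\,Y_j^{(N)}\otimes\bar Y_j'^{(N)}\Big\|_q^p .$$ Let $n\ge 1$ be an integer, let $a_1,\dots,a_n\in\mathbb{C}$, and for each $N\ge 1$ let $$\hat S^{(N)}=\sum_{j=1}^n a_j\,(U_j^{(N)}\otimes\bar U_j^{(N)})(1-P_N).$$ Then $$\limsup_{N\to\infty}\mathbb{E}\|\hat S^{(N)}\|\le 4C\Big(\sum_{j=1}^n|a_j|^2\Big)^{1/2}.$$ Moreover, almost surely, $$\limsup_{N\to\infty}\|\hat S^{(N)}\|\le 4C\Big(\sum_{j=1}^n|a_j|^2\Big)^{1/2}.$$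
   Context: $M_N$ denotes the $N\times N$ complex matrices, and $S_2^N$ denotes $M_N$ equipped with the Hilbert–Schmidt norm (a Hilbert space of dimension $N^2$). For $x,y\in M_N$, the symbol $x\otimes\bar y$ denotes the linear operator on $S_2^N$ given by $\xi\mapsto x\,\xi\,y^*$; sums and scalar multiples are taken in $B(S_2^N)$. $P_N$ is the orthogonal projection of $S_2^N$ onto the line $\mathbb{C}I$ spanned by the identity matrix, so that $1-P_N$ is the orthogonal projection onto the orthogonal complement of the identity (the trace-zero matrices). $\|\cdot\|$ denotes the operator norm on $B(S_2^N)$, and $\|x\|_q=(\mathrm{tr}(|x|^q))^{1/q}$ is the Schatten $q$-norm (unnormalized trace) for $1\le q<\infty$, with $\|\cdot\|_\infty$ the operator norm. For each $N$: $(U_j^{(N)})_j$ is a sequence of i.i.d. random $N\times N$ matrices uniformly distributed (Haar measure) over the unitary group $U(N)$. $(Y_j^{(N)})_j$ is a sequence of i.i.d. random $N\times N$ matrices, each distributed like $Y$, where the entries $Y(i,l)$ are independent and $Y(i,l)=(2N)^{-1/2}(g_{il}+\sqrt{-1}\,g'_{il})$ with $g_{il},g'_{il}$ all independent real standard Gaussian $N(0,1)$ variables. $(Y_j'^{(N)})_j$ is an independent copy of $(Y_j^{(N)})_j$. For the almost sure statement, the matrices $U_j^{(N)}$ for all $N$ are defined on a common probability space; no assumption is made on their joint distribution for different values of $N$. *)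

theory Defs
  imports "HOL-Probability.Probability" "Jordan_Normal_Form.Schur_Decomposition"
begin

section \<open>Matrices and operators on the Hilbert--Schmidt space\<close>

definition mat_trace :: "complex mat \<Rightarrow> complex" where
  "mat_trace A = (\<Sum>i<dim_row A. A $$ (i, i))"

definition unitary_group :: "nat \<Rightarrow> complex mat set" where
  "unitary_group N =
     {V \<in> carrier_mat N N. mat_adjoint V * V = 1\<^sub>m N \<and> V * mat_adjoint V = 1\<^sub>m N}"

definition hs_inner :: "complex mat \<Rightarrow> complex mat \<Rightarrow> complex" where
  "hs_inner \<xi> \<eta> = mat_trace (mat_adjoint \<eta> * \<xi>)"

definition hs_norm :: "complex mat \<Rightarrow> real" where
  "hs_norm \<xi> = sqrt (Re (hs_inner \<xi> \<xi>))"

text \<open>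
  The space \<open>S_2^N\<close> is \<^term>\<open>carrier_mat N N\<close> with the inner product \<^const>\<open>hs_inner\<close>; an operator on
  it is a function on matrices, of which only the values on \<^term>\<open>carrier_mat N N\<close> matter.
\<close>

type_synonym hs_op = "complex mat \<Rightarrow> complex mat"

text \<open>The operator usually written \<open>x \<otimes> y\<close> with a bar over \<open>y\<close>.\<close>

definition tensor_bar :: "complex mat \<Rightarrow> complex mat \<Rightarrow> hs_op" where
  "tensor_bar x y = (\<lambda>\<xi>. x * \<xi> * mat_adjoint y)"

text \<open>
  Linear combinations are written entrywise, because matrices of all sizes share one type and
  \<^const>\<open>sum\<close> is not available for them.
\<close>

definition lin_comb_op :: "nat \<Rightarrow> nat set \<Rightarrow> (nat \<Rightarrow> complex) \<Rightarrow> (nat \<Rightarrow> hs_op) \<Rightarrow> hs_op" where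
  "lin_comb_op N J a T =
     (\<lambda>\<xi>. mat N N (\<lambda>(i, l). \<Sum>j\<in>J. a j * (T j \<xi>) $$ (i, l)))"

definition line_proj :: "complex mat \<Rightarrow> hs_op" where
  "line_proj v = (\<lambda>\<xi>. (hs_inner \<xi> v / hs_inner v v) \<cdot>\<^sub>m v)"

definition P_op :: "nat \<Rightarrow> hs_op" where
  "P_op N = line_proj (1\<^sub>m N)"

definition one_minus_P :: "nat \<Rightarrow> hs_op" where
  "one_minus_P N = (\<lambda>\<xi>. \<xi> - P_op N \<xi>)"

definition op_norm :: "nat \<Rightarrow> hs_op \<Rightarrow> real" where
  "op_norm N T = Sup {hs_norm (T \<xi>) | \<xi>. \<xi> \<in> carrier_mat N N \<and> hs_norm \<xi> \<le> 1}"

section \<open>Schatten norms\<close>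

text \<open>
  Functional calculus of a Hermitian matrix: the result does not depend on the choice of the
  unitary diagonalisation.
\<close>

definition herm_fun :: "(real \<Rightarrow> real) \<Rightarrow> complex mat \<Rightarrow> complex mat" where
  "herm_fun f A = (SOME B. \<exists>V\<in>unitary_group (dim_row A). \<exists>d :: nat \<Rightarrow> real.
     A = V * mat_diag (dim_row A) (\<lambda>i. complex_of_real (d i)) * mat_adjoint V \<and>
     B = V * mat_diag (dim_row A) (\<lambda>i. complex_of_real (f (d i))) * mat_adjoint V)"

definition mat_abs :: "complex mat \<Rightarrow> complex mat" where
  "mat_abs A = herm_fun sqrt (mat_adjoint A * A)"

definition mat_powr :: "complex mat \<Rightarrow> real \<Rightarrow> complex mat" where
  "mat_powr A q = herm_fun (\<lambda>t. t powr q) A"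

definition matrix_unit :: "nat \<Rightarrow> nat \<Rightarrow> complex mat" where
  "matrix_unit N c = mat N N (\<lambda>il. if il = (c div N, c mod N) then 1 else 0)"

text \<open>
  The \<open>N\<^sup>2 \<times> N\<^sup>2\<close> matrix of an operator with respect to the orthonormal basis of the matrix units,
  enumerated row by row.
\<close>

definition op_mat :: "nat \<Rightarrow> hs_op \<Rightarrow> complex mat" where
  "op_mat N T = mat (N\<^sup>2) (N\<^sup>2) (\<lambda>(r, c). hs_inner (T (matrix_unit N c)) (matrix_unit N r))"

definition schatten_norm :: "nat \<Rightarrow> ereal \<Rightarrow> hs_op \<Rightarrow> real" where
  "schatten_norm N q T =
     (if q = \<infinity> then op_norm N T
      else Re (mat_trace (mat_powr (mat_abs (op_mat N T)) (real_of_ereal q)))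
             powr (1 / real_of_ereal q))"

section \<open>Random matrices\<close>

text \<open>The Borel \<open>\<sigma>\<close>-algebra of \<open>M_N\<close>, generated by the matrix entries.\<close>

definition mat_borel :: "nat \<Rightarrow> complex mat measure" where
  "mat_borel N = sigma (carrier_mat N N)
     {{A \<in> carrier_mat N N. A $$ (i, l) \<in> B} | i l B. i < N \<and> l < N \<and> B \<in> sets borel}"

definition haar_measure_unitary :: "nat \<Rightarrow> complex mat measure \<Rightarrow> bool" where
  "haar_measure_unitary N \<mu> \<longleftrightarrow>
     prob_space \<mu> \<and> sets \<mu> = sets (mat_borel N) \<and>
     (AE A in \<mu>. A \<in> unitary_group N) \<and>
     (\<forall>V\<in>unitary_group N. distr \<mu> (mat_borel N) (\<lambda>A. V * A) = \<mu>)"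

definition iid_seq :: "'a measure \<Rightarrow> 'b measure \<Rightarrow> (nat \<Rightarrow> 'a \<Rightarrow> 'b) \<Rightarrow> bool" where
  "iid_seq M S X \<longleftrightarrow>
     prob_space.indep_vars M (\<lambda>_. S) X {1..} \<and>
     (\<forall>j\<ge>1. distr M S (X j) = distr M S (X 1))"

definition iid_haar_unitary :: "'a measure \<Rightarrow> nat \<Rightarrow> (nat \<Rightarrow> 'a \<Rightarrow> complex mat) \<Rightarrow> bool" where
  "iid_haar_unitary M N U \<longleftrightarrow>
     iid_seq M (mat_borel N) U \<and>
     (\<forall>j\<ge>1. haar_measure_unitary N (distr M (mat_borel N) (U j)))"

text \<open>
  The real Gaussian variables \<open>g\<close> and \<open>g'\<close> form one independent family; the Boolean index tells
  them apart.
\<close>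

definition gaussian_matrix :: "'a measure \<Rightarrow> nat \<Rightarrow> ('a \<Rightarrow> complex mat) \<Rightarrow> bool" where
  "gaussian_matrix M N Y \<longleftrightarrow>
     Y \<in> measurable M (mat_borel N) \<and>
     (\<exists>g g' :: nat \<Rightarrow> nat \<Rightarrow> 'a \<Rightarrow> real.
        prob_space.indep_vars M (\<lambda>_. borel)
          (\<lambda>(i, l, b). if b then g' i l else g i l) ({..<N} \<times> {..<N} \<times> (UNIV :: bool set)) \<and>
        (\<forall>i<N. \<forall>l<N. distributed M lborel (g i l) std_normal_density \<and>
                      distributed M lborel (g' i l) std_normal_density) \<and>
        (\<forall>\<omega>\<in>space M. \<forall>i<N. \<forall>l<N.
           Y \<omega> $$ (i, l) = complex_of_real ((2 * real N) powr (- 1 / 2))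
                          * Complex (g i l \<omega>) (g' i l \<omega>)))"

definition iid_gaussian :: "'a measure \<Rightarrow> nat \<Rightarrow> (nat \<Rightarrow> 'a \<Rightarrow> complex mat) \<Rightarrow> bool" where
  "iid_gaussian M N Y \<longleftrightarrow>
     iid_seq M (mat_borel N) Y \<and> (\<forall>j\<ge>1. gaussian_matrix M N (Y j))"

definition independent_copy ::
    "'a measure \<Rightarrow> 'b measure \<Rightarrow> (nat \<Rightarrow> 'a \<Rightarrow> 'b) \<Rightarrow> (nat \<Rightarrow> 'a \<Rightarrow> 'b) \<Rightarrow> bool" where
  "independent_copy M S X X' \<longleftrightarrow>
     prob_space.indep_var M (PiM {1..} (\<lambda>_. S)) (\<lambda>\<omega>. \<lambda>j\<in>{1..}. X j \<omega>)
                            (PiM {1..} (\<lambda>_. S)) (\<lambda>\<omega>. \<lambda>j\<in>{1..}. X' j \<omega>) \<and>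
     distr M (PiM {1..} (\<lambda>_. S)) (\<lambda>\<omega>. \<lambda>j\<in>{1..}. X' j \<omega>)
       = distr M (PiM {1..} (\<lambda>_. S)) (\<lambda>\<omega>. \<lambda>j\<in>{1..}. X j \<omega>)"

section \<open>The two random operators\<close>

definition S_hat ::
    "nat \<Rightarrow> nat \<Rightarrow> (nat \<Rightarrow> complex) \<Rightarrow> (nat \<Rightarrow> 'a \<Rightarrow> complex mat) \<Rightarrow> 'a \<Rightarrow> hs_op" where
  "S_hat N n a U \<omega> =
     lin_comb_op N {1..n} a (\<lambda>j. tensor_bar (U j \<omega>) (U j \<omega>) \<circ> one_minus_P N)"

definition gaussian_sum ::
    "nat \<Rightarrow> nat \<Rightarrow> (nat \<Rightarrow> complex) \<Rightarrow> (nat \<Rightarrow> 'a \<Rightarrow> complex mat) \<Rightarrow>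
     (nat \<Rightarrow> 'a \<Rightarrow> complex mat) \<Rightarrow> 'a \<Rightarrow> hs_op" where
  "gaussian_sum N m b Y Y' \<omega> = lin_comb_op N {1..m} b (\<lambda>j. tensor_bar (Y j \<omega>) (Y' j \<omega>))"

end

theory Submission
  imports Defs "Jordan_Normal_Form.Spectral_Radius" "HOL-Real_Asymp.Real_Asymp"
begin

text \<open>
  The hypothesis is used only with \<open>q = p = 2m\<close>, where both sides are expectations of
  \<open>Tr (T\<^sup>* T)\<^sup>m\<close>, a polynomial in the matrix entries. For the Gaussian sum \<open>T = \<Sum> a\<^sub>j Y\<^sub>j \<otimes> Y'\<^sub>j\<close> this
  expectation is \<open>\<Sum> c(j,k) \<bar>F(j,k)\<bar>\<^sup>2\<close> over words \<open>j, k\<close> of length \<open>m\<close>, where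
  \<open>F(j,k) = E Tr (Y\<^sub>j\<^sub>1\<^sup>* Y\<^sub>k\<^sub>1 \<cdots> Y\<^sub>j\<^sub>m\<^sup>* Y\<^sub>k\<^sub>m)\<close>. The Wick formula writes \<open>F\<close> as a sum of nonnegative weights over
  the permutations matching \<open>j\<close> with \<open>k\<close>; hence \<open>0 \<le> F \<le> W\<close> with \<open>W = E Tr (Y\<^sup>* Y)\<^sup>m\<close>, and the
  sum is at most \<open>(\<Sum> \<bar>a\<^sub>j\<bar>\<^sup>2)\<^sup>m W\<^sup>2\<close>. Gaussian integration by parts gives a recursion for mixed moments of
  several traces; comparing it with the Catalan recursion yields
  \<open>W \<le> N (4 (1 + m (m + 1)\<^sup>2 / N\<^sup>2))\<^sup>m\<close>. For \<open>m \<approx> \<surd>N\<close> the \<open>2m\<close>-th root of \<open>W\<^sup>2\<close> tends to \<open>4\<close>, fast enough for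
  Markov's inequality and the Borel--Cantelli lemma.
\<close>

section \<open>Unitary diagonalisation\<close>

text \<open>Integration by parts in \<open>W\<close> cuts one trace into two, and the expectation of
  a product of traces does not factor. So no closed recursion exists for \<open>W\<close> alone, and
  the bound has to be proved for all products of traces at once. Differentiating the other traces
  joins them to the first one; these terms lack the factor \<open>N^2\<close> that the cut terms
  carry, and \<open>growth N m\<close> is the price for absorbing them. The degree has to lie in a
  window: \<open>growth N m\<close> must tend to 1, which asks for \<open>m^3\<close> much smaller
  than \<open>N^2\<close>, while the factor \<open>N^2\<close> in the square of \<open>W\<close> and
  a summable tail ask for \<open>m\<close> much larger than \<open>ln N\<close>. The square root of
  \<open>N\<close> satisfies both. The 4 in the limit is 2 times 2: each of the two independent
  families contributes one factor \<open>W\<close>, of Catalan growth \<open>4^m\<close>, whose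
  \<open>2m\<close>-th root is 2. Nothing is known about the joint law for different
  \<open>N\<close>, so the almost sure part has to rest on summable tail probabilities
  alone.\<close>

lemma mat_adjoint_carrier [simp]:
  "A \<in> carrier_mat n m \<Longrightarrow> mat_adjoint A \<in> carrier_mat m n"
  unfolding mat_adjoint_def by (auto simp: mat_of_rows_def)

lemma dim_mat_adjoint [simp]:
  "dim_row (mat_adjoint A) = dim_col A" "dim_col (mat_adjoint A) = dim_row A"
  unfolding mat_adjoint_def by (auto simp: mat_of_rows_def)

lemma index_mat_adjoint [simp]:
  fixes A :: "complex mat"
  assumes "i < dim_col A" "j < dim_row A"
  shows "mat_adjoint A $$ (i, j) = cnj (A $$ (j, i))"
  using assms unfolding mat_adjoint_def by (auto simp: mat_of_rows_def)

lemma mat_adjoint_adjoint [simp]: "mat_adjoint (mat_adjoint (A :: complex mat)) = A"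
  by (rule eq_matI) auto

lemma index_mult_mat_sum:
  "i < dim_row A \<Longrightarrow> j < dim_col B \<Longrightarrow> dim_row B = dim_col A \<Longrightarrow>
   (A * B) $$ (i, j) = (\<Sum>k<dim_col A. A $$ (i, k) * B $$ (k, j))"
  by (auto simp: scalar_prod_def atLeast0LessThan intro!: sum.cong)

lemma mat_adjoint_mult:
  fixes A B :: "complex mat"
  assumes "A \<in> carrier_mat n m" "B \<in> carrier_mat m p"
  shows "mat_adjoint (A * B) = mat_adjoint B * mat_adjoint A"
proof (rule eq_matI)
  fix i j assume ij: "i < dim_row (mat_adjoint B * mat_adjoint A)" "j < dim_col (mat_adjoint B * mat_adjoint A)"
  then have "mat_adjoint (A * B) $$ (i, j) = cnj ((A * B) $$ (j, i))"
    using assms by auto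
  also have "\<dots> = (\<Sum>k<m. cnj (A $$ (j, k)) * cnj (B $$ (k, i)))"
    using assms ij by (subst index_mult_mat_sum) (auto simp: cnj_sum)
  also have "\<dots> = (mat_adjoint B * mat_adjoint A) $$ (i, j)"
    using assms ij by (subst index_mult_mat_sum) (auto intro!: sum.cong)
  finally show "mat_adjoint (A * B) $$ (i, j) = (mat_adjoint B * mat_adjoint A) $$ (i, j)" .
qed (use assms in auto)

lemma unitary_groupD:
  assumes "V \<in> unitary_group n"
  shows "V \<in> carrier_mat n n" "mat_adjoint V * V = 1\<^sub>m n" "V * mat_adjoint V = 1\<^sub>m n"
  using assms unfolding unitary_group_def by auto

lemma unitary_groupI:
  fixes V :: "complex mat"
  assumes "V \<in> carrier_mat n n" "mat_adjoint V * V = 1\<^sub>m n"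
  shows "V \<in> unitary_group n"
  using assms mat_mult_left_right_inverse[of "mat_adjoint V" n V] unfolding unitary_group_def by auto

lemma unitary_group_mult:
  assumes "V \<in> unitary_group n" "W \<in> unitary_group n"
  shows "V * W \<in> unitary_group n"
proof (rule unitary_groupI)
  note V = unitary_groupD[OF assms(1)] and W = unitary_groupD[OF assms(2)]
  show "V * W \<in> carrier_mat n n" using V W by auto
  have "mat_adjoint (V * W) * (V * W) = mat_adjoint W * (mat_adjoint V * V) * W"
    using V(1) W(1) mat_adjoint_carrier[OF V(1)] mat_adjoint_carrier[OF W(1)]
    by (simp add: mat_adjoint_mult[of _ n n _ n] assoc_mult_mat[of _ n n _ n _ n]
        mult_carrier_mat[of _ n n _ n] del: assoc_mult_mat)
  then show "mat_adjoint (V * W) * (V * W) = 1\<^sub>m n"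
    using V W by simp
qed

text \<open>Gram-Schmidt keeps the head of its list and returns orthogonal columns that are not
  normalised; dividing each by its length gives a unitary matrix. The scalar \<open>c\<close> stays
  unspecified because an eigenvector equation does not see it.\<close>

lemma unitary_with_first_column:
  fixes v :: "complex Matrix.vec"
  assumes v: "v \<in> carrier_vec n" and v0: "v \<noteq> 0\<^sub>v n"
  obtains U c where "U \<in> unitary_group n" "\<And>i. i < n \<Longrightarrow> U $$ (i, 0) = c * vec_index v i"
proof -
  have n: "n \<noteq> 0"
    using assms by (metis carrier_vecD eq_vecI index_zero_vec(2) less_zeroE)
  interpret cof_vec_space n "TYPE(complex)" .
  define b where "b = basis_completion v"
  define ws where "ws = gram_schmidt n b"
  define W where "W = mat_of_cols n ws"
  from basis_completion[OF v v0, folded b_def]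
  have span_b: "span (set b) = carrier_vec n" and dist_b: "distinct b"
    and indep: "\<not> lin_dep (set b)" and b: "set b \<subseteq> carrier_vec n" and hdb: "hd b = v"
    and len_b: "length b = n" by auto
  from hdb len_b n obtain vs where bv: "b = v # vs" by (cases b, auto)
  from gram_schmidt_result[OF b dist_b indep refl, folded ws_def]
  have ws: "set ws \<subseteq> carrier_vec n" "corthogonal ws" "length ws = n"
    by (auto simp: len_b)
  from gram_schmidt_hd[OF v, of vs, folded bv] have hdws: "hd ws = v" unfolding ws_def .
  have ws0: "ws ! 0 = v" using hdws ws n by (cases ws) auto
  have W: "W \<in> carrier_mat n n" using ws unfolding W_def by auto
  have wsn: "ws ! i \<in> carrier_vec n" if "i < n" for i using ws that by auto
  have Wi: "W $$ (l, i) = vec_index (ws ! i) l" if "l < n" "i < n" for l i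
    using that ws unfolding W_def by (simp add: mat_of_cols_index)
  define g where "g i = (\<Sum>l<n. (cmod (W $$ (l, i)))\<^sup>2)" for i
  have sp: "scalar_prod (ws ! j) (conjugate (ws ! i)) = (\<Sum>l<n. W $$ (l, j) * cnj (W $$ (l, i)))"
    if "i < n" "j < n" for i j
    using that wsn[of i] wsn[of j] by (auto simp: scalar_prod_def Wi atLeast0LessThan intro!: sum.cong)
  have orth: "(\<Sum>l<n. W $$ (l, j) * cnj (W $$ (l, i))) = 0 \<longleftrightarrow> i \<noteq> j" if "i < n" "j < n" for i j
    using corthogonalD[OF ws(2), of j i] that ws(3) sp[of i j] by auto
  have diag: "(\<Sum>l<n. W $$ (l, i) * cnj (W $$ (l, i))) = complex_of_real (g i)" for i
    unfolding g_def of_real_sum by (intro sum.cong refl) (simp add: complex_norm_square del: of_real_power)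
  have g: "g i > 0" if "i < n" for i
  proof -
    have "g i \<ge> 0" unfolding g_def by (intro sum_nonneg) auto
    moreover have "g i \<noteq> 0" using orth[of i i] diag[of i] that by auto
    ultimately show ?thesis by linarith
  qed
  define U where "U = Matrix.mat n n (\<lambda>(l, i). W $$ (l, i) / complex_of_real (sqrt (g i)))"
  have "mat_adjoint U * U = 1\<^sub>m n"
  proof (rule eq_matI)
    fix i j assume "i < dim_row (1\<^sub>m n)" "j < dim_col (1\<^sub>m n)"
    then have ij: "i < n" "j < n" by auto
    have "(mat_adjoint U * U) $$ (i, j) = (\<Sum>l<n. cnj (U $$ (l, i)) * U $$ (l, j))"
      using ij by (subst index_mult_mat_sum) (auto simp: U_def)
    also have "\<dots> = (\<Sum>l<n. W $$ (l, j) * cnj (W $$ (l, i))) / complex_of_real (sqrt (g i) * sqrt (g j))"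
      using ij by (auto simp: U_def sum_divide_distrib field_simps intro!: sum.cong)
    also have "\<dots> = 1\<^sub>m n $$ (i, j)"
    proof (cases "i = j")
      case True
      then show ?thesis using ij g[of i] by (simp add: diag flip: of_real_mult)
    next
      case False
      then show ?thesis using ij orth[of i j] by simp
    qed
    finally show "(mat_adjoint U * U) $$ (i, j) = 1\<^sub>m n $$ (i, j)" .
  qed (auto simp: U_def)
  then have "U \<in> unitary_group n" by (intro unitary_groupI) (auto simp: U_def)
  moreover have "U $$ (i, 0) = (1 / complex_of_real (sqrt (g 0))) * vec_index v i" if "i < n" for i
    using that n ws0 by (simp add: U_def Wi)
  ultimately show thesis by (rule that)
qed

lemma mat_adjoint_four_block:
  fixes A :: "complex mat"
  assumes "A \<in> carrier_mat a b" "D \<in> carrier_mat c d"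
  shows "mat_adjoint (four_block_mat A (0\<^sub>m a d) (0\<^sub>m c b) D) =
    four_block_mat (mat_adjoint A) (0\<^sub>m b c) (0\<^sub>m d a) (mat_adjoint D)"
  using assms by (intro eq_matI) auto

lemma triple_mult_assoc:
  assumes "U \<in> carrier_mat p n" "V \<in> carrier_mat n n" "D \<in> carrier_mat n n"
    "V' \<in> carrier_mat n n" "U' \<in> carrier_mat n q"
  shows "U * (V * D * V') * U' = U * V * D * (V' * U')"
proof -
  have "U * (V * D * V') * U' = U * (V * D * V' * U')"
    using assms by (intro assoc_mult_mat[of _ p n _ n _ q]) auto
  also have "V * D * V' * U' = V * D * (V' * U')"
    using assms by (intro assoc_mult_mat[of _ n n _ n _ q]) auto
  also have "U * (V * D * (V' * U')) = U * (V * D) * (V' * U')"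
    using assms by (intro assoc_mult_mat[of _ p n _ n _ q, symmetric]) auto
  also have "U * (V * D) = U * V * D"
    using assms by (intro assoc_mult_mat[of _ p n _ n _ n, symmetric]) auto
  finally show ?thesis .
qed

lemma block_diag_mult:
  assumes "A \<in> carrier_mat a a" "A' \<in> carrier_mat a a" "D \<in> carrier_mat d d" "D' \<in> carrier_mat d d"
  shows "four_block_mat A (0\<^sub>m a d) (0\<^sub>m d a) D * four_block_mat A' (0\<^sub>m a d) (0\<^sub>m d a) D' =
    four_block_mat (A * A') (0\<^sub>m a d) (0\<^sub>m d a) (D * D')"
  using assms by (subst mult_four_block_mat[of _ a a _ d _ d _ _ a _ d]) auto

text \<open>Deflation: conjugating by a unitary matrix with an eigenvector in its first column
  clears that column below the corner. Being Hermitian, the conjugated matrix also has a cleared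
  first row, so a Hermitian block of size \<open>k\<close> is left for the induction.\<close>

theorem hermitian_diagonalisation:
  fixes A :: "complex mat"
  assumes "A \<in> carrier_mat n n" "mat_adjoint A = A"
  shows "\<exists>V\<in>unitary_group n. \<exists>d :: nat \<Rightarrow> real.
    A = V * mat_diag n (\<lambda>i. complex_of_real (d i)) * mat_adjoint V"
  using assms
proof (induction n arbitrary: A)
  case 0
  then show ?case
    by (intro bexI[of _ "1\<^sub>m 0"] exI) (auto simp: unitary_group_def intro!: eq_matI)
next
  case (Suc k)
  note A = Suc.prems(1) and herm = Suc.prems(2)
  obtain e v where "eigenvector A v e"
    using spectrum_non_empty[OF A] unfolding spectrum_def eigenvalue_def by auto
  then have v: "v \<in> carrier_vec (Suc k)" "v \<noteq> 0\<^sub>v (Suc k)" and ev: "A *\<^sub>v v = e \<cdot>\<^sub>v v"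
    using A unfolding eigenvector_def by auto
  obtain U c where U: "U \<in> unitary_group (Suc k)"
    and U0: "\<And>i. i < Suc k \<Longrightarrow> U $$ (i, 0) = c * vec_index v i"
    using unitary_with_first_column[OF v] by blast
  note UU = unitary_groupD[OF U]
  define B where "B = mat_adjoint U * A * U"
  have B: "B \<in> carrier_mat (1 + k) (1 + k)" using UU A unfolding B_def by auto
  have hB: "mat_adjoint B = B"
    using UU(1) A herm mat_adjoint_carrier[OF UU(1)] unfolding B_def
    by (simp add: mat_adjoint_mult[of _ "Suc k" "Suc k" _ "Suc k"]
        assoc_mult_mat[of _ "Suc k" "Suc k" _ "Suc k" _ "Suc k"]
        mult_carrier_mat[of _ "Suc k" "Suc k" _ "Suc k"] del: assoc_mult_mat)
  have AU0: "(A * U) $$ (l, 0) = e * U $$ (l, 0)" if "l < Suc k" for l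
  proof -
    have "(A * U) $$ (l, 0) = (\<Sum>i<Suc k. A $$ (l, i) * (c * vec_index v i))"
      using that A UU(1) by (subst index_mult_mat_sum) (auto simp: U0 simp del: sum.lessThan_Suc)
    also have "\<dots> = c * vec_index (A *\<^sub>v v) l"
      using that A v(1) by (auto simp: scalar_prod_def sum_distrib_left atLeast0LessThan ac_simps
          intro!: sum.cong simp del: sum.lessThan_Suc sum.op_ivl_Suc)
    finally show ?thesis using that v(1) U0[OF that] by (simp add: ev)
  qed
  have B0: "B $$ (i, 0) = (if i = 0 then e else 0)" if "i < 1 + k" for i
  proof -
    have "B $$ (i, 0) = (mat_adjoint U * (A * U)) $$ (i, 0)"
      using UU(1) A unfolding B_def
      by (subst assoc_mult_mat[of _ "Suc k" "Suc k" _ "Suc k" _ "Suc k"]) auto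
    also have "\<dots> = (\<Sum>l<Suc k. mat_adjoint U $$ (i, l) * (e * U $$ (l, 0)))"
      using that A UU(1) by (subst index_mult_mat_sum) (auto simp: AU0 simp del: sum.lessThan_Suc index_mult_mat(1) intro!: sum.cong)
    also have "\<dots> = e * (mat_adjoint U * U) $$ (i, 0)"
      using that A UU(1) by (subst index_mult_mat_sum)
        (auto simp: sum_distrib_left ac_simps simp del: sum.lessThan_Suc intro!: sum.cong)
    finally show ?thesis using UU(2) that by simp
  qed
  have B0': "B $$ (0, j) = (if j = 0 then e else 0)" if "j < 1 + k" for j
  proof -
    have "B $$ (0, j) = cnj (B $$ (j, 0))"
      using B that hB index_mat_adjoint[of 0 B j] by auto
    moreover have "cnj e = e" using B hB index_mat_adjoint[of 0 B 0] B0[of 0] by auto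
    ultimately show ?thesis using B0[OF that] by auto
  qed
  \<comment> \<open>The corner entry of a Hermitian matrix is its own conjugate, so the eigenvalue
    is real, as the real-valued \<open>d1\<close> requires.\<close>
  have e: "complex_of_real (Re e) = e"
    using B hB index_mat_adjoint[of 0 B 0] B0[of 0]
    by (auto simp: complex_eq_iff)
  define B3 where "B3 = Matrix.mat k k (\<lambda>(i, j). B $$ (Suc i, Suc j))"
  have B3: "B3 \<in> carrier_mat k k" by (simp add: B3_def)
  have "mat_adjoint B3 = B3"
  proof (rule eq_matI)
    fix i j assume "i < dim_row B3" "j < dim_col B3"
    then have ij: "i < k" "j < k" by (auto simp: B3_def)
    have "cnj (B $$ (Suc j, Suc i)) = B $$ (Suc i, Suc j)"
      using B ij hB index_mat_adjoint[of "Suc i" B "Suc j"] by auto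
    then show "mat_adjoint B3 $$ (i, j) = B3 $$ (i, j)" using ij by (simp add: B3_def)
  qed (auto simp: B3_def)
  from Suc.IH[OF B3 this] obtain V d where V: "V \<in> unitary_group k"
    and d: "B3 = V * mat_diag k (\<lambda>i. complex_of_real (d i)) * mat_adjoint V" by auto
  note VV = unitary_groupD[OF V]
  define E where "E = Matrix.mat 1 1 (\<lambda>_. e)"
  define V1 where "V1 = four_block_mat (1\<^sub>m 1) (0\<^sub>m 1 k) (0\<^sub>m k 1) V"
  define d1 where "d1 i = (case i of 0 \<Rightarrow> Re e | Suc i \<Rightarrow> d i)" for i
  have Bfb: "B = four_block_mat E (0\<^sub>m 1 k) (0\<^sub>m k 1) B3"
    using B by (intro eq_matI) (auto simp: E_def B3_def B0 B0')
  have D1: "mat_diag (Suc k) (\<lambda>i. complex_of_real (d1 i)) =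
      four_block_mat E (0\<^sub>m 1 k) (0\<^sub>m k 1) (mat_diag k (\<lambda>i. complex_of_real (d i)))"
    using e by (intro eq_matI) (auto simp: mat_diag_def E_def d1_def split: nat.splits)
  have adj1: "mat_adjoint (1\<^sub>m 1 :: complex mat) = 1\<^sub>m 1" by (intro eq_matI) auto
  have V1c: "V1 \<in> carrier_mat (Suc k) (Suc k)" unfolding V1_def using four_block_carrier_mat[of "1\<^sub>m 1" 1 1 V k k] VV(1) by simp
  have aV1: "mat_adjoint V1 = four_block_mat (1\<^sub>m 1) (0\<^sub>m 1 k) (0\<^sub>m k 1) (mat_adjoint V)"
    unfolding V1_def using mat_adjoint_four_block[OF one_carrier_mat VV(1), of 1] by (simp add: adj1[simplified])
  have V1: "V1 \<in> unitary_group (Suc k)"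
  proof (rule unitary_groupI[OF V1c])
    show "mat_adjoint V1 * V1 = 1\<^sub>m (Suc k)"
      unfolding aV1 unfolding V1_def using VV
      by (subst mult_four_block_mat[of _ 1 1 _ k _ k _ _ 1 _ k]) auto
  qed
  have hB1: "B = V1 * mat_diag (Suc k) (\<lambda>i. complex_of_real (d1 i)) * mat_adjoint V1"
    unfolding aV1 D1 Bfb d unfolding V1_def using VV(1)
    by (simp add: block_diag_mult[of _ 1 _ _ k] E_def mult_carrier_mat[of _ k k _ k] del: assoc_mult_mat One_nat_def)
  have hA: "A = U * B * mat_adjoint U"
  proof -
    have "U * B * mat_adjoint U = (U * mat_adjoint U) * A * (U * mat_adjoint U)"
      unfolding B_def by (intro triple_mult_assoc[of _ "Suc k" "Suc k" _ _ _ _ "Suc k"] UU(1) A mat_adjoint_carrier)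
    then show ?thesis using UU A by simp
  qed
  have "A = U * (V1 * mat_diag (Suc k) (\<lambda>i. complex_of_real (d1 i)) * mat_adjoint V1) * mat_adjoint U"
    by (rule hA[unfolded hB1])
  also have "\<dots> = (U * V1) * mat_diag (Suc k) (\<lambda>i. complex_of_real (d1 i)) * mat_adjoint (U * V1)"
    unfolding mat_adjoint_mult[OF UU(1) V1c]
    by (intro triple_mult_assoc[of _ "Suc k" "Suc k" _ _ _ _ "Suc k"] UU(1) V1c mat_diag_dim mat_adjoint_carrier)
  finally show ?case using unitary_group_mult[OF U V1] by blast
qed

section \<open>Traces, eigenvalues and the functional calculus of Gram matrices\<close>

lemma mat_trace_eq: "A \<in> carrier_mat n m \<Longrightarrow> mat_trace A = (\<Sum>i<n. A $$ (i, i))"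
  unfolding mat_trace_def by auto

lemma mat_trace_comm:
  assumes "A \<in> carrier_mat n m" "B \<in> carrier_mat m n"
  shows "mat_trace (A * B) = mat_trace (B * A)"
proof -
  have "mat_trace (A * B) = (\<Sum>i<n. \<Sum>k<m. A $$ (i, k) * B $$ (k, i))"
    using assms by (subst mat_trace_eq[of _ n n]) (auto simp: index_mult_mat_sum simp del: index_mult_mat(1) intro!: sum.cong)
  also have "\<dots> = (\<Sum>k<m. \<Sum>i<n. B $$ (k, i) * A $$ (i, k))"
    by (subst sum.swap) (simp add: ac_simps)
  also have "\<dots> = mat_trace (B * A)"
    using assms by (subst mat_trace_eq[of _ m m]) (auto simp: index_mult_mat_sum simp del: index_mult_mat(1) intro!: sum.cong)
  finally show ?thesis .
qed

lemma mat_adjoint_mult_self: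
  fixes M X :: "complex mat"
  assumes M: "M \<in> carrier_mat m n" and X: "X \<in> carrier_mat n p"
  shows "mat_adjoint (M * X) * (M * X) = mat_adjoint X * (mat_adjoint M * M) * X"
proof -
  note a = mat_adjoint_carrier[OF M] mat_adjoint_carrier[OF X]
  have "mat_adjoint (M * X) * (M * X) = mat_adjoint X * (mat_adjoint M * (M * X))"
    unfolding mat_adjoint_mult[OF M X] using a M X by (intro assoc_mult_mat[of _ p n _ m _ p]) auto
  also have "mat_adjoint M * (M * X) = mat_adjoint M * M * X"
    using a M X by (intro assoc_mult_mat[of _ n m _ n _ p, symmetric]) auto
  also have "mat_adjoint X * \<dots> = mat_adjoint X * (mat_adjoint M * M) * X"
    using a M X by (intro assoc_mult_mat[of _ p n _ n _ p, symmetric]) auto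
  finally show ?thesis .
qed

definition unitary_diag :: "nat \<Rightarrow> complex mat \<Rightarrow> (nat \<Rightarrow> real) \<Rightarrow> complex mat" where
  "unitary_diag n V d = V * mat_diag n (\<lambda>i. complex_of_real (d i)) * mat_adjoint V"

lemma unitary_diag_carrier [simp]:
  "V \<in> unitary_group n \<Longrightarrow> unitary_diag n V d \<in> carrier_mat n n"
  unfolding unitary_diag_def using unitary_groupD(1)[of V n]
  by (auto intro!: mult_carrier_mat[of _ n n _ n])

lemma adjoint_mult_unitary_diag:
  assumes V: "V \<in> unitary_group n" and X: "X \<in> carrier_mat n p"
  shows "mat_adjoint X * unitary_diag n V d * X =
    mat_adjoint (mat_adjoint V * X) * mat_diag n (\<lambda>i. complex_of_real (d i)) * (mat_adjoint V * X)"
proof -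
  have "mat_adjoint (mat_adjoint V * X) = mat_adjoint X * V"
    using X unitary_groupD(1)[OF V] by (simp add: mat_adjoint_mult[of _ n n _ p])
  then show ?thesis
    unfolding unitary_diag_def using X unitary_groupD(1)[OF V]
    by (simp only:) (intro triple_mult_assoc[of _ p n _ _ _ _ p] mat_adjoint_carrier mat_diag_dim)
qed

text \<open>Together with \<open>adjoint_mult_unitary_diag\<close> this evaluates the quadratic form
  of a diagonalised matrix as an eigenvalue-weighted sum of squares, the source of the sign and size
  estimates below.\<close>

lemma adjoint_diag_mult_index:
  fixes Z :: "complex mat"
  assumes "Z \<in> carrier_mat n p" "i < p"
  shows "(mat_adjoint Z * mat_diag n (\<lambda>i. complex_of_real (d i)) * Z) $$ (i, i) =
    complex_of_real (\<Sum>l<n. d l * (cmod (Z $$ (l, i)))\<^sup>2)"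
proof -
  have "(mat_adjoint Z * mat_diag n (\<lambda>i. complex_of_real (d i)) * Z) $$ (i, i) =
      (\<Sum>l<n. (cnj (Z $$ (l, i)) * d l) * Z $$ (l, i))"
    using assms by (subst mat_diag_mult_right[of _ p n], simp, subst index_mult_mat_sum) auto
  also have "\<dots> = (\<Sum>l<n. complex_of_real (d l * (cmod (Z $$ (l, i)))\<^sup>2))"
    by (intro sum.cong refl) (simp add: complex_norm_square ac_simps del: of_real_power)
  finally show ?thesis by simp
qed

lemma diag_conj_unitary_diag:
  assumes V: "V \<in> unitary_group n"
  shows "mat_adjoint V * unitary_diag n V d * V = mat_diag n (\<lambda>i. complex_of_real (d i))"
proof -
  have "mat_adjoint (1\<^sub>m n :: complex mat) = 1\<^sub>m n" by (intro eq_matI) auto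
  then show ?thesis
    using mat_diag_dim[of n "\<lambda>i. complex_of_real (d i)"] unitary_groupD[OF V]
    by (simp add: adjoint_mult_unitary_diag[OF V unitary_groupD(1)[OF V]]
       left_mult_one_mat[of _ n n] right_mult_one_mat[of _ n n] del: mat_diag_dim)
qed

lemma unitary_diag_mult:
  assumes V: "V \<in> unitary_group n"
  shows "unitary_diag n V d * unitary_diag n V e = unitary_diag n V (\<lambda>i. d i * e i)"
proof -
  let ?D = "\<lambda>d. mat_diag n (\<lambda>i. complex_of_real (d i))"
  note c = unitary_groupD(1)[OF V] mat_adjoint_carrier[OF unitary_groupD(1)[OF V]]
    mat_diag_dim[of n "\<lambda>i. complex_of_real (d i)"] mat_diag_dim[of n "\<lambda>i. complex_of_real (e i)"]
  have "unitary_diag n V d * unitary_diag n V e = V * (?D d * (mat_adjoint V * V) * ?D e) * mat_adjoint V"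
    unfolding unitary_diag_def using c
    by (simp add: assoc_mult_mat[of _ n n _ n _ n] mult_carrier_mat[of _ n n _ n] del: assoc_mult_mat mat_diag_dim mat_diag_diag)
  also have "\<dots> = unitary_diag n V (\<lambda>i. d i * e i)"
    unfolding unitary_diag_def unitary_groupD(2)[OF V] using c
    by (simp add: right_mult_one_mat[of _ n n] del: mat_diag_dim)
  finally show ?thesis .
qed

lemma unitary_diag_pow:
  assumes V: "V \<in> unitary_group n"
  shows "unitary_diag n V d ^\<^sub>m k = unitary_diag n V (\<lambda>i. d i ^ k)"
proof (induction k)
  case 0
  have "V * 1\<^sub>m n * mat_adjoint V = 1\<^sub>m n"
    using unitary_groupD[OF V] by (simp add: right_mult_one_mat[of _ n n])
  then show ?case using unitary_diag_carrier[OF V, of d] unitary_groupD(1)[OF V] by (simp add: unitary_diag_def)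
next
  case (Suc k)
  then show ?case by (simp add: unitary_diag_mult[OF V] ac_simps)
qed

lemma trace_unitary_diag:
  assumes V: "V \<in> unitary_group n"
  shows "mat_trace (unitary_diag n V d) = complex_of_real (\<Sum>i<n. d i)"
proof -
  let ?D = "mat_diag n (\<lambda>i. complex_of_real (d i))"
  note c = unitary_groupD(1)[OF V] mat_adjoint_carrier[OF unitary_groupD(1)[OF V]] mat_diag_dim[of n "\<lambda>i. complex_of_real (d i)"]
  have "mat_trace (unitary_diag n V d) = mat_trace (mat_adjoint V * (V * ?D))"
    unfolding unitary_diag_def using c by (intro mat_trace_comm[of _ n n]) auto
  also have "mat_adjoint V * (V * ?D) = (mat_adjoint V * V) * ?D"
    using c by (simp add: assoc_mult_mat[of _ n n _ n _ n] del: assoc_mult_mat mat_diag_dim)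
  also have "\<dots> = ?D" unfolding unitary_groupD(2)[OF V] using c by (simp del: mat_diag_dim)
  also have "mat_trace ?D = complex_of_real (\<Sum>i<n. d i)"
    by (auto simp: mat_trace_def mat_diag_def)
  finally show ?thesis .
qed

text \<open>Each \<open>e i\<close> is a combination of the \<open>d l\<close> whose weights are
  squared absolute values of entries of the change of basis. Nonnegativity thus passes between
  diagonalisations without comparing eigenvalues one by one.\<close>

lemma unitary_diag_nonneg_unique:
  assumes "V \<in> unitary_group n" "W \<in> unitary_group n"
    and eq: "unitary_diag n V d = unitary_diag n W e" and d: "\<And>i. i < n \<Longrightarrow> d i \<ge> 0" and i: "i < n"
  shows "e i \<ge> 0"
proof -
  let ?Z = "mat_adjoint V * W"
  have "complex_of_real (e i) = (mat_adjoint W * unitary_diag n V d * W) $$ (i, i)"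
    unfolding eq diag_conj_unitary_diag[OF assms(2)] using i by (simp add: mat_diag_def)
  also have "\<dots> = complex_of_real (\<Sum>l<n. d l * (cmod (?Z $$ (l, i)))\<^sup>2)"
    using adjoint_diag_mult_index[of ?Z n n i d] i unitary_groupD(1)[OF assms(1)] unitary_groupD(1)[OF assms(2)]
    by (simp add: adjoint_mult_unitary_diag[OF assms(1) unitary_groupD(1)[OF assms(2)]] mult_carrier_mat[of _ n n _ n]
      del: of_real_sum)
  finally have "e i = (\<Sum>l<n. d l * (cmod (?Z $$ (l, i)))\<^sup>2)" using of_real_eq_iff by blast
  also have "\<dots> \<ge> 0" by (intro sum_nonneg mult_nonneg_nonneg d) auto
  finally show ?thesis .
qed

text \<open>The eigenvalue \<open>d i\<close> is the squared length of the \<open>i\<close>-th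
  column of \<open>M * V\<close>.\<close>

lemma gram_unitary_diag:
  fixes M :: "complex mat"
  assumes M: "M \<in> carrier_mat n n"
  obtains V d where "V \<in> unitary_group n" "mat_adjoint M * M = unitary_diag n V d" "\<And>i. i < n \<Longrightarrow> d i \<ge> 0"
proof -
  have "mat_adjoint (mat_adjoint M * M) = mat_adjoint M * M"
    using M by (simp add: mat_adjoint_mult[of _ n n _ n])
  then obtain V d where V: "V \<in> unitary_group n" and d: "mat_adjoint M * M = unitary_diag n V d"
    using hermitian_diagonalisation[of "mat_adjoint M * M" n] mult_carrier_mat[of "mat_adjoint M" n n M n] M
    unfolding unitary_diag_def by auto
  have "d i \<ge> 0" if i: "i < n" for i
  proof -
    note c = unitary_groupD(1)[OF V] mat_adjoint_carrier[OF unitary_groupD(1)[OF V]] M mat_adjoint_carrier[OF M]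
    have "complex_of_real (d i) = (mat_adjoint V * (mat_adjoint M * M) * V) $$ (i, i)"
      unfolding d diag_conj_unitary_diag[OF V] using i by (simp add: mat_diag_def)
    also have "mat_adjoint V * (mat_adjoint M * M) * V = mat_adjoint (M * V) * mat_diag n (\<lambda>i. complex_of_real 1) * (M * V)"
      using c by (simp add: mat_adjoint_mult[of _ n n _ n] assoc_mult_mat[of _ n n _ n _ n] mult_carrier_mat[of _ n n _ n]
         right_mult_one_mat[of _ n n] del: assoc_mult_mat)
    also have "\<dots> $$ (i, i) = complex_of_real (\<Sum>l<n. 1 * (cmod ((M * V) $$ (l, i)))\<^sup>2)"
      using c i by (intro adjoint_diag_mult_index[of _ n n]) auto
    finally have "d i = (\<Sum>l<n. 1 * (cmod ((M * V) $$ (l, i)))\<^sup>2)" using of_real_eq_iff by blast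
    then show ?thesis by (auto intro: sum_nonneg)
  qed
  then show thesis using that V d by blast
qed

text \<open>\<open>herm_fun\<close> chooses its value with \<open>SOME\<close>, so the
  diagonalisation behind it may differ from the one at hand; all that can be extracted is that some
  \<open>W\<close> and \<open>e\<close> lie behind it.\<close>

lemma herm_fun_spec:
  assumes V: "V \<in> unitary_group n"
  obtains W e where "W \<in> unitary_group n" "unitary_diag n V d = unitary_diag n W e"
    "herm_fun f (unitary_diag n V d) = unitary_diag n W (\<lambda>i. f (e i))"
proof -
  let ?A = "unitary_diag n V d"
  let ?P = "\<lambda>B. \<exists>W\<in>unitary_group n. \<exists>e. ?A = unitary_diag n W e \<and> B = unitary_diag n W (\<lambda>i. f (e i))"
  have dim: "dim_row ?A = n" using unitary_diag_carrier[OF V, of d] by auto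
  have "herm_fun f ?A = (SOME B. ?P B)"
    unfolding herm_fun_def dim unfolding unitary_diag_def ..
  moreover have "?P (SOME B. ?P B)" by (rule someI_ex) (use V in blast)
  ultimately show thesis using that by auto
qed

text \<open>The two applications of \<open>herm_fun\<close> bring unrelated diagonalisations. They
  are compared through integer matrix powers, which depend on the matrix only; the even exponent
  removes the square roots. Nonnegative eigenvalues and \<open>m \<ge> 1\<close> turn
  \<open>powr\<close> into an ordinary power.\<close>

lemma trace_powr_mat_abs:
  fixes M :: "complex mat"
  assumes M: "M \<in> carrier_mat n n" and m: "m \<ge> 1"
  shows "mat_trace (mat_powr (mat_abs M) (2 * real m)) = mat_trace ((mat_adjoint M * M) ^\<^sub>m m)"
    and "Re (mat_trace ((mat_adjoint M * M) ^\<^sub>m m)) \<ge> 0"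
proof -
  obtain V0 d0 where V0: "V0 \<in> unitary_group n" and d0: "mat_adjoint M * M = unitary_diag n V0 d0"
    "\<And>i. i < n \<Longrightarrow> d0 i \<ge> 0" using gram_unitary_diag[OF M] by blast
  obtain V d where V: "V \<in> unitary_group n" and eqd: "mat_adjoint M * M = unitary_diag n V d"
    and abs: "mat_abs M = unitary_diag n V (\<lambda>i. sqrt (d i))"
    unfolding mat_abs_def d0(1) by (rule herm_fun_spec[OF V0, of d0 sqrt])
  have d: "d i \<ge> 0" if "i < n" for i
    using unitary_diag_nonneg_unique[OF V0 V _ d0(2) that] d0(1) eqd by simp
  obtain W e where W: "W \<in> unitary_group n" and eqe: "unitary_diag n V (\<lambda>i. sqrt (d i)) = unitary_diag n W e"
    and pow: "mat_powr (mat_abs M) (2 * real m) = unitary_diag n W (\<lambda>i. e i powr (2 * real m))"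
    unfolding mat_powr_def abs by (rule herm_fun_spec[OF V, of "\<lambda>i. sqrt (d i)" "\<lambda>t. t powr (2 * real m)"])
  have e: "e i \<ge> 0" if "i < n" for i
    by (rule unitary_diag_nonneg_unique[OF V W eqe _ that]) (auto simp: d)
  have "e i powr (2 * real m) = e i ^ (2 * m)" if "i < n" for i
    using e[OF that] powr_realpow'[of "e i" "2 * m"] m by simp
  then have "mat_trace (mat_powr (mat_abs M) (2 * real m)) = complex_of_real (\<Sum>i<n. e i ^ (2 * m))"
    unfolding pow trace_unitary_diag[OF W] by simp
  also have "\<dots> = mat_trace (unitary_diag n W e ^\<^sub>m (2 * m))"
    by (simp add: unitary_diag_pow[OF W] trace_unitary_diag[OF W])
  also have "\<dots> = complex_of_real (\<Sum>i<n. sqrt (d i) ^ (2 * m))"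
    unfolding eqe[symmetric] by (simp add: unitary_diag_pow[OF V] trace_unitary_diag[OF V])
  also have "\<dots> = complex_of_real (\<Sum>i<n. d i ^ m)"
    by (auto simp: power_mult d)
  also have "\<dots> = mat_trace ((mat_adjoint M * M) ^\<^sub>m m)"
    unfolding eqd by (simp add: unitary_diag_pow[OF V] trace_unitary_diag[OF V])
  finally show "mat_trace (mat_powr (mat_abs M) (2 * real m)) = mat_trace ((mat_adjoint M * M) ^\<^sub>m m)" .
  show "Re (mat_trace ((mat_adjoint M * M) ^\<^sub>m m)) \<ge> 0"
    unfolding eqd by (auto simp: unitary_diag_pow[OF V] trace_unitary_diag[OF V] d intro!: sum_nonneg)
qed

text \<open>The \<open>m\<close>-th power of each eigenvalue of the Gram matrix is one summand of a
  trace with nonnegative summands, so each eigenvalue is at most the \<open>m\<close>-th root of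
  that trace. Vectors are one-column matrices so that the adjoint lemmas apply to them.\<close>

lemma norm_mult_vector_le:
  fixes M X :: "complex mat"
  assumes M: "M \<in> carrier_mat n n" and X: "X \<in> carrier_mat n 1" and m: "m \<ge> 1"
  shows "(\<Sum>i<n. (cmod ((M * X) $$ (i, 0)))\<^sup>2) \<le>
    root m (Re (mat_trace ((mat_adjoint M * M) ^\<^sub>m m))) * (\<Sum>i<n. (cmod (X $$ (i, 0)))\<^sup>2)"
proof -
  obtain V d where V: "V \<in> unitary_group n" and eqd: "mat_adjoint M * M = unitary_diag n V d"
    and d: "\<And>i. i < n \<Longrightarrow> d i \<ge> 0" using gram_unitary_diag[OF M] by blast
  let ?t = "Re (mat_trace ((mat_adjoint M * M) ^\<^sub>m m))"
  let ?Z = "mat_adjoint V * X"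
  note VV = unitary_groupD[OF V]
  note c = VV(1) mat_adjoint_carrier[OF VV(1)] M mat_adjoint_carrier[OF M] X mat_adjoint_carrier[OF X]
  have t: "?t = (\<Sum>i<n. d i ^ m)"
    unfolding eqd by (simp add: unitary_diag_pow[OF V] trace_unitary_diag[OF V])
  have dr: "d i \<le> root m ?t" if "i < n" for i
  proof -
    have "d i ^ m \<le> (\<Sum>i<n. d i ^ m)" using that d by (intro member_le_sum) auto
    then have "root m (d i ^ m) \<le> root m ?t" unfolding t using m by simp
    then show ?thesis using d[OF that] m by (simp add: real_root_power_cancel)
  qed
  have one: "(\<Sum>i<n. (cmod (Z $$ (i, 0)))\<^sup>2) = Re ((mat_adjoint Z * Z) $$ (0, 0))"
    if Z: "Z \<in> carrier_mat n 1" for Z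
    using adjoint_diag_mult_index[OF Z, of 0 "\<lambda>_. 1"] Z by (simp add: right_mult_one_mat[of _ 1 n])
  have "mat_adjoint (M * X) * (M * X) = mat_adjoint X * (mat_adjoint M * M) * X"
    by (rule mat_adjoint_mult_self[OF M X])
  also have "\<dots> = mat_adjoint ?Z * mat_diag n (\<lambda>i. complex_of_real (d i)) * ?Z"
    unfolding eqd using adjoint_mult_unitary_diag[OF V X] .
  finally have gram: "mat_adjoint (M * X) * (M * X) =
    mat_adjoint ?Z * mat_diag n (\<lambda>i. complex_of_real (d i)) * ?Z" .
  have Z: "?Z \<in> carrier_mat n 1" and MX: "M * X \<in> carrier_mat n 1" using c by auto
  have "(\<Sum>i<n. (cmod ((M * X) $$ (i, 0)))\<^sup>2) = (\<Sum>l<n. d l * (cmod (?Z $$ (l, 0)))\<^sup>2)"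
    unfolding one[OF MX] gram adjoint_diag_mult_index[OF Z less_one[THEN iffD2, OF refl]] Re_complex_of_real ..
  also have "\<dots> \<le> (\<Sum>l<n. root m ?t * (cmod (?Z $$ (l, 0)))\<^sup>2)"
    by (intro sum_mono mult_right_mono) (auto simp: dr)
  also have "\<dots> = root m ?t * Re ((mat_adjoint ?Z * ?Z) $$ (0, 0))"
    using c by (subst one[symmetric]) (auto simp: sum_distrib_left)
  also have "mat_adjoint ?Z * ?Z = mat_adjoint X * (V * mat_adjoint V) * X"
    using mat_adjoint_mult_self[OF c(2) X] by simp
  also have "\<dots> = mat_adjoint X * X" unfolding VV(3) using c by (simp add: right_mult_one_mat[of _ 1 n])
  also have "Re (\<dots> $$ (0, 0)) = (\<Sum>i<n. (cmod (X $$ (i, 0)))\<^sup>2)" using one[OF X] by simp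
  finally show ?thesis .
qed

section \<open>Schatten norms and the operator norm\<close>

lemma div_mod_less_square:
  assumes "r < (N::nat)\<^sup>2" shows "r div N < N" "r mod N < N"
  using assms by (auto simp: power2_eq_square less_mult_imp_div_less intro!: mod_less_divisor gr0I)

lemma sum_div_mod:
  fixes f :: "nat \<Rightarrow> nat \<Rightarrow> 'a :: comm_monoid_add"
  shows "(\<Sum>r<N\<^sup>2. f (r div N) (r mod N)) = (\<Sum>i<N. \<Sum>l<N. f i l)"
proof -
  have "(\<Sum>i<N. \<Sum>l<N. f i l) = (\<Sum>(i, l)\<in>{..<N} \<times> {..<N}. f i l)"
    by (simp add: sum.cartesian_product)
  also have "\<dots> = (\<Sum>r<N\<^sup>2. f (r div N) (r mod N))"
  proof (rule sum.reindex_bij_witness[of _ "\<lambda>r. (r div N, r mod N)" "\<lambda>(i, l). i * N + l"])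
    fix p assume "p \<in> {..<N} \<times> {..<N}"
    then obtain i l where p: "p = (i, l)" "i < N" "l < N" by auto
    have "i * N + l < (i + 1) * N" using p by simp
    also have "\<dots> \<le> N * N" using p by (intro mult_right_mono) auto
    finally show "(case p of (i, l) \<Rightarrow> i * N + l) \<in> {..<N\<^sup>2}" using p by (simp add: power2_eq_square)
  qed (auto simp: div_mod_less_square)
  finally show ?thesis ..
qed

text \<open>Linearity is encoded by an explicit coefficient array: sums and compositions of
  operators become finite sums, and \<open>op_mat_index\<close> reads the matrix of the operator
  directly off the array.\<close>

definition has_kernel :: "nat \<Rightarrow> hs_op \<Rightarrow> (nat \<times> nat \<Rightarrow> nat \<times> nat \<Rightarrow> complex) \<Rightarrow> bool" where
  "has_kernel N T t \<longleftrightarrow> (\<forall>\<xi>\<in>carrier_mat N N. T \<xi> \<in> carrier_mat N N \<and>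
     (\<forall>i<N. \<forall>l<N. T \<xi> $$ (i, l) = (\<Sum>p<N. \<Sum>q<N. t (i, l) (p, q) * \<xi> $$ (p, q))))"

lemma has_kernelD:
  assumes "has_kernel N T t" "\<xi> \<in> carrier_mat N N"
  shows "T \<xi> \<in> carrier_mat N N"
    "i < N \<Longrightarrow> l < N \<Longrightarrow> T \<xi> $$ (i, l) = (\<Sum>p<N. \<Sum>q<N. t (i, l) (p, q) * \<xi> $$ (p, q))"
  using assms unfolding has_kernel_def by auto

lemma hs_inner_eq:
  assumes "\<xi> \<in> carrier_mat N N" "\<eta> \<in> carrier_mat N N"
  shows "hs_inner \<xi> \<eta> = (\<Sum>i<N. \<Sum>l<N. \<xi> $$ (i, l) * cnj (\<eta> $$ (i, l)))"
proof -
  have "hs_inner \<xi> \<eta> = (\<Sum>l<N. \<Sum>i<N. \<xi> $$ (i, l) * cnj (\<eta> $$ (i, l)))"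
    unfolding hs_inner_def using assms
    by (subst mat_trace_eq[of _ N N])
      (auto simp: index_mult_mat_sum ac_simps simp del: index_mult_mat(1) intro!: sum.cong)
  then show ?thesis by (subst sum.swap) simp
qed

lemma hs_norm_eq:
  assumes "\<xi> \<in> carrier_mat N N"
  shows "hs_norm \<xi> = sqrt (\<Sum>i<N. \<Sum>l<N. (cmod (\<xi> $$ (i, l)))\<^sup>2)"
proof -
  have "hs_inner \<xi> \<xi> = complex_of_real (\<Sum>i<N. \<Sum>l<N. (cmod (\<xi> $$ (i, l)))\<^sup>2)"
    unfolding hs_inner_eq[OF assms assms] of_real_sum
    by (intro sum.cong refl) (simp add: complex_norm_square del: of_real_power)
  then show ?thesis unfolding hs_norm_def by (simp only: Re_complex_of_real)
qed

lemma sum_sum_delta: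
  fixes f :: "nat \<Rightarrow> nat \<Rightarrow> complex"
  assumes "a < N" "b < N"
  shows "(\<Sum>i<N. \<Sum>l<N. f i l * (if i = a then if l = b then 1 else 0 else 0)) = f a b"
proof -
  have "(\<Sum>i<N. \<Sum>l<N. f i l * (if i = a then if l = b then 1 else 0 else 0)) = (\<Sum>i<N. if i = a then f i b else 0)"
    using assms by (intro sum.cong refl) (auto simp: mult_delta_right)
  then show ?thesis using assms by simp
qed

lemma op_mat_index:
  assumes T: "has_kernel N T t" and r: "r < N\<^sup>2" and c: "c < N\<^sup>2"
  shows "op_mat N T $$ (r, c) = t (r div N, r mod N) (c div N, c mod N)"
proof -
  let ?e = "matrix_unit N"
  have e: "?e k \<in> carrier_mat N N" for k by (simp add: matrix_unit_def)
  have ix: "?e k $$ (i, l) = (if i = k div N then if l = k mod N then 1 else 0 else 0)" if "i < N" "l < N" for k i l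
    using that by (simp add: matrix_unit_def)
  note rc = div_mod_less_square[OF r] div_mod_less_square[OF c]
  have "op_mat N T $$ (r, c) = hs_inner (T (?e c)) (?e r)"
    using r c by (simp add: op_mat_def)
  also have "\<dots> = (\<Sum>i<N. \<Sum>l<N. T (?e c) $$ (i, l) * (if i = r div N then if l = r mod N then 1 else 0 else 0))"
    by (subst hs_inner_eq[OF has_kernelD(1)[OF T e] e]) (auto simp: ix intro!: sum.cong)
  also have "\<dots> = T (?e c) $$ (r div N, r mod N)"
    using rc by (intro sum_sum_delta)
  also have "\<dots> = (\<Sum>p<N. \<Sum>q<N. t (r div N, r mod N) (p, q) * (if p = c div N then if q = c mod N then 1 else 0 else 0))"
    using rc by (auto simp: has_kernelD(2)[OF T e] ix intro!: sum.cong)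
  also have "\<dots> = t (r div N, r mod N) (c div N, c mod N)"
    using rc by (intro sum_sum_delta)
  finally show ?thesis .
qed

lemma op_mat_carrier [simp]: "op_mat N T \<in> carrier_mat (N\<^sup>2) (N\<^sup>2)"
  by (simp add: op_mat_def)

text \<open>The \<open>2m\<close>-th power of the Schatten \<open>2m\<close>-norm, by
  \<open>schatten_norm_even_powr\<close>; unlike the norm it is a polynomial in the entries and
  their conjugates, so its expectation can be computed.\<close>

definition schatten_trace :: "nat \<Rightarrow> nat \<Rightarrow> hs_op \<Rightarrow> real" where
  "schatten_trace N m T = Re (mat_trace ((mat_adjoint (op_mat N T) * op_mat N T) ^\<^sub>m m))"

lemma schatten_trace_nonneg: "m \<ge> 1 \<Longrightarrow> schatten_trace N m T \<ge> 0"
  unfolding schatten_trace_def by (rule trace_powr_mat_abs(2)[OF op_mat_carrier])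

lemma schatten_norm_even_powr:
  assumes m: "m \<ge> 1"
  shows "schatten_norm N (ereal (2 * real m)) T powr (2 * real m) = schatten_trace N m T"
proof -
  have "schatten_norm N (ereal (2 * real m)) T = schatten_trace N m T powr (1 / (2 * real m))"
    using trace_powr_mat_abs(1)[OF op_mat_carrier[of N T] m]
    by (simp add: schatten_norm_def schatten_trace_def)
  then show ?thesis using m schatten_trace_nonneg[OF m, of N T] by (simp add: powr_powr)
qed

lemma op_norm_le_schatten_trace:
  assumes T: "has_kernel N T t" and m: "m \<ge> 1"
  shows "op_norm N T \<le> root (2 * m) (schatten_trace N m T)"
  unfolding op_norm_def
proof (rule cSup_least)
  \<comment> \<open>The zero matrix makes the set nonempty, which \<open>cSup_least\<close> asks
    for.\<close>
  have "hs_norm (0\<^sub>m N N) \<le> 1" by (subst hs_norm_eq[of _ N]) auto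
  then show "{hs_norm (T \<xi>) |\<xi>. \<xi> \<in> carrier_mat N N \<and> hs_norm \<xi> \<le> 1} \<noteq> {}"
    using zero_carrier_mat[of N N] by blast
next
  fix x assume "x \<in> {hs_norm (T \<xi>) |\<xi>. \<xi> \<in> carrier_mat N N \<and> hs_norm \<xi> \<le> 1}"
  then obtain \<xi> where \<xi>: "\<xi> \<in> carrier_mat N N" "hs_norm \<xi> \<le> 1" and x: "x = hs_norm (T \<xi>)" by auto
  define M where "M = op_mat N T"
  \<comment> \<open>Row-by-row vectorisation, in the order of \<open>matrix_unit\<close>, so that
    \<open>M * X\<close> becomes the vectorisation of \<open>T \<xi>\<close>.\<close>
  define X where "X = Matrix.mat (N\<^sup>2) 1 (\<lambda>(r, _). \<xi> $$ (r div N, r mod N))"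
  have X: "X \<in> carrier_mat (N\<^sup>2) 1" by (simp add: X_def)
  have M: "M \<in> carrier_mat (N\<^sup>2) (N\<^sup>2)" by (simp add: M_def)
  have nX: "(\<Sum>r<N\<^sup>2. (cmod (X $$ (r, 0)))\<^sup>2) = (hs_norm \<xi>)\<^sup>2"
    using sum_div_mod[of "\<lambda>i l. (cmod (\<xi> $$ (i, l)))\<^sup>2" N]
    by (simp add: hs_norm_eq[OF \<xi>(1)] X_def sum_nonneg)
  have "(M * X) $$ (r, 0) = T \<xi> $$ (r div N, r mod N)" if r: "r < N\<^sup>2" for r
  proof -
    have "(M * X) $$ (r, 0) = (\<Sum>c<N\<^sup>2. t (r div N, r mod N) (c div N, c mod N) * \<xi> $$ (c div N, c mod N))"
      using M X r by (subst index_mult_mat_sum) (auto simp: M_def X_def op_mat_index[OF T] op_mat_def[THEN arg_cong, of dim_row] op_mat_def[THEN arg_cong, of dim_col])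
    also have "\<dots> = (\<Sum>p<N. \<Sum>q<N. t (r div N, r mod N) (p, q) * \<xi> $$ (p, q))"
      by (rule sum_div_mod)
    also have "\<dots> = T \<xi> $$ (r div N, r mod N)"
      using has_kernelD(2)[OF T \<xi>(1)] div_mod_less_square[OF r] by simp
    finally show ?thesis .
  qed
  then have "(\<Sum>r<N\<^sup>2. (cmod ((M * X) $$ (r, 0)))\<^sup>2) = (hs_norm (T \<xi>))\<^sup>2"
    using sum_div_mod[of "\<lambda>i l. (cmod (T \<xi> $$ (i, l)))\<^sup>2" N]
    by (simp add: hs_norm_eq[OF has_kernelD(1)[OF T \<xi>(1)]] sum_nonneg del: index_mult_mat(1))
  then have "(hs_norm (T \<xi>))\<^sup>2 \<le> root m (schatten_trace N m T) * (hs_norm \<xi>)\<^sup>2"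
    using norm_mult_vector_le[OF M X m] nX by (simp add: schatten_trace_def M_def)
  also have "\<dots> \<le> root m (schatten_trace N m T) * 1"
    using \<xi>(2) hs_norm_eq[OF \<xi>(1)] schatten_trace_nonneg[OF m, of N T] m
    by (intro mult_left_mono) (auto simp: power_le_one_iff sum_nonneg)
  finally have "hs_norm (T \<xi>) \<le> sqrt (root m (schatten_trace N m T))"
    by (intro real_le_rsqrt) simp
  also have "\<dots> = root (2 * m) (schatten_trace N m T)"
    unfolding sqrt_def using real_root_mult_exp[of 2 m] by simp
  finally show "x \<le> root (2 * m) (schatten_trace N m T)" unfolding x .
qed

section \<open>Gaussian integration by parts and the Wick formula\<close>

text \<open>
  Polynomials are represented by their evaluation functions; the relation records a polynomial
  together with its partial derivatives.
\<close>

inductive poly_deriv :: "'r set \<Rightarrow> (('r \<Rightarrow> real) \<Rightarrow> complex) \<Rightarrow> ('r \<Rightarrow> ('r \<Rightarrow> real) \<Rightarrow> complex) \<Rightarrow> bool"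
  for R :: "'r set" where
  const: "poly_deriv R (\<lambda>w. c) (\<lambda>r w. 0)"
| add: "poly_deriv R P D \<Longrightarrow> poly_deriv R Q E \<Longrightarrow> poly_deriv R (\<lambda>w. P w + Q w) (\<lambda>r w. D r w + E r w)"
| var: "poly_deriv R P D \<Longrightarrow> j \<in> R \<Longrightarrow>
    poly_deriv R (\<lambda>w. P w * of_real (w j)) (\<lambda>r w. D r w * of_real (w j) + (if j = r then P w else 0))"

lemma poly_deriv_scale:
  "poly_deriv R P D \<Longrightarrow> poly_deriv R (\<lambda>w. P w * c) (\<lambda>r w. D r w * c)"
proof (induction rule: poly_deriv.induct)
  case (const c')
  then show ?case using poly_deriv.const[of R "c' * c"] by simp
next
  case (add P D Q E)
  then show ?case using poly_deriv.add[OF add.IH] by (simp add: algebra_simps)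
next
  case (var P D j)
  have *: "(\<lambda>r w. D r w * c * of_real (w j) + (if j = r then P w * c else 0)) =
      (\<lambda>r w. (D r w * of_real (w j) + (if j = r then P w else 0)) * c)"
    by (auto simp: fun_eq_iff algebra_simps)
  show ?case using poly_deriv.var[OF var.IH var.hyps(2)] unfolding * by (simp add: ac_simps)
qed

lemma poly_deriv_mult:
  assumes "poly_deriv R Q E" "poly_deriv R P D"
  shows "poly_deriv R (\<lambda>w. P w * Q w) (\<lambda>r w. D r w * Q w + P w * E r w)"
  using assms(1)
proof (induction rule: poly_deriv.induct)
  case (const c)
  then show ?case using poly_deriv_scale[OF assms(2)] by simp
next
  case (add Q E Q' E')
  then show ?case using poly_deriv.add[OF add.IH] by (simp add: algebra_simps)
next
  case (var Q E j)
  have *: "(\<lambda>r w. (D r w * Q w + P w * E r w) * of_real (w j) + (if j = r then P w * Q w else 0)) =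
      (\<lambda>r w. D r w * (Q w * of_real (w j)) + P w * (E r w * of_real (w j) + (if j = r then Q w else 0)))"
    by (auto simp: fun_eq_iff algebra_simps)
  show ?case using poly_deriv.var[OF var.IH var.hyps(2)] unfolding * by (simp add: ac_simps)
qed

text \<open>The moments of the standard normal law; the recursion is integration by parts for a
  monomial.\<close>

fun gauss_moment :: "nat \<Rightarrow> real" where
  "gauss_moment 0 = 1"
| "gauss_moment (Suc 0) = 0"
| "gauss_moment (Suc (Suc k)) = real (Suc k) * gauss_moment k"

lemma gauss_moment_Suc: "gauss_moment (Suc k) = real k * gauss_moment (k - 1)"
  by (cases k) auto

text \<open>Gaussianity enters only through the joint moments, which suffices because every function
  integrated below is a polynomial. The scale \<open>s\<close> gives the complex variable
  \<open>y e\<close> the mean square \<open>2 * s\<^sup>2\<close>.\<close>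

locale gaussian_family = prob_space M for M :: "'a measure" +
  fixes I :: "'i set" and s :: real and X :: "'i \<times> bool \<Rightarrow> 'a \<Rightarrow> real"
  assumes finite_I: "finite I" and s_pos: "s > 0"
    and moments: "\<And>k. has_bochner_integral M (\<lambda>\<omega>. \<Prod>r\<in>I \<times> UNIV. X r \<omega> ^ k r) (\<Prod>r\<in>I \<times> UNIV. gauss_moment (k r))"
begin

abbreviation R :: "('i \<times> bool) set" where "R \<equiv> I \<times> UNIV"

definition cfg :: "'a \<Rightarrow> 'i \<times> bool \<Rightarrow> real" where "cfg \<omega> = (\<lambda>r. X r \<omega>)"

definition monomial :: "('i \<times> bool \<Rightarrow> nat) \<Rightarrow> 'a \<Rightarrow> complex" where
  "monomial k \<omega> = of_real (\<Prod>r\<in>R. X r \<omega> ^ k r)"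

lemma finite_R: "finite R" using finite_I by auto

lemma monomial_has_integral: "has_bochner_integral M (monomial k) (of_real (\<Prod>r\<in>R. gauss_moment (k r)))"
  unfolding monomial_def[abs_def] by (intro has_bochner_integral_of_real moments)

lemma monomial_mult_var: "r \<in> R \<Longrightarrow> monomial k \<omega> * of_real (cfg \<omega> r) = monomial (k(r := Suc (k r))) \<omega>"
  using finite_R by (auto simp: monomial_def cfg_def prod.remove[of R r] intro!: prod.cong)

lemma prod_moment_update:
  assumes "r \<in> R"
  shows "(\<Prod>j\<in>R. gauss_moment ((k(r := Suc (k r))) j)) = real (k r) * (\<Prod>j\<in>R. gauss_moment ((k(r := k r - 1)) j))"
proof -
  have "(\<Prod>j\<in>R - {r}. gauss_moment ((k(r := Suc (k r))) j)) = (\<Prod>j\<in>R - {r}. gauss_moment ((k(r := k r - 1)) j))"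
    by (intro prod.cong) auto
  then show ?thesis using assms finite_R
    by (simp add: prod.remove[OF finite_R assms] gauss_moment_Suc)
qed

text \<open>The extra monomial is the induction device: a variable multiplying \<open>P\<close> is
  moved into \<open>k\<close>, until only constants times monomials remain, where the identity is
  \<open>gauss_moment_Suc\<close>. The truncated \<open>k r - 1\<close> at \<open>k r = 0\<close>
  comes with the factor 0.\<close>

lemma poly_deriv_ibp:
  assumes "poly_deriv R P D"
  shows "integrable M (\<lambda>\<omega>. P (cfg \<omega>) * monomial k \<omega>) \<and>
    (\<forall>r. integrable M (\<lambda>\<omega>. D r (cfg \<omega>) * monomial k \<omega>)) \<and>
    (\<forall>r\<in>R. expectation (\<lambda>\<omega>. P (cfg \<omega>) * monomial (k(r := Suc (k r))) \<omega>) =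
      expectation (\<lambda>\<omega>. D r (cfg \<omega>) * monomial k \<omega>) + of_nat (k r) * expectation (\<lambda>\<omega>. P (cfg \<omega>) * monomial (k(r := k r - 1)) \<omega>))"
  using assms
proof (induction arbitrary: k rule: poly_deriv.induct)
  case (const c)
  have "expectation (monomial (k(r := Suc (k r)))) = of_nat (k r) * expectation (monomial (k(r := k r - 1)))" if "r \<in> R" for r
    using prod_moment_update[OF that, of k]
    by (simp add: has_bochner_integral_integral_eq[OF monomial_has_integral] del: of_real_prod)
  then have "expectation (\<lambda>\<omega>. c * monomial (k(r := Suc (k r))) \<omega>) =
      expectation (\<lambda>\<omega>. 0 * monomial k \<omega>) + of_nat (k r) * expectation (\<lambda>\<omega>. c * monomial (k(r := k r - 1)) \<omega>)" if "r \<in> R" for r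
    using that by (simp only: integral_mult_right_zero) simp
  then show ?case
    using integrable.intros[OF monomial_has_integral] by blast
next
  case (add P D Q E)
  from add.IH[THEN conjunct1] have i: "integrable M (\<lambda>\<omega>. P (cfg \<omega>) * monomial k \<omega>)" "integrable M (\<lambda>\<omega>. Q (cfg \<omega>) * monomial k \<omega>)" for k
    by auto
  have i': "integrable M (\<lambda>\<omega>. D r (cfg \<omega>) * monomial k \<omega>)" "integrable M (\<lambda>\<omega>. E r (cfg \<omega>) * monomial k \<omega>)" for k r
    using add.IH by blast+
  show ?case
  proof (intro conjI allI ballI)
    fix r assume "r \<in> R"
    then have
      "expectation (\<lambda>\<omega>. P (cfg \<omega>) * monomial (k(r := Suc (k r))) \<omega>) = expectation (\<lambda>\<omega>. D r (cfg \<omega>) * monomial k \<omega>) +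
        of_nat (k r) * expectation (\<lambda>\<omega>. P (cfg \<omega>) * monomial (k(r := k r - 1)) \<omega>)"
      "expectation (\<lambda>\<omega>. Q (cfg \<omega>) * monomial (k(r := Suc (k r))) \<omega>) = expectation (\<lambda>\<omega>. E r (cfg \<omega>) * monomial k \<omega>) +
        of_nat (k r) * expectation (\<lambda>\<omega>. Q (cfg \<omega>) * monomial (k(r := k r - 1)) \<omega>)"
      using add.IH by blast+
    then show "expectation (\<lambda>\<omega>. (P (cfg \<omega>) + Q (cfg \<omega>)) * monomial (k(r := Suc (k r))) \<omega>) =
        expectation (\<lambda>\<omega>. (D r (cfg \<omega>) + E r (cfg \<omega>)) * monomial k \<omega>) +
        of_nat (k r) * expectation (\<lambda>\<omega>. (P (cfg \<omega>) + Q (cfg \<omega>)) * monomial (k(r := k r - 1)) \<omega>)"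
      by (simp add: distrib_right distrib_left i i' del: fun_upd_apply)
  qed (simp_all add: distrib_right i i')
next
  case (var P D j)
  have i: "integrable M (\<lambda>\<omega>. P (cfg \<omega>) * monomial k \<omega>)" for k using var.IH by auto
  have i': "integrable M (\<lambda>\<omega>. D r (cfg \<omega>) * monomial k \<omega>)" for k r using var.IH by blast
  let ?k' = "\<lambda>k. k(j := Suc (k j))"
  have step: "F * of_real (cfg \<omega> j) * monomial k \<omega> = F * monomial (?k' k) \<omega>" for F k \<omega>
    using monomial_mult_var[OF var.hyps(2), of k \<omega>] by (metis mult.assoc mult.commute)
  have Dr: "(\<lambda>\<omega>. (D r (cfg \<omega>) * of_real (cfg \<omega> j) + (if j = r then P (cfg \<omega>) else 0)) * monomial k \<omega>) =
      (\<lambda>\<omega>. D r (cfg \<omega>) * monomial (?k' k) \<omega> + (if j = r then P (cfg \<omega>) * monomial k \<omega> else 0))" for r k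
    by (auto simp: fun_eq_iff distrib_right step)
  have int: "integrable M (\<lambda>\<omega>. if j = r then P (cfg \<omega>) * monomial k \<omega> else 0)" for r k
    using i by (cases "j = r") auto
  have ibp: "expectation (\<lambda>\<omega>. P (cfg \<omega>) * monomial (k(r := Suc (k r))) \<omega>) =
      expectation (\<lambda>\<omega>. D r (cfg \<omega>) * monomial k \<omega>) + of_nat (k r) * expectation (\<lambda>\<omega>. P (cfg \<omega>) * monomial (k(r := k r - 1)) \<omega>)"
    if "r \<in> R" for r k using var.IH that by blast
  have "expectation (\<lambda>\<omega>. P (cfg \<omega>) * of_real (cfg \<omega> j) * monomial (k(r := Suc (k r))) \<omega>) =
    expectation (\<lambda>\<omega>. (D r (cfg \<omega>) * of_real (cfg \<omega> j) + (if j = r then P (cfg \<omega>) else 0)) * monomial k \<omega>) +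
     of_nat (k r) * expectation (\<lambda>\<omega>. P (cfg \<omega>) * of_real (cfg \<omega> j) * monomial (k(r := k r - 1)) \<omega>)" if r: "r \<in> R" for r
  proof (cases "j = r")
    \<comment> \<open>The hypothesis is used at \<open>k r + 1\<close> and yields
      \<open>k r + 1\<close> equal terms: \<open>k r\<close> belong to the monomial, one is the
      derivative of the new factor.\<close>
    case True
    have "k r > 0 \<Longrightarrow> k(r := Suc (k r - 1)) = k" by auto
    then have "of_nat (k r) * expectation (\<lambda>\<omega>. P (cfg \<omega>) * monomial (k(r := Suc (k r - 1))) \<omega>) =
        of_nat (k r) * expectation (\<lambda>\<omega>. P (cfg \<omega>) * monomial k \<omega>)"
      by (cases "k r = 0") auto
    then show ?thesis
      using ibp[OF r, of "k(r := Suc (k r))"] i[of k] i'[of r "k(r := Suc (k r))"] True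
      unfolding step Dr by (auto simp: distrib_right)
  next
    case False
    have "k(r := Suc (k r), j := Suc (k j)) = (?k' k)(r := Suc (k r))"
      "k(r := k r - 1, j := Suc (k j)) = (?k' k)(r := k r - 1)" using False by auto
    then show ?thesis
      using ibp[OF r, of "?k' k"] False unfolding step Dr by (simp add: fun_upd_twist)
  qed
  moreover have "integrable M (\<lambda>\<omega>. P (cfg \<omega>) * of_real (cfg \<omega> j) * monomial k \<omega>)"
    unfolding step by (rule i)
  moreover have "integrable M (\<lambda>\<omega>. (D r (cfg \<omega>) * of_real (cfg \<omega> j) + (if j = r then P (cfg \<omega>) else 0)) * monomial k \<omega>)" for r
    unfolding Dr by (intro Bochner_Integration.integrable_add i' int)
  ultimately show ?case by blast
qed

lemma poly_deriv_integrable: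
  assumes "poly_deriv R P D"
  shows "integrable M (\<lambda>\<omega>. P (cfg \<omega>))" "integrable M (\<lambda>\<omega>. D r (cfg \<omega>))"
  using poly_deriv_ibp[OF assms, of "\<lambda>_. 0"] by (cases r; auto simp: monomial_def)+

lemma poly_deriv_expectation:
  assumes "poly_deriv R P D" "r \<in> R"
  shows "expectation (\<lambda>\<omega>. of_real (cfg \<omega> r) * P (cfg \<omega>)) = expectation (\<lambda>\<omega>. D r (cfg \<omega>))"
proof -
  have "monomial ((\<lambda>_. 0)(r := Suc 0)) \<omega> = of_real (cfg \<omega> r)" for \<omega>
    using monomial_mult_var[OF assms(2), of "\<lambda>_. 0" \<omega>] by (simp add: monomial_def)
  then show ?thesis
    using poly_deriv_ibp[OF assms(1), of "\<lambda>_. 0", THEN conjunct2, THEN conjunct2, THEN bspec, OF assms(2)]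
    by (simp add: monomial_def[of "\<lambda>_. 0"] mult.commute)
qed

definition y :: "'i \<Rightarrow> ('i \<times> bool \<Rightarrow> real) \<Rightarrow> complex" where
  "y e w = of_real s * (of_real (w (e, False)) + \<i> * of_real (w (e, True)))"

text \<open>
  The Wirtinger derivative with respect to the conjugate of \<open>y\<^sub>e\<close>; the factor \<open>1 / (2s)\<close> makes the
  derivative of \<open>cnj y\<^sub>e\<close> equal to \<open>1\<close>.
\<close>

definition dbar :: "'i \<Rightarrow> (('i \<times> bool \<Rightarrow> real) \<Rightarrow> complex) \<Rightarrow> (('i \<times> bool \<Rightarrow> real) \<Rightarrow> complex) \<Rightarrow> bool" where
  "dbar e P D \<longleftrightarrow> (\<exists>G. poly_deriv R P G \<and> D = (\<lambda>w. (G (e, False) w + \<i> * G (e, True) w) / (2 * of_real s)))"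

lemma dbar_integrable:
  assumes "dbar e P D" shows "integrable M (\<lambda>\<omega>. P (cfg \<omega>))" "integrable M (\<lambda>\<omega>. D (cfg \<omega>))"
  using assms poly_deriv_integrable unfolding dbar_def by auto

lemma dbar_const: "dbar e (\<lambda>w. c) (\<lambda>w. 0)"
  unfolding dbar_def using poly_deriv.const[of R c] by (intro exI[of _ "\<lambda>_ _. 0"]) auto

lemma dbar_add: "dbar e P D \<Longrightarrow> dbar e Q E \<Longrightarrow> dbar e (\<lambda>w. P w + Q w) (\<lambda>w. D w + E w)"
  unfolding dbar_def by (elim exE conjE, rule exI, rule conjI, rule poly_deriv.add, assumption+)
    (simp add: fun_eq_iff field_simps add_divide_distrib)

lemma dbar_mult:
  assumes "dbar e P D" "dbar e Q E"
  shows "dbar e (\<lambda>w. P w * Q w) (\<lambda>w. D w * Q w + P w * E w)"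
proof -
  obtain G H where G: "poly_deriv R P G" and D: "D = (\<lambda>w. (G (e, False) w + \<i> * G (e, True) w) / (2 * of_real s))"
    and H: "poly_deriv R Q H" and E: "E = (\<lambda>w. (H (e, False) w + \<i> * H (e, True) w) / (2 * of_real s))"
    using assms unfolding dbar_def by auto
  show ?thesis unfolding dbar_def
    by (rule exI, rule conjI, rule poly_deriv_mult[OF H G]) (simp add: D E fun_eq_iff algebra_simps add_divide_distrib)
qed

lemma dbar_cong: "dbar e P D \<Longrightarrow> (\<And>w. P w = P' w) \<Longrightarrow> (\<And>w. D w = D' w) \<Longrightarrow> dbar e P' D'"
  by (metis ext)

lemma dbar_linear:
  assumes "e' \<in> I"
  shows "dbar e (\<lambda>w. c * of_real (w (e', False)) + d * of_real (w (e', True)))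
    (\<lambda>w. of_bool (e = e') * ((c + \<i> * d) / (2 * of_real s)))"
proof -
  have "poly_deriv R (\<lambda>w. c * of_real (w (e', False)) + d * of_real (w (e', True)))
    (\<lambda>r w. (if (e', False) = r then c else 0) + (if (e', True) = r then d else 0))"
    using poly_deriv.add[OF poly_deriv.var[OF poly_deriv.const[of R c], of "(e', False)"]
       poly_deriv.var[OF poly_deriv.const[of R d], of "(e', True)"]] assms by simp
  then show ?thesis unfolding dbar_def by (intro exI conjI) auto
qed

lemma dbar_y: "e' \<in> I \<Longrightarrow> dbar e (y e') (\<lambda>w. 0)"
  by (rule dbar_cong[OF dbar_linear[of e' e "of_real s" "\<i> * of_real s"]])
    (auto simp: y_def algebra_simps)

lemma dbar_cnj_y: "e' \<in> I \<Longrightarrow> dbar e (\<lambda>w. cnj (y e' w)) (\<lambda>w. of_bool (e = e'))"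
  by (rule dbar_cong[OF dbar_linear[of e' e "of_real s" "- \<i> * of_real s"]])
    (use s_pos in \<open>auto simp: y_def algebra_simps\<close>)

lemma dbar_sum:
  assumes "finite S" "\<And>i. i \<in> S \<Longrightarrow> dbar e (P i) (D i)"
  shows "dbar e (\<lambda>w. \<Sum>i\<in>S. P i w) (\<lambda>w. \<Sum>i\<in>S. D i w)"
  using assms by (induction S rule: finite_induct) (auto intro: dbar_const dbar_add)

lemma dbar_prod:
  assumes "finite S" "\<And>i. i \<in> S \<Longrightarrow> dbar e (P i) (D i)"
  shows "dbar e (\<lambda>w. \<Prod>i\<in>S. P i w) (\<lambda>w. \<Sum>b\<in>S. D b w * (\<Prod>i\<in>S - {b}. P i w))"
  using assms
proof (induction S rule: finite_induct)
  case empty then show ?case by (simp add: dbar_const)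
next
  case (insert a S)
  have *: "(\<Prod>i\<in>insert a S - {b}. P i w) = P a w * (\<Prod>i\<in>S - {b}. P i w)" if "b \<in> S" for b w
  proof -
    have "insert a S - {b} = insert a (S - {b})" using that insert by auto
    then show ?thesis using insert by simp
  qed
  have "dbar e (\<lambda>w. P a w * (\<Prod>i\<in>S. P i w)) (\<lambda>w. D a w * (\<Prod>i\<in>S. P i w) + P a w * (\<Sum>b\<in>S. D b w * (\<Prod>i\<in>S - {b}. P i w)))"
    using insert by (intro dbar_mult insert.IH) auto
  then show ?case
    by (rule dbar_cong) (use insert in \<open>auto simp: * sum_distrib_left ac_simps intro!: sum.cong\<close>)
qed

text \<open>Complex form of integration by parts: the factor \<open>s\<close> of \<open>y e\<close>
  times the \<open>2 * s\<close> that \<open>dbar\<close> divides by gives the mean square.\<close>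

lemma dbar_expectation:
  assumes "dbar e P D" "e \<in> I"
  shows "expectation (\<lambda>\<omega>. y e (cfg \<omega>) * P (cfg \<omega>)) = of_real (2 * s\<^sup>2) * expectation (\<lambda>\<omega>. D (cfg \<omega>))"
proof -
  obtain G where G: "poly_deriv R P G" and D: "D = (\<lambda>w. (G (e, False) w + \<i> * G (e, True) w) / (2 * of_real s))"
    using assms(1) unfolding dbar_def by auto
  have i: "integrable M (\<lambda>\<omega>. of_real (cfg \<omega> r) * P (cfg \<omega>))" if "r \<in> R" for r
    using poly_deriv_integrable(1)[OF poly_deriv.var[OF G that]] by (simp add: mult.commute)
  have "expectation (\<lambda>\<omega>. y e (cfg \<omega>) * P (cfg \<omega>)) =
     expectation (\<lambda>\<omega>. of_real s * (of_real (cfg \<omega> (e, False)) * P (cfg \<omega>)) + (\<i> * of_real s) * (of_real (cfg \<omega> (e, True)) * P (cfg \<omega>)))"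
    by (intro Bochner_Integration.integral_cong) (auto simp: y_def algebra_simps)
  also have "\<dots> = of_real s * expectation (\<lambda>\<omega>. G (e, False) (cfg \<omega>)) + (\<i> * of_real s) * expectation (\<lambda>\<omega>. G (e, True) (cfg \<omega>))"
    using assms(2) i by (subst Bochner_Integration.integral_add) (auto simp: poly_deriv_expectation[OF G])
  also have "\<dots> = of_real (2 * s\<^sup>2) * expectation (\<lambda>\<omega>. D (cfg \<omega>))"
    using s_pos poly_deriv_integrable(2)[OF G] by (simp add: D field_simps power2_eq_square)
  finally show ?thesis .
qed

lemma dbar_wick:
  assumes "finite S" "finite S'" "\<And>i. i \<in> S \<Longrightarrow> e i \<in> I" "\<And>i. i \<in> S' \<Longrightarrow> f i \<in> I"
  shows "dbar e0 (\<lambda>w. (\<Prod>i\<in>S. y (e i) w) * (\<Prod>i\<in>S'. cnj (y (f i) w)))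
    (\<lambda>w. \<Sum>b\<in>S'. of_bool (e0 = f b) * ((\<Prod>i\<in>S. y (e i) w) * (\<Prod>i\<in>S' - {b}. cnj (y (f i) w))))"
proof -
  have "dbar e0 (\<lambda>w. \<Prod>i\<in>S. y (e i) w) (\<lambda>w. \<Sum>b\<in>S. 0 * (\<Prod>i\<in>S - {b}. y (e i) w))"
    using assms by (intro dbar_prod dbar_y) auto
  moreover have "dbar e0 (\<lambda>w. \<Prod>i\<in>S'. cnj (y (f i) w)) (\<lambda>w. \<Sum>b\<in>S'. of_bool (e0 = f b) * (\<Prod>i\<in>S' - {b}. cnj (y (f i) w)))"
    using assms by (intro dbar_prod dbar_cnj_y) auto
  ultimately have "dbar e0 (\<lambda>w. (\<Prod>i\<in>S. y (e i) w) * (\<Prod>i\<in>S'. cnj (y (f i) w)))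
    (\<lambda>w. (\<Sum>b\<in>S. 0 * (\<Prod>i\<in>S - {b}. y (e i) w)) * (\<Prod>i\<in>S'. cnj (y (f i) w)) +
      (\<Prod>i\<in>S. y (e i) w) * (\<Sum>b\<in>S'. of_bool (e0 = f b) * (\<Prod>i\<in>S' - {b}. cnj (y (f i) w))))"
    by (rule dbar_mult)
  then show ?thesis by (rule dbar_cong) (auto simp: sum_distrib_left ac_simps intro!: sum.cong)
qed

text \<open>Integrating by parts in the variable at \<open>a\<close> pairs it with some conjugate at
  \<open>b\<close>. The transposition of \<open>a\<close> and \<open>b\<close> relabels the
  remaining conjugates by \<open>S\<close>, and composing it with permutations of \<open>S\<close>
  produces each permutation of \<open>insert a S\<close> once.\<close>

theorem wick:
  assumes "finite S" "\<And>i. i \<in> S \<Longrightarrow> e i \<in> I" "\<And>i. i \<in> S \<Longrightarrow> f i \<in> I"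
  shows "expectation (\<lambda>\<omega>. (\<Prod>i\<in>S. y (e i) (cfg \<omega>)) * (\<Prod>i\<in>S. cnj (y (f i) (cfg \<omega>)))) =
    of_real ((2 * s\<^sup>2) ^ card S) * (\<Sum>\<pi> | \<pi> permutes S. \<Prod>i\<in>S. of_bool (e i = f (\<pi> i)))"
  using assms
proof (induction S arbitrary: f rule: finite_induct)
  case empty
  then show ?case by (simp add: prob_space permutes_empty)
next
  case (insert a S)
  let ?t = "\<lambda>b. Transposition.transpose a b"
  let ?Q = "\<lambda>b w. (\<Prod>i\<in>S. y (e i) w) * (\<Prod>i\<in>insert a S - {b}. cnj (y (f i) w))"
  let ?P = "\<lambda>w. (\<Prod>i\<in>S. y (e i) w) * (\<Prod>i\<in>insert a S. cnj (y (f i) w))"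
  have d: "dbar (e a) ?P (\<lambda>w. \<Sum>b\<in>insert a S. of_bool (e a = f b) * ?Q b w)"
    using insert.prems insert.hyps by (intro dbar_wick) auto
  have iQ: "integrable M (\<lambda>\<omega>. ?Q b (cfg \<omega>))" for b
    using insert.prems insert.hyps by (intro dbar_integrable(1)[OF dbar_wick[of S "insert a S - {b}" e f "e a"]]) auto
  have Q: "expectation (\<lambda>\<omega>. ?Q b (cfg \<omega>)) =
      of_real ((2 * s\<^sup>2) ^ card S) * (\<Sum>\<pi> | \<pi> permutes S. \<Prod>i\<in>S. of_bool (e i = f (?t b (\<pi> i))))" if b: "b \<in> insert a S" for b
  proof -
    have img: "?t b ` S = insert a S - {b}"
    proof -
      have "?t b ` insert a S = insert a S" using b by (intro permutes_image permutes_swap_id) auto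
      moreover have "insert a S = insert b (insert a S - {b})" using b by auto
      moreover have "?t b ` insert a S = insert b (?t b ` S)" by simp
      moreover have "b \<notin> ?t b ` S" using insert.hyps by (metis imageE transpose_apply_second transpose_involutory)
      ultimately show ?thesis by (metis Diff_insert_absorb)
    qed
    have "(\<Prod>i\<in>insert a S - {b}. cnj (y (f i) w)) = (\<Prod>i\<in>S. cnj (y (f (?t b i)) w))" for w
      unfolding img[symmetric] by (subst prod.reindex) (auto intro: inj_on_subset[OF inj_transpose])
    then have "expectation (\<lambda>\<omega>. ?Q b (cfg \<omega>)) =
      expectation (\<lambda>\<omega>. (\<Prod>i\<in>S. y (e i) (cfg \<omega>)) * (\<Prod>i\<in>S. cnj (y ((f \<circ> ?t b) i) (cfg \<omega>))))" by simp
    also have "\<dots> = of_real ((2 * s\<^sup>2) ^ card S) * (\<Sum>\<pi> | \<pi> permutes S. \<Prod>i\<in>S. of_bool (e i = (f \<circ> ?t b) (\<pi> i)))"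
    proof (rule insert.IH)
      fix i assume "i \<in> S"
      then have "?t b i \<in> insert a S" using img by blast
      then show "(f \<circ> ?t b) i \<in> I" using insert.prems by simp
    qed (use insert.prems in auto)
    finally show ?thesis by simp
  qed
  have "expectation (\<lambda>\<omega>. (\<Prod>i\<in>insert a S. y (e i) (cfg \<omega>)) * (\<Prod>i\<in>insert a S. cnj (y (f i) (cfg \<omega>)))) =
      expectation (\<lambda>\<omega>. y (e a) (cfg \<omega>) * ?P (cfg \<omega>))"
    using insert.hyps by (simp add: ac_simps)
  also have "\<dots> = of_real (2 * s\<^sup>2) * expectation (\<lambda>\<omega>. \<Sum>b\<in>insert a S. of_bool (e a = f b) * ?Q b (cfg \<omega>))"
    using insert.prems by (intro dbar_expectation[OF d]) auto
  also have "expectation (\<lambda>\<omega>. \<Sum>b\<in>insert a S. of_bool (e a = f b) * ?Q b (cfg \<omega>)) =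
      (\<Sum>b\<in>insert a S. of_bool (e a = f b) * expectation (\<lambda>\<omega>. ?Q b (cfg \<omega>)))"
    by (subst Bochner_Integration.integral_sum) (auto intro!: integrable_mult_right iQ simp del: prod.insert sum.insert)
  also have "\<dots> = (\<Sum>b\<in>insert a S. of_real ((2 * s\<^sup>2) ^ card S) * (\<Sum>\<pi> | \<pi> permutes S. \<Prod>i\<in>insert a S. of_bool (e i = f ((?t b \<circ> \<pi>) i))))"
  proof (intro sum.cong refl)
    fix b assume "b \<in> insert a S"
    have "(\<Prod>i\<in>insert a S. of_bool (e i = f ((?t b \<circ> \<pi>) i))) =
       (of_bool (e a = f b) * (\<Prod>i\<in>S. of_bool (e i = f (?t b (\<pi> i)))) :: complex)" if "\<pi> permutes S" for \<pi>
      using insert.hyps permutes_not_in[OF that, of a] by simp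
    then show "of_bool (e a = f b) * expectation (\<lambda>\<omega>. ?Q b (cfg \<omega>)) =
      of_real ((2 * s\<^sup>2) ^ card S) * (\<Sum>\<pi> | \<pi> permutes S. \<Prod>i\<in>insert a S. of_bool (e i = f ((?t b \<circ> \<pi>) i)))"
      unfolding Q[OF \<open>b \<in> insert a S\<close>] by (simp add: sum_distrib_left ac_simps)
  qed
  also have "\<dots> = of_real ((2 * s\<^sup>2) ^ card S) * (\<Sum>\<pi> | \<pi> permutes insert a S. \<Prod>i\<in>insert a S. of_bool (e i = f (\<pi> i)))"
    unfolding sum_over_permutations_insert[OF insert.hyps] by (simp add: sum_distrib_left)
  finally show ?case using insert.hyps by (simp add: ac_simps)
qed

end

section \<open>Moments of traces of a Ginibre matrix\<close>

text \<open>Defined by the ratio of neighbours, from which the two exponential bounds follow by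
  one-step inductions; the convolution needed for traces is then derived.\<close>

fun catalan :: "nat \<Rightarrow> real" where
  "catalan 0 = 1"
| "catalan (Suc k) = (4 * real k + 2) / (real k + 2) * catalan k"

lemma catalan_pos: "catalan k > 0"
  by (induction k) auto

lemma catalan_Suc: "(real k + 2) * catalan (Suc k) = (4 * real k + 2) * catalan k"
  by (simp add: field_simps)

text \<open>Symmetrising \<open>\<Sum>(l + 1) catalan l * catalan (K - l)\<close> under \<open>l \<mapsto> K - l\<close> gives \<open>(K + 2) / 2\<close> times the convolution, while
  the two-term recursion evaluates it through the convolution at \<open>K - 1\<close>.\<close>
lemma catalan_convolution: "(\<Sum>l\<le>k. catalan l * catalan (k - l)) = catalan (Suc k)"
proof (induction k)
  case (Suc k)
  let ?K = "Suc k"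
  let ?S = "\<Sum>l\<le>?K. catalan l * catalan (?K - l)"
  have "(\<Sum>l\<le>?K. real l * (catalan l * catalan (?K - l))) = (\<Sum>l\<le>?K. real (?K - l) * (catalan l * catalan (?K - l)))"
    by (subst sum.nat_diff_reindex[symmetric, of _ "Suc ?K", unfolded lessThan_Suc_atMost])
      (auto intro!: sum.cong simp: mult.commute)
  then have "2 * (\<Sum>l\<le>?K. real l * (catalan l * catalan (?K - l))) =
      (\<Sum>l\<le>?K. real l * (catalan l * catalan (?K - l)) + real (?K - l) * (catalan l * catalan (?K - l)))"
    by (simp only: sum.distrib mult_2)
  also have "\<dots> = real ?K * ?S"
    unfolding sum_distrib_left by (intro sum.cong refl) (auto simp: algebra_simps of_nat_diff)
  finally have "2 * (\<Sum>l\<le>?K. (real l + 1) * (catalan l * catalan (?K - l))) = (real ?K + 2) * ?S"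
    by (simp only: distrib_right sum.distrib mult_1 distrib_left)
  moreover have "(\<Sum>l\<le>?K. (real l + 1) * (catalan l * catalan (?K - l))) =
      catalan ?K + (\<Sum>l\<le>k. (real l + 2) * catalan (Suc l) * catalan (k - l))"
    by (simp only: sum.atMost_Suc_shift) (simp add: mult.assoc add.commute del: catalan.simps(2))
  moreover have "(\<Sum>l\<le>k. (real l + 2) * catalan (Suc l) * catalan (k - l)) = (\<Sum>l\<le>k. (4 * real l + 2) * (catalan l * catalan (k - l)))"
    unfolding catalan_Suc by (simp only: mult.assoc)
  moreover have "(\<Sum>l\<le>k. (4 * real l + 2) * (catalan l * catalan (k - l))) = (2 * real k + 2) * (\<Sum>l\<le>k. catalan l * catalan (k - l))"
  proof -
    have "(\<Sum>l\<le>k. real l * (catalan l * catalan (k - l))) = (\<Sum>l\<le>k. real (k - l) * (catalan l * catalan (k - l)))"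
      by (subst sum.nat_diff_reindex[symmetric, of _ "Suc k", unfolded lessThan_Suc_atMost])
        (auto intro!: sum.cong simp: mult.commute)
    then have "2 * (\<Sum>l\<le>k. real l * (catalan l * catalan (k - l))) =
        (\<Sum>l\<le>k. real l * (catalan l * catalan (k - l)) + real (k - l) * (catalan l * catalan (k - l)))"
      by (simp only: sum.distrib mult_2)
    also have "\<dots> = real k * (\<Sum>l\<le>k. catalan l * catalan (k - l))"
      unfolding sum_distrib_left by (intro sum.cong refl) (auto simp: algebra_simps of_nat_diff)
    finally have e: "2 * (\<Sum>l\<le>k. real l * (catalan l * catalan (k - l))) = real k * (\<Sum>l\<le>k. catalan l * catalan (k - l))" .
    have "(\<Sum>l\<le>k. (4 * real l + 2) * (catalan l * catalan (k - l))) =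
        2 * (2 * (\<Sum>l\<le>k. real l * (catalan l * catalan (k - l)))) + 2 * (\<Sum>l\<le>k. catalan l * catalan (k - l))"
      by (simp only: sum_distrib_left flip: sum.distrib) (simp add: algebra_simps)
    then show ?thesis unfolding e by (simp add: algebra_simps)
  qed
  ultimately have "(real ?K + 2) * ?S = 2 * (catalan ?K + (2 * real k + 2) * catalan ?K)"
    by (simp only: Suc.IH)
  also have "\<dots> = (4 * real ?K + 2) * catalan ?K" by (simp add: algebra_simps del: catalan.simps)
  also have "\<dots> = (real ?K + 2) * catalan (Suc ?K)" by (rule catalan_Suc[symmetric])
  finally have "(real ?K + 2) * ?S = (real ?K + 2) * catalan (Suc ?K)" .
  then show ?case by (simp only: mult_cancel_left) simp
qed simp

lemma catalan_Suc_le: "catalan (Suc k) \<le> 4 * catalan k"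
  using catalan_pos[of k] by (simp add: divide_le_eq)

lemma catalan_add_le: "catalan (k + p) \<le> 4 ^ k * catalan p"
proof (induction k)
  case (Suc k)
  then show ?case using catalan_Suc_le[of "k + p"] by (simp del: catalan.simps)
qed simp

lemma catalan_le: "catalan k \<le> 4 ^ k"
  using catalan_add_le[of k 0] by simp

text \<open>The induction step is \<open>4 * (k + 1)^2 \<le> (k + 2) * (4 * k + 2)\<close>. This
  lower bound converts the powers of 4 in the joining terms back into Catalan numbers.\<close>

lemma catalan_ge: "4 ^ k \<le> (real k + 1)\<^sup>2 * catalan k"
proof (induction k)
  case (Suc k)
  have "4 * (real k + 1)\<^sup>2 \<le> (real k + 2) * (4 * real k + 2)"
    by (simp add: power2_eq_square algebra_simps)
  then have "4 * ((real k + 1)\<^sup>2 * catalan k) \<le> (real k + 2) * (4 * real k + 2) * catalan k"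
    using catalan_pos[of k] by (simp add: mult_right_mono flip: mult.assoc)
  also have "\<dots> = (real k + 2)\<^sup>2 * catalan (Suc k)"
    using catalan_Suc[of k] by (simp add: power2_eq_square ac_simps del: catalan.simps)
  finally show ?case using Suc by (simp add: ac_simps del: catalan.simps)
qed simp

section \<open>Integration by parts for products of traces of Gram powers\<close>

definition mat_mul :: "nat \<Rightarrow> (nat \<Rightarrow> nat \<Rightarrow> complex) \<Rightarrow> (nat \<Rightarrow> nat \<Rightarrow> complex) \<Rightarrow> nat \<Rightarrow> nat \<Rightarrow> complex" where
  "mat_mul N A B = (\<lambda>i j. \<Sum>d<N. A i d * B d j)"

lemma mat_mul_assoc: "mat_mul N (mat_mul N A B) C = mat_mul N A (mat_mul N B C)"
  unfolding mat_mul_def sum_distrib_left sum_distrib_right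
  by (intro ext, subst sum.swap) (simp add: ac_simps)

definition omit :: "nat \<Rightarrow> nat list \<Rightarrow> nat list" where
  "omit i ks = take i ks @ drop (Suc i) ks"

lemma sum_sum_mult_add:
  fixes f g :: "nat \<Rightarrow> nat \<Rightarrow> complex"
  shows "(\<Sum>r<N. \<Sum>c<N. f r c * t + g r c) = (\<Sum>r<N. \<Sum>c<N. f r c) * t + (\<Sum>r<N. \<Sum>c<N. g r c)"
  by (simp add: sum.distrib sum_distrib_right)

lemma integral_sum_sum:
  fixes f :: "nat \<Rightarrow> nat \<Rightarrow> 'a \<Rightarrow> complex"
  assumes "\<And>r c. r < N \<Longrightarrow> c < N \<Longrightarrow> integrable M (f r c)"
  shows "(LINT \<omega>|M. (\<Sum>r<N. \<Sum>c<N. f r c \<omega>)) = (\<Sum>r<N. \<Sum>c<N. LINT \<omega>|M. f r c \<omega>)"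
  using assms unfolding sum.cartesian_product
  by (subst Bochner_Integration.integral_sum) (auto simp: case_prod_beta)

text \<open>The injection \<open>h\<close> of matrix positions into the index set singles out one
  matrix among the possibly many that the family carries.\<close>

locale ginibre = gaussian_family M I s X
  for M :: "'a measure" and I :: "'i set" and s :: real and X +
  fixes N :: nat and h :: "nat \<Rightarrow> nat \<Rightarrow> 'i"
  assumes h_in: "\<And>r c. r < N \<Longrightarrow> c < N \<Longrightarrow> h r c \<in> I"
    and h_inj: "\<And>r c r' c'. r < N \<Longrightarrow> c < N \<Longrightarrow> r' < N \<Longrightarrow> c' < N \<Longrightarrow> h r c = h r' c' \<longleftrightarrow> r = r' \<and> c = c'"
begin

definition Y :: "('i \<times> bool \<Rightarrow> real) \<Rightarrow> nat \<Rightarrow> nat \<Rightarrow> complex" where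
  "Y w r c = y (h r c) w"

definition gram :: "('i \<times> bool \<Rightarrow> real) \<Rightarrow> nat \<Rightarrow> nat \<Rightarrow> complex" where
  "gram w p q = (\<Sum>r<N. cnj (Y w r p) * Y w r q)"

fun gram_pow :: "nat \<Rightarrow> ('i \<times> bool \<Rightarrow> real) \<Rightarrow> nat \<Rightarrow> nat \<Rightarrow> complex" where
  "gram_pow 0 w = (\<lambda>p q. of_bool (p = q))"
| "gram_pow (Suc k) w = mat_mul N (gram_pow k w) (gram w)"

definition ygram :: "nat \<Rightarrow> ('i \<times> bool \<Rightarrow> real) \<Rightarrow> nat \<Rightarrow> nat \<Rightarrow> complex" where
  "ygram k w = mat_mul N (Y w) (gram_pow k w)"

definition gram_trace :: "nat \<Rightarrow> ('i \<times> bool \<Rightarrow> real) \<Rightarrow> complex" where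
  "gram_trace k w = (\<Sum>p<N. gram_pow k w p p)"

lemma gram_pow_add: "p < N \<Longrightarrow> q < N \<Longrightarrow> mat_mul N (gram_pow k w) (gram_pow l w) p q = gram_pow (k + l) w p q"
proof (induction l arbitrary: q)
  case 0
  have "(\<Sum>d<N. gram_pow k w p d * of_bool (d = q)) = (\<Sum>d<N. if d = q then gram_pow k w p d else 0)"
    by (intro sum.cong) auto
  then show ?case using 0 by (simp add: mat_mul_def)
next
  case (Suc l)
  have "mat_mul N (gram_pow k w) (gram_pow (Suc l) w) p q = mat_mul N (mat_mul N (gram_pow k w) (gram_pow l w)) (gram w) p q"
    by (simp add: mat_mul_assoc)
  also have "\<dots> = mat_mul N (gram_pow (k + l) w) (gram w) p q"
    unfolding mat_mul_def[of N _ "gram w"] using Suc by (intro sum.cong) auto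
  finally show ?case by simp
qed

lemma ygram_mult_gram_pow: "q < N \<Longrightarrow> mat_mul N (ygram k w) (gram_pow l w) r q = ygram (k + l) w r q"
  unfolding ygram_def mat_mul_assoc by (simp add: mat_mul_def[of N "Y w"] gram_pow_add)

lemma ygram_0: "c < N \<Longrightarrow> ygram 0 w r c = Y w r c"
proof -
  assume "c < N"
  have "(\<Sum>d<N. Y w r d * of_bool (d = c)) = (\<Sum>d<N. if d = c then Y w r d else 0)"
    by (intro sum.cong) auto
  then show ?thesis using \<open>c < N\<close> by (simp add: ygram_def mat_mul_def)
qed

lemma dbar_eqI: "dbar e P D \<Longrightarrow> (\<And>w. D w = D' w) \<Longrightarrow> dbar e P D'"
  by (rule dbar_cong[OF _ refl])

lemma dbar_Y: "r' < N \<Longrightarrow> p < N \<Longrightarrow> dbar e (\<lambda>w. Y w r' p) (\<lambda>w. 0)"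
  unfolding Y_def by (intro dbar_y h_in)

lemma dbar_cnj_Y:
  assumes "r < N" "c < N" "r' < N" "p < N"
  shows "dbar (h r c) (\<lambda>w. cnj (Y w r' p)) (\<lambda>w. of_bool (r = r' \<and> c = p))"
  using dbar_cnj_y[OF h_in[OF assms(3,4)], of "h r c"] h_inj[OF assms] unfolding Y_def by simp

lemma dbar_gram:
  assumes "r < N" "c < N" "p < N" "q < N"
  shows "dbar (h r c) (\<lambda>w. gram w p q) (\<lambda>w. of_bool (c = p) * Y w r q)"
proof -
  have "dbar (h r c) (\<lambda>w. gram w p q) (\<lambda>w. \<Sum>r'<N. of_bool (r = r' \<and> c = p) * Y w r' q + cnj (Y w r' p) * 0)"
    unfolding gram_def using assms by (intro dbar_sum dbar_mult dbar_cnj_Y dbar_Y) auto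
  moreover have "(\<Sum>r'<N. of_bool (r = r' \<and> c = p) * Y w r' q + cnj (Y w r' p) * 0) = of_bool (c = p) * Y w r q" for w
  proof -
    have "(\<Sum>r'<N. of_bool (r = r' \<and> c = p) * Y w r' q + cnj (Y w r' p) * 0) =
      (\<Sum>r'<N. if r' = r then of_bool (c = p) * Y w r' q else 0)" by (intro sum.cong) auto
    then show ?thesis using assms by simp
  qed
  ultimately show ?thesis by (rule dbar_eqI)
qed

text \<open>Leibniz rule: the derivative consumes the conjugate in the factor number
  \<open>l\<close>, cutting the power into \<open>l\<close> factors before it and
  \<open>k - Suc l\<close> after it; the surviving \<open>Y\<close> of that factor stays with the
  second piece.\<close>

lemma dbar_gram_pow:
  assumes "r < N" "c < N" "p < N" "q < N"
  shows "dbar (h r c) (\<lambda>w. gram_pow k w p q) (\<lambda>w. \<Sum>l<k. gram_pow l w p c * ygram (k - Suc l) w r q)"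
  using assms(4)
proof (induction k arbitrary: q)
  case 0
  then show ?case by (simp add: dbar_const)
next
  case (Suc k)
  have "dbar (h r c) (\<lambda>w. gram_pow (Suc k) w p q)
    (\<lambda>w. \<Sum>d<N. (\<Sum>l<k. gram_pow l w p c * ygram (k - Suc l) w r d) * gram w d q + gram_pow k w p d * (of_bool (c = d) * Y w r q))"
    unfolding gram_pow.simps mat_mul_def using assms Suc.prems by (intro dbar_sum dbar_mult Suc.IH dbar_gram) auto
  moreover have "(\<Sum>d<N. (\<Sum>l<k. gram_pow l w p c * ygram (k - Suc l) w r d) * gram w d q + gram_pow k w p d * (of_bool (c = d) * Y w r q)) =
     (\<Sum>l<Suc k. gram_pow l w p c * ygram (Suc k - Suc l) w r q)" for w
  proof -
    have "(\<Sum>d<N. (\<Sum>l<k. gram_pow l w p c * ygram (k - Suc l) w r d) * gram w d q) = (\<Sum>l<k. gram_pow l w p c * mat_mul N (ygram (k - Suc l) w) (gram w) r q)"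
      unfolding mat_mul_def sum_distrib_left sum_distrib_right by (subst sum.swap) (simp add: ac_simps)
    also have "\<dots> = (\<Sum>l<k. gram_pow l w p c * ygram (Suc k - Suc l) w r q)"
      by (intro sum.cong refl) (simp add: ygram_def mat_mul_assoc Suc_diff_Suc flip: gram_pow.simps(2))
    finally have 1: "(\<Sum>d<N. (\<Sum>l<k. gram_pow l w p c * ygram (k - Suc l) w r d) * gram w d q) = \<dots>" .
    have "(\<Sum>d<N. gram_pow k w p d * (of_bool (c = d) * Y w r q)) = (\<Sum>d<N. if d = c then gram_pow k w p d * Y w r q else 0)"
      by (intro sum.cong) auto
    then have 2: "(\<Sum>d<N. gram_pow k w p d * (of_bool (c = d) * Y w r q)) = gram_pow k w p c * ygram 0 w r q"
      using assms Suc.prems by (simp add: ygram_0)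
    show ?thesis unfolding sum.distrib 1 2 by simp
  qed
  ultimately show ?case by (rule dbar_eqI)
qed

text \<open>By cyclicity the \<open>k\<close> cuts all give the same matrix. For
  \<open>k = 0\<close> the truncated \<open>k - 1\<close> is multiplied by 0.\<close>

lemma dbar_gram_trace:
  assumes "r < N" "c < N"
  shows "dbar (h r c) (gram_trace k) (\<lambda>w. of_nat k * ygram (k - 1) w r c)"
proof -
  have "dbar (h r c) (gram_trace k) (\<lambda>w. \<Sum>p<N. \<Sum>l<k. gram_pow l w p c * ygram (k - Suc l) w r p)"
    unfolding gram_trace_def[abs_def] using assms by (intro dbar_sum dbar_gram_pow) auto
  moreover have "(\<Sum>p<N. \<Sum>l<k. gram_pow l w p c * ygram (k - Suc l) w r p) = of_nat k * ygram (k - 1) w r c" for w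
  proof -
    have "(\<Sum>p<N. \<Sum>l<k. gram_pow l w p c * ygram (k - Suc l) w r p) = (\<Sum>l<k. mat_mul N (ygram (k - Suc l) w) (gram_pow l w) r c)"
      unfolding mat_mul_def by (subst sum.swap) (simp add: ac_simps)
    also have "\<dots> = (\<Sum>l<k. ygram (k - 1) w r c)"
      using assms by (intro sum.cong refl) (simp add: ygram_mult_gram_pow)
    finally show ?thesis by simp
  qed
  ultimately show ?thesis by (rule dbar_eqI)
qed

definition gram_adj :: "nat \<Rightarrow> ('i \<times> bool \<Rightarrow> real) \<Rightarrow> nat \<Rightarrow> nat \<Rightarrow> complex" where
  "gram_adj k w c r = (\<Sum>d<N. gram_pow k w c d * cnj (Y w r d))"

lemma gram_trace_Suc: "gram_trace (Suc k) w = (\<Sum>r<N. \<Sum>c<N. Y w r c * gram_adj k w c r)"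
proof -
  have "gram_trace (Suc k) w = (\<Sum>c<N. \<Sum>r<N. \<Sum>d<N. Y w r c * (gram_pow k w c d * cnj (Y w r d)))"
    unfolding gram_trace_def gram_pow.simps mat_mul_def gram_def sum_distrib_left
    by (rule sum.cong[OF refl], subst sum.swap) (simp add: ac_simps)
  then show ?thesis unfolding gram_adj_def sum_distrib_left by (subst sum.swap)
qed

text \<open>The isolated Gram power comes from differentiating the trailing conjugate, the sum from
  the conjugates inside the power.\<close>

lemma dbar_gram_adj:
  assumes "r < N" "c < N"
  shows "dbar (h r c) (\<lambda>w. gram_adj k w c r)
    (\<lambda>w. gram_pow k w c c + (\<Sum>l<k. gram_pow l w c c * (\<Sum>d<N. ygram (k - Suc l) w r d * cnj (Y w r d))))"
proof -
  have "dbar (h r c) (\<lambda>w. gram_adj k w c r)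
    (\<lambda>w. \<Sum>d<N. (\<Sum>l<k. gram_pow l w c c * ygram (k - Suc l) w r d) * cnj (Y w r d) + gram_pow k w c d * of_bool (r = r \<and> c = d))"
    unfolding gram_adj_def using assms by (intro dbar_sum dbar_mult dbar_gram_pow dbar_cnj_Y) auto
  moreover have "(\<Sum>d<N. (\<Sum>l<k. gram_pow l w c c * ygram (k - Suc l) w r d) * cnj (Y w r d) + gram_pow k w c d * of_bool (r = r \<and> c = d)) =
    gram_pow k w c c + (\<Sum>l<k. gram_pow l w c c * (\<Sum>d<N. ygram (k - Suc l) w r d * cnj (Y w r d)))" for w
  proof -
    have "(\<Sum>d<N. (\<Sum>l<k. gram_pow l w c c * ygram (k - Suc l) w r d) * cnj (Y w r d)) =
        (\<Sum>l<k. gram_pow l w c c * (\<Sum>d<N. ygram (k - Suc l) w r d * cnj (Y w r d)))"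
      unfolding sum_distrib_left sum_distrib_right by (subst sum.swap) (simp add: ac_simps)
    moreover have "(\<Sum>d<N. gram_pow k w c d * of_bool (r = r \<and> c = d)) = (\<Sum>d<N. if d = c then gram_pow k w c d else 0)"
      by (intro sum.cong) auto
    ultimately show ?thesis using assms by (simp add: sum.distrib)
  qed
  ultimately show ?thesis by (rule dbar_eqI)
qed

lemma sum_ygram_cnj_Y: "(\<Sum>r<N. \<Sum>d<N. ygram k w r d * cnj (Y w r d)) = gram_trace (Suc k) w"
proof -
  have "(\<Sum>r<N. \<Sum>d<N. ygram k w r d * cnj (Y w r d)) = (\<Sum>r<N. \<Sum>c<N. \<Sum>d<N. Y w r c * (gram_pow k w c d * cnj (Y w r d)))"
    unfolding ygram_def mat_mul_def sum_distrib_right by (rule sum.cong[OF refl], subst sum.swap) (simp add: ac_simps)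
  then show ?thesis unfolding gram_trace_Suc gram_adj_def sum_distrib_left .
qed

lemma sum_gram_adj_ygram:
  "(\<Sum>r<N. \<Sum>c<N. gram_adj k w c r * ygram j w r c) = gram_trace (Suc k + j) w"
proof -
  have "(\<Sum>r<N. \<Sum>c<N. gram_adj k w c r * ygram j w r c) = (\<Sum>c<N. \<Sum>r<N. \<Sum>q<N. \<Sum>d<N. gram_pow k w c d * cnj (Y w r d) * Y w r q * gram_pow j w q c)"
    unfolding gram_adj_def ygram_def mat_mul_def sum_distrib_left sum_distrib_right
    by (subst sum.swap) (simp add: ac_simps)
  also have "\<dots> = (\<Sum>c<N. mat_mul N (gram_pow (Suc k) w) (gram_pow j w) c c)"
    unfolding gram_pow.simps mat_mul_def gram_def sum_distrib_left sum_distrib_right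
  proof (rule sum.cong[OF refl])
    fix c assume "c \<in> {..<N}"
    have "(\<Sum>r<N. \<Sum>q<N. \<Sum>d<N. gram_pow k w c d * cnj (Y w r d) * Y w r q * gram_pow j w q c) =
       (\<Sum>q<N. \<Sum>r<N. \<Sum>d<N. gram_pow k w c d * cnj (Y w r d) * Y w r q * gram_pow j w q c)" by (rule sum.swap)
    also have "\<dots> = (\<Sum>q<N. \<Sum>d<N. \<Sum>r<N. gram_pow k w c d * cnj (Y w r d) * Y w r q * gram_pow j w q c)"
      by (intro sum.cong refl sum.swap)
    finally show "(\<Sum>r<N. \<Sum>q<N. \<Sum>d<N. gram_pow k w c d * cnj (Y w r d) * Y w r q * gram_pow j w q c) =
      (\<Sum>q<N. \<Sum>d<N. \<Sum>r<N. gram_pow k w c d * (cnj (Y w r d) * Y w r q) * gram_pow j w q c)"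
      by (simp add: ac_simps)
  qed
  also have "\<dots> = gram_trace (Suc k + j) w" unfolding gram_trace_def by (intro sum.cong refl gram_pow_add) auto
  finally show ?thesis .
qed

definition trace_prod :: "nat list \<Rightarrow> ('i \<times> bool \<Rightarrow> real) \<Rightarrow> complex" where
  "trace_prod ks w = prod_list (map (\<lambda>k. gram_trace k w) ks)"

lemma trace_prod_simps [simp]: "trace_prod [] w = 1" "trace_prod (k # ks) w = gram_trace k w * trace_prod ks w"
  by (simp_all add: trace_prod_def)

lemma dbar_trace_prod:
  assumes "r < N" "c < N"
  shows "dbar (h r c) (trace_prod ks) (\<lambda>w. \<Sum>i<length ks. of_nat (ks ! i) * ygram (ks ! i - 1) w r c * trace_prod (omit i ks) w)"
proof (induction ks)
  case Nil
  then show ?case by (simp add: trace_prod_def dbar_const)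
next
  case (Cons k ks)
  have "dbar (h r c) (\<lambda>w. gram_trace k w * trace_prod ks w)
    (\<lambda>w. (of_nat k * ygram (k - 1) w r c) * trace_prod ks w + gram_trace k w * (\<Sum>i<length ks. of_nat (ks ! i) * ygram (ks ! i - 1) w r c * trace_prod (omit i ks) w))"
    by (intro dbar_mult dbar_gram_trace assms Cons.IH)
  then show ?case
    by (rule dbar_cong) (auto simp: omit_def sum.lessThan_Suc_shift sum_distrib_left ac_simps simp del: sum.lessThan_Suc)
qed

definition trace_moment :: "nat list \<Rightarrow> complex" where
  "trace_moment ks = expectation (\<lambda>\<omega>. trace_prod ks (cfg \<omega>))"

lemma integrable_trace_prod: "integrable M (\<lambda>\<omega>. trace_prod ks (cfg \<omega>))"
\<comment> \<open>Integrability is read off \<open>dbar_trace_prod\<close>, which needs a matrix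
  position to differentiate at; for \<open>N = 0\<close> there is none, but all traces
  vanish.\<close>
proof (cases "N = 0")
  case True
  have "gram_trace k w = 0" for k w unfolding gram_trace_def using True by simp
  then show ?thesis by (cases ks) auto
next
  case False
  then show ?thesis using dbar_integrable(1)[OF dbar_trace_prod[of 0 0 ks]] by simp
qed

lemma trace_moment_Nil: "trace_moment [] = 1"
  by (simp add: trace_moment_def prob_space)

lemma trace_moment_zero: "trace_moment (0 # ks) = of_nat N * trace_moment ks"
  by (simp add: trace_moment_def gram_trace_def)

text \<open>The isolated Gram power is counted once for each row and so supplies the summand
  \<open>l = k\<close>, since \<open>gram_trace 0\<close> is \<open>N\<close>; the cuts inside the
  power supply \<open>l < k\<close>.\<close>

lemma sum_dbar_gram_adj:
  "(\<Sum>r<N. \<Sum>c<N. gram_pow k w c c + (\<Sum>l<k. gram_pow l w c c * (\<Sum>d<N. ygram (k - Suc l) w r d * cnj (Y w r d)))) =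
    (\<Sum>l\<le>k. gram_trace l w * gram_trace (k - l) w)"
proof -
  have "(\<Sum>r<N. \<Sum>c<N. \<Sum>l<k. gram_pow l w c c * (\<Sum>d<N. ygram (k - Suc l) w r d * cnj (Y w r d))) =
    (\<Sum>r<N. \<Sum>l<k. gram_trace l w * (\<Sum>d<N. ygram (k - Suc l) w r d * cnj (Y w r d)))"
    unfolding gram_trace_def sum_distrib_right by (intro sum.cong refl sum.swap)
  also have "\<dots> = (\<Sum>l<k. \<Sum>r<N. gram_trace l w * (\<Sum>d<N. ygram (k - Suc l) w r d * cnj (Y w r d)))"
    by (rule sum.swap)
  also have "\<dots> = (\<Sum>l<k. gram_trace l w * gram_trace (k - l) w)"
    by (intro sum.cong refl) (simp add: sum_ygram_cnj_Y Suc_diff_Suc flip: sum_distrib_left)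
  finally show ?thesis
    by (simp add: sum.distrib lessThan_Suc_atMost[symmetric] gram_trace_def[of k] gram_trace_def[of 0] mult.commute)
qed

text \<open>One \<open>Y\<close> is taken out of the first trace and integrated by parts. The
  derivative either cuts this trace in two or joins it to another trace, at any of the
  \<open>ks ! i\<close> positions there.\<close>

theorem trace_moment_Suc:
  "trace_moment (Suc k # ks) = of_real (2 * s\<^sup>2) * ((\<Sum>l\<le>k. trace_moment (l # (k - l) # ks)) +
    (\<Sum>i<length ks. of_nat (ks ! i) * trace_moment ((k + ks ! i) # omit i ks)))"
proof -
  let ?D = "\<lambda>r c w. (gram_pow k w c c + (\<Sum>l<k. gram_pow l w c c * (\<Sum>d<N. ygram (k - Suc l) w r d * cnj (Y w r d)))) * trace_prod ks w +
      gram_adj k w c r * (\<Sum>i<length ks. of_nat (ks ! i) * ygram (ks ! i - 1) w r c * trace_prod (omit i ks) w)"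
  have D: "dbar (h r c) (\<lambda>w. gram_adj k w c r * trace_prod ks w) (?D r c)" if "r < N" "c < N" for r c
    by (intro dbar_mult dbar_gram_adj dbar_trace_prod that)
  have iYP: "integrable M (\<lambda>\<omega>. Y (cfg \<omega>) r c * (gram_adj k (cfg \<omega>) c r * trace_prod ks (cfg \<omega>)))" if "r < N" "c < N" for r c
    using dbar_integrable(1)[OF dbar_mult[OF dbar_Y[OF that] D[OF that]]] .
  have iD: "integrable M (\<lambda>\<omega>. ?D r c (cfg \<omega>))" if "r < N" "c < N" for r c
    using dbar_integrable(2)[OF D[OF that]] .
  have "trace_moment (Suc k # ks) = expectation (\<lambda>\<omega>. \<Sum>r<N. \<Sum>c<N. Y (cfg \<omega>) r c * (gram_adj k (cfg \<omega>) c r * trace_prod ks (cfg \<omega>)))"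
    by (simp add: trace_moment_def gram_trace_Suc sum_distrib_right mult.assoc)
  also have "\<dots> = (\<Sum>r<N. \<Sum>c<N. expectation (\<lambda>\<omega>. Y (cfg \<omega>) r c * (gram_adj k (cfg \<omega>) c r * trace_prod ks (cfg \<omega>))))"
    by (rule integral_sum_sum) (rule iYP)
  also have "\<dots> = (\<Sum>r<N. \<Sum>c<N. of_real (2 * s\<^sup>2) * expectation (\<lambda>\<omega>. ?D r c (cfg \<omega>)))"
    by (intro sum.cong refl) (simp only: Y_def[abs_def] dbar_expectation[OF D h_in] lessThan_iff)
  also have "\<dots> = of_real (2 * s\<^sup>2) * expectation (\<lambda>\<omega>. \<Sum>r<N. \<Sum>c<N. ?D r c (cfg \<omega>))"
  proof -
    have e: "expectation (\<lambda>\<omega>. \<Sum>r<N. \<Sum>c<N. ?D r c (cfg \<omega>)) = (\<Sum>r<N. \<Sum>c<N. expectation (\<lambda>\<omega>. ?D r c (cfg \<omega>)))"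
      by (rule integral_sum_sum) (rule iD)
    show ?thesis unfolding e by (simp only: sum_distrib_left)
  qed
  also have "(\<lambda>\<omega>. \<Sum>r<N. \<Sum>c<N. ?D r c (cfg \<omega>)) = (\<lambda>\<omega>. (\<Sum>l\<le>k. trace_prod (l # (k - l) # ks) (cfg \<omega>)) +
      (\<Sum>i<length ks. of_nat (ks ! i) * trace_prod ((k + ks ! i) # omit i ks) (cfg \<omega>)))"
  proof
    fix \<omega>
    define w where "w = cfg \<omega>"
    have "(\<Sum>r<N. \<Sum>c<N. gram_adj k w c r * (\<Sum>i<length ks. of_nat (ks ! i) * ygram (ks ! i - 1) w r c * trace_prod (omit i ks) w)) =
      (\<Sum>i<length ks. of_nat (ks ! i) * (\<Sum>r<N. \<Sum>c<N. gram_adj k w c r * ygram (ks ! i - 1) w r c) * trace_prod (omit i ks) w)"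
    proof -
      have "(\<Sum>r<N. \<Sum>c<N. gram_adj k w c r * (\<Sum>i<length ks. of_nat (ks ! i) * ygram (ks ! i - 1) w r c * trace_prod (omit i ks) w)) =
        (\<Sum>r<N. \<Sum>i<length ks. \<Sum>c<N. of_nat (ks ! i) * (gram_adj k w c r * ygram (ks ! i - 1) w r c) * trace_prod (omit i ks) w)"
        unfolding sum_distrib_left by (rule sum.cong[OF refl], subst sum.swap) (simp add: ac_simps)
      also have "\<dots> = (\<Sum>i<length ks. \<Sum>r<N. \<Sum>c<N. of_nat (ks ! i) * (gram_adj k w c r * ygram (ks ! i - 1) w r c) * trace_prod (omit i ks) w)"
        by (rule sum.swap)
      finally show ?thesis by (simp add: sum_distrib_left sum_distrib_right)
    qed
    also have "\<dots> = (\<Sum>i<length ks. of_nat (ks ! i) * trace_prod ((k + ks ! i) # omit i ks) w)"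
    proof (intro sum.cong refl)
      fix i
      show "of_nat (ks ! i) * (\<Sum>r<N. \<Sum>c<N. gram_adj k w c r * ygram (ks ! i - 1) w r c) * trace_prod (omit i ks) w =
        of_nat (ks ! i) * trace_prod ((k + ks ! i) # omit i ks) w"
        \<comment> \<open>The degree \<open>Suc k + (ks ! i - 1)\<close> equals
          \<open>k + ks ! i\<close> only for positive \<open>ks ! i\<close>; otherwise the
          coefficient is 0.\<close>
        unfolding sum_gram_adj_ygram by (cases "ks ! i") auto
    qed
    finally have 1: "(\<Sum>r<N. \<Sum>c<N. gram_adj k w c r * (\<Sum>i<length ks. of_nat (ks ! i) * ygram (ks ! i - 1) w r c * trace_prod (omit i ks) w)) = \<dots>" .
    show "(\<Sum>r<N. \<Sum>c<N. ?D r c (cfg \<omega>)) = (\<Sum>l\<le>k. trace_prod (l # (k - l) # ks) (cfg \<omega>)) +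
      (\<Sum>i<length ks. of_nat (ks ! i) * trace_prod ((k + ks ! i) # omit i ks) (cfg \<omega>))"
      unfolding w_def[symmetric] sum_sum_mult_add 1 sum_dbar_gram_adj
      by (simp add: sum_distrib_left ac_simps)
  qed
  also have "expectation \<dots> = (\<Sum>l\<le>k. trace_moment (l # (k - l) # ks)) + (\<Sum>i<length ks. of_nat (ks ! i) * trace_moment ((k + ks ! i) # omit i ks))"
    unfolding trace_moment_def
    by (subst Bochner_Integration.integral_add)
      (auto simp: Bochner_Integration.integral_sum integrable_trace_prod simp del: trace_prod_simps intro!: Bochner_Integration.integrable_sum)
  finally show ?thesis .
qed

end

section \<open>Bounds for the mixed moments\<close>

lemma prod_list_omit:
  fixes f :: "nat \<Rightarrow> 'b :: comm_monoid_mult"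
  assumes "i < length ks"
  shows "f (ks ! i) * prod_list (map f (omit i ks)) = prod_list (map f ks)"
proof -
  have "ks = take i ks @ ks ! i # drop (Suc i) ks" using assms by (rule id_take_nth_drop)
  then have "prod_list (map f ks) = prod_list (map f (take i ks @ ks ! i # drop (Suc i) ks))" by simp
  then show ?thesis by (simp add: omit_def ac_simps)
qed

lemma sum_list_omit:
  assumes "i < length ks"
  shows "ks ! i + sum_list (omit i ks) = sum_list (ks :: nat list)"
proof -
  have "ks = take i ks @ ks ! i # drop (Suc i) ks" using assms by (rule id_take_nth_drop)
  then have "sum_list ks = sum_list (take i ks @ ks ! i # drop (Suc i) ks)" by simp
  then show ?thesis by (simp add: omit_def)
qed

lemma length_omit: "i < length ks \<Longrightarrow> length (omit i ks) = length ks - 1"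
  by (simp add: omit_def)

text \<open>The excess over 1 is set by \<open>moment_bound_step\<close>: times \<open>N^2\<close>
  it is \<open>m * (m + 1)^2\<close>, where \<open>m\<close> bounds the number of joinings and
  \<open>(m + 1)^2\<close> is the loss in \<open>catalan_ge\<close>.\<close>

definition growth :: "nat \<Rightarrow> nat \<Rightarrow> real" where
  "growth N m = 1 + real m * (real m + 1)\<^sup>2 / (real N)\<^sup>2"

lemma growth_ge_1: "growth N m \<ge> 1"
  by (simp add: growth_def)

text \<open>\<open>N * catalan k\<close> solves the recursion without joining terms; the power of
  \<open>growth N m\<close> corrects for them.\<close>

definition moment_bound :: "nat \<Rightarrow> nat \<Rightarrow> nat \<Rightarrow> real" where
  "moment_bound N m k = real N * catalan k * growth N m ^ k"

lemma moment_bound_nonneg: "moment_bound N m k \<ge> 0"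
  using catalan_pos[of k] growth_ge_1[of N m] by (simp add: moment_bound_def)

lemma moment_bound_zero: "moment_bound N m 0 = real N"
  by (simp add: moment_bound_def)

lemma moment_bound_add_le: "moment_bound N m (k + p) \<le> (4 * growth N m) ^ k * moment_bound N m p"
proof -
  have "real N * catalan (k + p) * growth N m ^ (k + p) \<le> real N * (4 ^ k * catalan p) * growth N m ^ (k + p)"
    using growth_ge_1[of N m] by (intro mult_right_mono mult_left_mono catalan_add_le) auto
  then show ?thesis by (simp add: moment_bound_def power_add power_mult_distrib ac_simps)
qed

text \<open>With \<open>L\<close> for \<open>growth N m\<close>, the convolution evaluates the cut
  terms as \<open>N^2 * L^k * catalan (Suc k)\<close>, and the choice of \<open>L\<close> bounds the
  joining terms by \<open>L - 1\<close> times this quantity. Together they give one more factor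
  \<open>L\<close>.\<close>

lemma moment_bound_step:
  assumes N: "N \<ge> 1" and k: "Suc k \<le> m"
  shows "1 / real N * ((\<Sum>l\<le>k. moment_bound N m l * moment_bound N m (k - l)) + real m * (4 * growth N m) ^ k) \<le> moment_bound N m (Suc k)"
proof -
  let ?L = "growth N m"
  have "moment_bound N m l * moment_bound N m (k - l) = (real N)\<^sup>2 * ?L ^ k * (catalan l * catalan (k - l))" if "l \<le> k" for l
    using that by (simp add: moment_bound_def power2_eq_square ac_simps flip: power_add)
  then have "(\<Sum>l\<le>k. moment_bound N m l * moment_bound N m (k - l)) = (\<Sum>l\<le>k. (real N)\<^sup>2 * ?L ^ k * (catalan l * catalan (k - l)))"
    by (intro sum.cong) auto
  then have 1: "(\<Sum>l\<le>k. moment_bound N m l * moment_bound N m (k - l)) = (real N)\<^sup>2 * ?L ^ k * catalan (Suc k)"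
    unfolding sum_distrib_left[symmetric] catalan_convolution .
  have "4 ^ k \<le> (4::real) ^ Suc k" by simp
  also have "\<dots> \<le> (real (Suc k) + 1)\<^sup>2 * catalan (Suc k)" by (rule catalan_ge)
  also have "\<dots> \<le> (real m + 1)\<^sup>2 * catalan (Suc k)"
    using k catalan_pos[of "Suc k"] by (intro mult_right_mono power_mono) auto
  finally have "real m * 4 ^ k * ?L ^ k \<le> real m * ((real m + 1)\<^sup>2 * catalan (Suc k)) * ?L ^ k"
    using growth_ge_1[of N m] by (intro mult_right_mono mult_left_mono) auto
  also have "\<dots> = (real N)\<^sup>2 * (?L - 1) * ?L ^ k * catalan (Suc k)"
    using N by (simp add: growth_def ac_simps)
  finally have "(real N)\<^sup>2 * ?L ^ k * catalan (Suc k) + real m * (4 * ?L) ^ k \<le> (real N)\<^sup>2 * ?L ^ Suc k * catalan (Suc k)"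
    by (simp add: power_mult_distrib algebra_simps del: catalan.simps)
  then have "1 / real N * ((real N)\<^sup>2 * ?L ^ k * catalan (Suc k) + real m * (4 * ?L) ^ k) \<le>
      1 / real N * ((real N)\<^sup>2 * ?L ^ Suc k * catalan (Suc k))"
    by (intro mult_left_mono) auto
  also have "\<dots> = moment_bound N m (Suc k)"
    using N by (simp add: moment_bound_def power2_eq_square ac_simps del: catalan.simps)
  finally show ?thesis unfolding 1 .
qed

text \<open>The parameter \<open>m\<close> only caps the total degree, which never increases in the
  recursion, so one value of \<open>growth\<close> serves throughout. The degree has weight 2 in the
  induction measure because a cut lowers it by one while lengthening the list by one.\<close>

lemma (in ginibre) norm_trace_moment_le:
  assumes N: "N \<ge> 1" and s: "2 * s\<^sup>2 = 1 / real N" and "sum_list ks \<le> m"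
  shows "cmod (trace_moment ks) \<le> prod_list (map (moment_bound N m) ks)"
  using assms(3)
proof (induction ks rule: measure_induct_rule[of "\<lambda>ks. 2 * sum_list ks + length ks"])
  case (less ks)
  show ?case
  proof (cases ks)
    case Nil
    then show ?thesis by (simp add: trace_moment_Nil)
  next
    case (Cons p ps)
    let ?P = "prod_list (map (moment_bound N m) ps)"
    have P: "?P \<ge> 0" by (intro prod_list_nonneg) (auto simp: moment_bound_nonneg)
    show ?thesis
    proof (cases p)
      case 0
      have "cmod (trace_moment ps) \<le> ?P" using less Cons 0 by auto
      then show ?thesis using Cons 0 by (simp add: trace_moment_zero norm_mult moment_bound_zero mult_left_mono)
    next
      case (Suc k)
      have 1: "cmod (trace_moment (l # (k - l) # ps)) \<le> moment_bound N m l * moment_bound N m (k - l) * ?P" if "l \<le> k" for l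
        using less.IH[of "l # (k - l) # ps"] less.prems Cons Suc that by (simp add: mult.assoc)
      \<comment> \<open>Trading the degree \<open>k + ps ! i\<close> for \<open>ps ! i\<close> costs
        \<open>(4 * growth N m) ^ k\<close> and restores the omitted factor, so that all joining
        terms share the product \<open>?P\<close>.\<close>
      have 2: "cmod (of_nat (ps ! i) * trace_moment ((k + ps ! i) # omit i ps)) \<le> real (ps ! i) * ((4 * growth N m) ^ k * ?P)"
        if i: "i < length ps" for i
      proof -
        have nn: "prod_list (map (moment_bound N m) (omit i ps)) \<ge> 0" by (intro prod_list_nonneg) (auto simp: moment_bound_nonneg)
        have "cmod (trace_moment ((k + ps ! i) # omit i ps)) \<le> moment_bound N m (k + ps ! i) * prod_list (map (moment_bound N m) (omit i ps))"
          using less.IH[of "(k + ps ! i) # omit i ps"] less.prems Cons Suc i sum_list_omit[OF i] length_omit[OF i]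
          by simp
        also have "\<dots> \<le> (4 * growth N m) ^ k * moment_bound N m (ps ! i) * prod_list (map (moment_bound N m) (omit i ps))"
          by (intro mult_right_mono moment_bound_add_le nn)
        also have "\<dots> = (4 * growth N m) ^ k * ?P"
          by (simp add: mult.assoc prod_list_omit[OF i])
        finally show ?thesis by (simp add: norm_mult mult_left_mono)
      qed
      have "cmod (trace_moment ks) \<le> 1 / real N * (cmod (\<Sum>l\<le>k. trace_moment (l # (k - l) # ps)) +
          cmod (\<Sum>i<length ps. of_nat (ps ! i) * trace_moment ((k + ps ! i) # omit i ps)))"
        unfolding Cons Suc trace_moment_Suc s norm_mult by (intro mult_mono norm_triangle_ineq) (auto simp: norm_divide)
      also have "\<dots> \<le> 1 / real N * ((\<Sum>l\<le>k. moment_bound N m l * moment_bound N m (k - l) * ?P) +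
          (\<Sum>i<length ps. real (ps ! i) * ((4 * growth N m) ^ k * ?P)))"
      proof (intro mult_left_mono add_mono)
        show "cmod (\<Sum>l\<le>k. trace_moment (l # (k - l) # ps)) \<le> (\<Sum>l\<le>k. moment_bound N m l * moment_bound N m (k - l) * ?P)"
          by (rule sum_norm_le, rule 1) simp
        show "cmod (\<Sum>i<length ps. of_nat (ps ! i) * trace_moment ((k + ps ! i) # omit i ps)) \<le>
            (\<Sum>i<length ps. real (ps ! i) * ((4 * growth N m) ^ k * ?P))"
          by (rule sum_norm_le, rule 2) simp
      qed simp
      also have "\<dots> \<le> 1 / real N * ((\<Sum>l\<le>k. moment_bound N m l * moment_bound N m (k - l) * ?P) + real m * ((4 * growth N m) ^ k * ?P))"
      proof (intro mult_left_mono add_mono order_refl)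
        have "(\<Sum>i<length ps. real (ps ! i) * ((4 * growth N m) ^ k * ?P)) = real (sum_list ps) * ((4 * growth N m) ^ k * ?P)"
          by (simp add: sum_distrib_right[symmetric] sum_list_sum_nth atLeast0LessThan)
        also have "\<dots> \<le> real m * ((4 * growth N m) ^ k * ?P)"
          using less.prems Cons Suc growth_ge_1[of N m] P by (intro mult_right_mono) auto
        finally show "(\<Sum>i<length ps. real (ps ! i) * ((4 * growth N m) ^ k * ?P)) \<le> real m * ((4 * growth N m) ^ k * ?P)" .
      qed simp
      also have "\<dots> =
         1 / real N * ((\<Sum>l\<le>k. moment_bound N m l * moment_bound N m (k - l)) + real m * (4 * growth N m) ^ k) * ?P"
        by (simp add: sum_distrib_left algebra_simps)
      also have "\<dots> \<le> moment_bound N m (Suc k) * ?P"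
        using less.prems Cons Suc by (intro mult_right_mono moment_bound_step N P) auto
      finally show ?thesis using Cons Suc by simp
    qed
  qed
qed

section \<open>Decoupling\<close>

type_synonym mat_family = "nat \<Rightarrow> nat \<Rightarrow> nat \<Rightarrow> complex"

definition letter :: "nat \<Rightarrow> mat_family \<Rightarrow> nat \<times> nat \<Rightarrow> nat \<Rightarrow> nat \<Rightarrow> complex" where
  "letter N Z jk = (\<lambda>p q. \<Sum>x<N. cnj (Z (fst jk) x p) * Z (snd jk) x q)"

fun word :: "nat \<Rightarrow> mat_family \<Rightarrow> (nat \<Rightarrow> nat \<times> nat) \<Rightarrow> nat \<Rightarrow> nat \<Rightarrow> nat \<Rightarrow> complex" where
  "word N Z K 0 = (\<lambda>p q. of_bool (p = q))"
| "word N Z K (Suc m) = mat_mul N (word N Z K m) (letter N Z (K m))"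

definition word_trace :: "nat \<Rightarrow> mat_family \<Rightarrow> (nat \<Rightarrow> nat \<times> nat) \<Rightarrow> nat \<Rightarrow> complex" where
  "word_trace N Z K m = (\<Sum>p<N. word N Z K m p p)"

lemma word_cong: "(\<And>i. i < m \<Longrightarrow> K i = K' i) \<Longrightarrow> word N Z K m = word N Z K' m"
  by (induction m) auto

text \<open>
  The entry \<open>(x, d, q)\<close> at position \<open>i\<close> of a path stands for the summand \<open>cnj (Z\<^sub>j x d) * Z\<^sub>k x q\<close> of the
  \<open>i\<close>-th letter.
\<close>

fun paths :: "nat \<Rightarrow> nat \<Rightarrow> nat \<Rightarrow> nat \<Rightarrow> (nat \<times> nat \<times> nat) list set" where
  "paths N 0 p q = (if p = q then {[]} else {})"
| "paths N (Suc m) p q = (\<lambda>(d, x, v). v @ [(x, d, q)]) ` (SIGMA d:{..<N}. {..<N} \<times> paths N m p d)"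

lemma paths_length: "v \<in> paths N m p q \<Longrightarrow> length v = m"
  by (induction m arbitrary: v q) (auto split: if_splits)

lemma finite_paths: "finite (paths N m p q)"
  by (induction m arbitrary: q) (auto intro!: finite_imageI finite_SigmaI)

lemma paths_less: "v \<in> paths N m p q \<Longrightarrow> q < N \<Longrightarrow> i < m \<Longrightarrow> v ! i \<in> {..<N} \<times> {..<N} \<times> {..<N}"
  by (induction m arbitrary: v q) (auto simp: nth_append paths_length less_Suc_eq)

definition path_in :: "(nat \<times> nat \<times> nat) list \<Rightarrow> nat \<Rightarrow> nat \<times> nat" where
  "path_in v i = (case v ! i of (x, d, q) \<Rightarrow> (x, d))"

definition path_out :: "(nat \<times> nat \<times> nat) list \<Rightarrow> nat \<Rightarrow> nat \<times> nat" where
  "path_out v i = (case v ! i of (x, d, q) \<Rightarrow> (x, q))"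

definition fam :: "(nat \<times> nat \<times> nat \<Rightarrow> complex) \<Rightarrow> mat_family" where
  "fam y = (\<lambda>j r c. y (j, r, c))"

text \<open>Multiplying out brings a word into the form required by \<open>wick\<close>: equally
  many variables and conjugates, with labels from the word and positions from the path.\<close>

lemma word_eq_sum_paths:
  "word N (fam y) K m p q = (\<Sum>v\<in>paths N m p q.
     (\<Prod>i<m. y (snd (K i), path_out v i)) * (\<Prod>i<m. cnj (y (fst (K i), path_in v i))))"
proof (induction m arbitrary: q)
  case 0
  then show ?case by simp
next
  case (Suc m)
  let ?f = "\<lambda>m v. (\<Prod>i<m. y (snd (K i), path_out v i)) * (\<Prod>i<m. cnj (y (fst (K i), path_in v i)))"
  have inj: "inj_on (\<lambda>(d, x, v). v @ [(x, d, q)]) (SIGMA d:{..<N}. {..<N} \<times> paths N m p d)"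
    by (auto simp: inj_on_def)
  have "word N (fam y) K (Suc m) p q =
      (\<Sum>d<N. \<Sum>x<N. \<Sum>v\<in>paths N m p d. ?f m v * (cnj (y (fst (K m), x, d)) * y (snd (K m), x, q)))"
    unfolding word.simps mat_mul_def Suc.IH unfolding letter_def fam_def sum_distrib_left unfolding sum_distrib_right ..
  also have "\<dots> = (\<Sum>d<N. \<Sum>x<N. \<Sum>v\<in>paths N m p d. ?f (Suc m) (v @ [(x, d, q)]))"
  proof (intro sum.cong refl)
    fix d x v assume v: "v \<in> paths N m p d"
    have "path_in (v @ [(x, d, q)]) i = path_in v i" "path_out (v @ [(x, d, q)]) i = path_out v i" if "i < m" for i
      using that paths_length[OF v] by (auto simp: path_in_def path_out_def nth_append)
    moreover have "path_in (v @ [(x, d, q)]) m = (x, d)" "path_out (v @ [(x, d, q)]) m = (x, q)"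
      using paths_length[OF v] by (auto simp: path_in_def path_out_def nth_append)
    ultimately show "?f m v * (cnj (y (fst (K m), x, d)) * y (snd (K m), x, q)) = ?f (Suc m) (v @ [(x, d, q)])"
      by (simp add: ac_simps)
  qed
  also have "\<dots> = (\<Sum>(d, x, v)\<in>(SIGMA d:{..<N}. {..<N} \<times> paths N m p d). ?f (Suc m) (v @ [(x, d, q)]))"
    unfolding sum.cartesian_product by (rule sum.Sigma) (auto simp: finite_paths)
  also have "\<dots> = (\<Sum>v\<in>paths N (Suc m) p q. ?f (Suc m) v)"
    unfolding paths.simps by (subst sum.reindex[OF inj]) (auto intro!: sum.cong)
  finally show ?case .
qed

definition coef :: "(nat \<Rightarrow> complex) \<Rightarrow> (nat \<Rightarrow> nat \<times> nat) \<Rightarrow> nat \<Rightarrow> complex" where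
  "coef a K m = (\<Prod>i<m. cnj (a (fst (K i))) * a (snd (K i)))"

locale ginibre_family = gaussian_family M "{1..n} \<times> {..<N} \<times> {..<N}" s X
  for M :: "'a measure" and n N :: nat and s :: real and X +
  assumes n_pos: "n \<ge> 1" and N_pos: "N \<ge> 1" and s_eq: "2 * s\<^sup>2 = 1 / real N"
begin

text \<open>The matrix with label 1 plays the single Ginibre matrix, which makes the trace moments
  available for \<open>total_weight\<close> on the same probability space.\<close>

sublocale ginibre M "{1..n} \<times> {..<N} \<times> {..<N}" s X N "\<lambda>r c. (1, r, c)"
  by unfold_locales (use n_pos in auto)

definition Z :: "'a \<Rightarrow> mat_family" where
  "Z \<omega> = fam (\<lambda>e. y e (cfg \<omega>))"

text \<open>The contribution of the pairing \<open>\<pi>\<close> to a word whose labels it matches.\<close>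

definition weight :: "nat \<Rightarrow> (nat \<Rightarrow> nat) \<Rightarrow> real" where
  "weight m \<pi> = (1 / real N) ^ m * (\<Sum>p<N. \<Sum>v\<in>paths N m p p. of_bool (\<forall>i<m. path_out v i = path_in v (\<pi> i)))"

lemma weight_nonneg: "weight m \<pi> \<ge> 0"
  unfolding weight_def by (intro mult_nonneg_nonneg sum_nonneg) auto

definition total_weight :: "nat \<Rightarrow> real" where
  "total_weight m = (\<Sum>\<pi> | \<pi> permutes {..<m}. weight m \<pi>)"

lemma total_weight_nonneg: "total_weight m \<ge> 0"
  unfolding total_weight_def by (intro sum_nonneg weight_nonneg)

lemma prod_of_bool: "finite S \<Longrightarrow> (\<Prod>i\<in>S. of_bool (P i)) = (of_bool (\<forall>i\<in>S. P i) :: 'b :: comm_semiring_1)"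
  by (induction S rule: finite_induct) auto

text \<open>The \<open>F\<close> of the overview. Equality of the paired variables splits into
  equality of labels and of positions; only the first depends on \<open>K\<close>, which is why
  \<open>weight\<close> does not.\<close>

definition word_mean :: "(nat \<Rightarrow> nat \<times> nat) \<Rightarrow> nat \<Rightarrow> real" where
  "word_mean K m = (\<Sum>\<pi> | \<pi> permutes {..<m}. of_bool (\<forall>i<m. snd (K i) = fst (K (\<pi> i))) * weight m \<pi>)"

lemma word_mean_nonneg: "word_mean K m \<ge> 0"
  unfolding word_mean_def by (intro sum_nonneg mult_nonneg_nonneg weight_nonneg) auto

lemma word_mean_le: "word_mean K m \<le> total_weight m"
  unfolding word_mean_def total_weight_def
  by (intro sum_mono) (auto simp: weight_nonneg)

lemma word_trace_integral:
  assumes K: "\<And>i. i < m \<Longrightarrow> K i \<in> {1..n} \<times> {1..n}"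
  shows "has_bochner_integral M (\<lambda>\<omega>. word_trace N (Z \<omega>) K m) (of_real (word_mean K m))"
proof -
  let ?g = "\<lambda>v \<omega>. (\<Prod>i<m. y (snd (K i), path_out v i) (cfg \<omega>)) * (\<Prod>i<m. cnj (y (fst (K i), path_in v i) (cfg \<omega>)))"
  have mem: "(snd (K i), path_out v i) \<in> {1..n} \<times> {..<N} \<times> {..<N}" "(fst (K i), path_in v i) \<in> {1..n} \<times> {..<N} \<times> {..<N}"
    if "v \<in> paths N m p p" "p < N" "i < m" for v p i
    using paths_less[OF that] K[OF that(3)] by (auto simp: path_in_def path_out_def split: prod.splits)
  have int: "has_bochner_integral M (?g v) (of_real ((1 / real N) ^ m *
      (\<Sum>\<pi> | \<pi> permutes {..<m}. of_bool (\<forall>i<m. snd (K i) = fst (K (\<pi> i))) * of_bool (\<forall>i<m. path_out v i = path_in v (\<pi> i)))))"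
    if v: "v \<in> paths N m p p" and p: "p < N" for v p
  proof -
    have "integrable M (?g v)"
      by (intro dbar_integrable(1)[OF dbar_wick[of "{..<m}" "{..<m}" "\<lambda>i. (snd (K i), path_out v i)" "\<lambda>i. (fst (K i), path_in v i)"]])
        (use mem[OF v p] in auto)
    moreover have "integral\<^sup>L M (?g v) = of_real ((2 * s\<^sup>2) ^ card {..<m}) * (\<Sum>\<pi> | \<pi> permutes {..<m}. \<Prod>i\<in>{..<m}.
        of_bool ((snd (K i), path_out v i) = (fst (K (\<pi> i)), path_in v (\<pi> i))))"
      by (rule wick) (use mem[OF v p] in auto)
    moreover have "(\<Prod>i\<in>{..<m}. of_bool ((snd (K i), path_out v i) = (fst (K (\<pi> i)), path_in v (\<pi> i)))) =
      (of_bool (\<forall>i<m. snd (K i) = fst (K (\<pi> i))) * of_bool (\<forall>i<m. path_out v i = path_in v (\<pi> i)) :: complex)" for \<pi>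
      by (subst prod_of_bool) auto
    moreover have ob: "complex_of_real (of_bool P) = of_bool P" for P by simp
    ultimately show ?thesis
      using s_eq ob by (simp add: has_bochner_integral_iff)
  qed
  have "(\<lambda>\<omega>. word_trace N (Z \<omega>) K m) = (\<lambda>\<omega>. \<Sum>p<N. \<Sum>v\<in>paths N m p p. ?g v \<omega>)"
    unfolding word_trace_def Z_def word_eq_sum_paths ..
  moreover have "has_bochner_integral M (\<lambda>\<omega>. \<Sum>p<N. \<Sum>v\<in>paths N m p p. ?g v \<omega>)
    (\<Sum>p<N. \<Sum>v\<in>paths N m p p. of_real ((1 / real N) ^ m *
      (\<Sum>\<pi> | \<pi> permutes {..<m}. of_bool (\<forall>i<m. snd (K i) = fst (K (\<pi> i))) * of_bool (\<forall>i<m. path_out v i = path_in v (\<pi> i)))))"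
    by (intro has_bochner_integral_sum int) auto
  moreover have "(\<Sum>p<N. \<Sum>v\<in>paths N m p p. (1 / real N) ^ m *
      (\<Sum>\<pi> | \<pi> permutes {..<m}. of_bool (\<forall>i<m. snd (K i) = fst (K (\<pi> i))) * of_bool (\<forall>i<m. path_out v i = path_in v (\<pi> i)))) =
      word_mean K m" (is "?L = _")
  proof -
    let ?h = "\<lambda>p v \<pi>. (1 / real N) ^ m * (of_bool (\<forall>i<m. snd (K i) = fst (K (\<pi> i))) * of_bool (\<forall>i<m. path_out v i = path_in v (\<pi> i)))"
    have "?L = (\<Sum>p<N. \<Sum>v\<in>paths N m p p. \<Sum>\<pi> | \<pi> permutes {..<m}. ?h p v \<pi>)"
      by (simp only: sum_distrib_left)
    also have "\<dots> = (\<Sum>p<N. \<Sum>\<pi> | \<pi> permutes {..<m}. \<Sum>v\<in>paths N m p p. ?h p v \<pi>)"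
      by (rule sum.cong[OF refl], rule sum.swap)
    also have "\<dots> = (\<Sum>\<pi> | \<pi> permutes {..<m}. \<Sum>p<N. \<Sum>v\<in>paths N m p p. ?h p v \<pi>)"
      by (rule sum.swap)
    also have "\<dots> = word_mean K m"
      unfolding word_mean_def weight_def sum_distrib_left by (simp only: ac_simps)
    finally show ?thesis .
  qed
  ultimately show ?thesis by (simp only: of_real_sum[symmetric])
qed

lemma word_eq_gram_pow: "word N (Z \<omega>) (\<lambda>_. (1, 1)) k = gram_pow k (cfg \<omega>)"
proof (induction k)
  case (Suc k)
  have "letter N (Z \<omega>) (1, 1) = gram (cfg \<omega>)"
    by (simp add: letter_def gram_def Z_def fam_def Y_def fun_eq_iff del: One_nat_def)
  then show ?case by (simp add: Suc.IH del: One_nat_def)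
qed (simp del: One_nat_def)

text \<open>In the word with all labels equal to 1 every pairing matches, so
  \<open>total_weight m\<close> is the expectation of a single trace.\<close>

lemma total_weight_le: "total_weight m \<le> real N * (4 * growth N m) ^ m"
proof -
  have "has_bochner_integral M (\<lambda>\<omega>. word_trace N (Z \<omega>) (\<lambda>_. (1, 1)) m) (of_real (word_mean (\<lambda>_. (1, 1)) m))"
    using n_pos by (intro word_trace_integral) auto
  moreover have "word_trace N (Z \<omega>) (\<lambda>_. (1, 1)) m = trace_prod [m] (cfg \<omega>)" for \<omega>
    by (simp add: word_trace_def word_eq_gram_pow gram_trace_def del: One_nat_def)
  moreover have "word_mean (\<lambda>_. (1, 1)) m = total_weight m"
    by (simp add: word_mean_def total_weight_def)
  ultimately have "trace_moment [m] = of_real (total_weight m)"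
    unfolding trace_moment_def by (simp add: has_bochner_integral_iff)
  then have "total_weight m \<le> moment_bound N m m"
    using norm_trace_moment_le[OF N_pos s_eq, of "[m]" m] by simp
  also have "\<dots> \<le> real N * 4 ^ m * growth N m ^ m"
    unfolding moment_bound_def using growth_ge_1[of N m] by (intro mult_right_mono mult_left_mono catalan_le) auto
  finally show ?thesis by (simp add: power_mult_distrib ac_simps)
qed

text \<open>A fixed pairing determines the second labels from the first ones, so each sequence of
  first labels occurs at most once; multiplying out the power gives the sum over all such
  sequences.\<close>

lemma sum_matched_le:
  fixes b :: "nat \<Rightarrow> real"
  assumes b: "\<And>j. b j \<ge> 0" and \<pi>: "\<pi> permutes {..<m}"
  shows "(\<Sum>K\<in>PiE {..<m} (\<lambda>_. {1..n} \<times> {1..n}). of_bool (\<forall>i<m. snd (K i) = fst (K (\<pi> i))) * (\<Prod>i<m. b (fst (K i)))) \<le>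
    (\<Sum>j=1..n. b j) ^ m"
proof -
  let ?P = "PiE {..<m} (\<lambda>_. {1..n} \<times> {1..n})"
  let ?S = "{K \<in> ?P. \<forall>i<m. snd (K i) = fst (K (\<pi> i))}"
  let ?\<phi> = "\<lambda>K. \<lambda>i\<in>{..<m}. fst (K i :: nat \<times> nat)"
  have fin: "finite ?P" by (intro finite_PiE) auto
  have inj: "inj_on ?\<phi> ?S"
  proof (rule inj_onI)
    fix K K' assume K: "K \<in> ?S" "K' \<in> ?S" and eq: "?\<phi> K = ?\<phi> K'"
    have f: "fst (K i) = fst (K' i)" if "i < m" for i using fun_cong[OF eq, of i] that by simp
    have "\<pi> i < m" if "i < m" for i using permutes_in_image[OF \<pi>, of i] that by simp
    then have "snd (K i) = snd (K' i)" if "i < m" for i using K f that by simp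
    with f have "K i = K' i" if "i < m" for i using that by (simp add: prod_eq_iff)
    then show "K = K'" using K by (intro PiE_ext[of K "{..<m}" "\<lambda>_. {1..n} \<times> {1..n}" K']) auto
  qed
  have "(\<Sum>K\<in>?P. of_bool (\<forall>i<m. snd (K i) = fst (K (\<pi> i))) * (\<Prod>i<m. b (fst (K i)))) = (\<Sum>K\<in>?S. \<Prod>i<m. b (fst (K i)))"
    using fin by (intro sum.mono_neutral_cong_right) auto
  also have "\<dots> = (\<Sum>K\<in>?S. \<Prod>i<m. b (?\<phi> K i))" by (intro sum.cong prod.cong refl) auto
  also have "\<dots> = (\<Sum>j\<in>?\<phi> ` ?S. \<Prod>i<m. b (j i))" by (subst sum.reindex[OF inj]) simp
  also have "\<dots> \<le> (\<Sum>j\<in>PiE {..<m} (\<lambda>_. {1..n}). \<Prod>i<m. b (j i))"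
  proof (intro sum_mono2)
    show "?\<phi> ` ?S \<subseteq> PiE {..<m} (\<lambda>_. {1..n})"
    proof (intro image_subsetI PiE_I)
      fix K i assume "K \<in> ?S" "i \<in> {..<m}"
      then have "K i \<in> {1..n} \<times> {1..n}" by blast
      then show "?\<phi> K i \<in> {1..n}" using \<open>i \<in> {..<m}\<close> by auto
    qed auto
  qed (auto intro!: finite_PiE prod_nonneg b)
  also have "\<dots> = (\<Prod>i<m. \<Sum>j=1..n. b j)" by (rule prod_sum_PiE[symmetric]) auto
  finally show ?thesis by simp
qed

text \<open>A matching pairing makes the second labels a rearrangement of the first, so the
  coefficient becomes a product of \<open>(cmod (a j))\<^sup>2\<close>. Only one of the two factors
  \<open>word_mean\<close> is expanded over pairings; the other is replaced by
  \<open>total_weight\<close>, so a single label sequence remains to be summed.\<close>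

theorem decoupled_moment_le:
  "Re (\<Sum>K\<in>PiE {..<m} (\<lambda>_. {1..n} \<times> {1..n}). coef a K m * (of_real (word_mean K m) * cnj (of_real (word_mean K m)))) \<le>
    (\<Sum>j=1..n. (cmod (a j))\<^sup>2) ^ m * (total_weight m)\<^sup>2"
proof -
  let ?P = "PiE {..<m} (\<lambda>_. {1..n} \<times> {1..n})"
  let ?A = "\<lambda>K. \<Prod>i<m. (cmod (a (fst (K i))))\<^sup>2"
  let ?W = "total_weight m"
  have c: "coef a K m = of_real (?A K)" if "\<pi> permutes {..<m}" and match: "\<forall>i<m. snd (K i) = fst (K (\<pi> i))" for K \<pi>
  proof -
    have "coef a K m = (\<Prod>i<m. cnj (a (fst (K i)))) * (\<Prod>i<m. a (fst (K (\<pi> i))))"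
      using match by (simp add: coef_def prod.distrib)
    also have "(\<Prod>i<m. a (fst (K (\<pi> i)))) = (\<Prod>i<m. a (fst (K i)))"
      using prod.permute[OF that(1), of "\<lambda>i. a (fst (K i))"] by (simp add: comp_def)
    finally show ?thesis
      unfolding prod.distrib[symmetric] of_real_prod
      by (simp only:, intro prod.cong refl) (simp add: complex_norm_square ac_simps del: of_real_power)
  qed
  have "Re (coef a K m * (of_real (word_mean K m) * cnj (of_real (word_mean K m)))) \<le> ?W * (?A K * word_mean K m)" for K
  proof (cases "\<exists>\<pi>. \<pi> permutes {..<m} \<and> (\<forall>i<m. snd (K i) = fst (K (\<pi> i)))")
    case True
    then have "coef a K m = of_real (?A K)" using c by blast
    then have "Re (coef a K m * (of_real (word_mean K m) * cnj (of_real (word_mean K m)))) = ?A K * word_mean K m * word_mean K m"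
      by (simp add: mult.assoc flip: of_real_mult of_real_prod of_real_power)
    also have "\<dots> \<le> ?A K * word_mean K m * ?W"
      by (intro mult_left_mono word_mean_le mult_nonneg_nonneg prod_nonneg word_mean_nonneg) auto
    finally show ?thesis by (simp add: ac_simps)
  next
    case False
    then have "word_mean K m = 0" unfolding word_mean_def by (intro sum.neutral) auto
    then show ?thesis by simp
  qed
  then have "Re (\<Sum>K\<in>?P. coef a K m * (of_real (word_mean K m) * cnj (of_real (word_mean K m)))) \<le>
      (\<Sum>K\<in>?P. ?W * (?A K * word_mean K m))"
    unfolding Re_sum by (intro sum_mono)
  also have "\<dots> = ?W * (\<Sum>\<pi> | \<pi> permutes {..<m}. weight m \<pi> *
      (\<Sum>K\<in>?P. of_bool (\<forall>i<m. snd (K i) = fst (K (\<pi> i))) * ?A K))"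
    unfolding word_mean_def sum_distrib_left by (subst sum.swap) (simp only: ac_simps)
  also have "\<dots> \<le> ?W * (\<Sum>\<pi> | \<pi> permutes {..<m}. weight m \<pi> * (\<Sum>j=1..n. (cmod (a j))\<^sup>2) ^ m)"
    by (intro mult_left_mono sum_mono total_weight_nonneg weight_nonneg sum_matched_le) auto
  also have "\<dots> = (\<Sum>j=1..n. (cmod (a j))\<^sup>2) ^ m * ?W\<^sup>2"
    unfolding total_weight_def by (simp add: power2_eq_square ac_simps flip: sum_distrib_right)
  finally show ?thesis .
qed

end

section \<open>Kernels of the two operators and the expansion of the Schatten trace into
  words\<close>

lemma has_kernel_tensor_bar:
  assumes "x \<in> carrier_mat N N" "z \<in> carrier_mat N N"
  shows "has_kernel N (tensor_bar x z) (\<lambda>(i, l) (p, q). x $$ (i, p) * cnj (z $$ (l, q)))"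
  unfolding has_kernel_def
proof (intro ballI conjI allI impI)
  fix \<xi> :: "complex mat" assume \<xi>: "\<xi> \<in> carrier_mat N N"
  show "tensor_bar x z \<xi> \<in> carrier_mat N N" using assms \<xi> by (auto simp: tensor_bar_def)
  fix i l assume il: "i < N" "l < N"
  have "tensor_bar x z \<xi> $$ (i, l) = (\<Sum>q<N. \<Sum>p<N. x $$ (i, p) * \<xi> $$ (p, q) * cnj (z $$ (l, q)))"
    unfolding tensor_bar_def using assms \<xi> il
    by (subst index_mult_mat_sum) (auto simp: index_mult_mat_sum sum_distrib_right simp del: index_mult_mat(1) intro!: sum.cong)
  also have "\<dots> = (\<Sum>p<N. \<Sum>q<N. x $$ (i, p) * \<xi> $$ (p, q) * cnj (z $$ (l, q)))" by (rule sum.swap)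
  finally show "tensor_bar x z \<xi> $$ (i, l) =
      (\<Sum>p<N. \<Sum>q<N. (case (i, l) of (i, l) \<Rightarrow> \<lambda>(p, q). x $$ (i, p) * cnj (z $$ (l, q))) (p, q) * \<xi> $$ (p, q))"
    by (simp add: ac_simps)
qed

lemma has_kernel_lin_comb_op:
  assumes "\<And>j. j \<in> J \<Longrightarrow> has_kernel N (T j) (t j)"
  shows "has_kernel N (lin_comb_op N J a T) (\<lambda>x y. \<Sum>j\<in>J. a j * t j x y)"
  unfolding has_kernel_def
proof (intro ballI conjI allI impI)
  fix \<xi> :: "complex mat" assume \<xi>: "\<xi> \<in> carrier_mat N N"
  show "lin_comb_op N J a T \<xi> \<in> carrier_mat N N" by (simp add: lin_comb_op_def)
  fix i l assume il: "i < N" "l < N"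
  have "lin_comb_op N J a T \<xi> $$ (i, l) = (\<Sum>j\<in>J. \<Sum>p<N. \<Sum>q<N. a j * t j (i, l) (p, q) * \<xi> $$ (p, q))"
    using il by (simp add: lin_comb_op_def has_kernelD(2)[OF assms \<xi>] sum_distrib_left mult.assoc)
  also have "\<dots> = (\<Sum>p<N. \<Sum>j\<in>J. \<Sum>q<N. a j * t j (i, l) (p, q) * \<xi> $$ (p, q))"
    by (rule sum.swap)
  also have "\<dots> = (\<Sum>p<N. \<Sum>q<N. \<Sum>j\<in>J. a j * t j (i, l) (p, q) * \<xi> $$ (p, q))"
    by (intro sum.cong refl sum.swap)
  finally show "lin_comb_op N J a T \<xi> $$ (i, l) = (\<Sum>p<N. \<Sum>q<N. (\<Sum>j\<in>J. a j * t j (i, l) (p, q)) * \<xi> $$ (p, q))"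
    by (simp add: sum_distrib_right)
qed

lemma sum_sum_swap:
  fixes f :: "'a \<Rightarrow> 'b \<Rightarrow> 'c \<Rightarrow> 'd \<Rightarrow> 'e :: comm_monoid_add"
  shows "(\<Sum>a\<in>A. \<Sum>b\<in>B. \<Sum>c\<in>C. \<Sum>d\<in>D. f a b c d) = (\<Sum>c\<in>C. \<Sum>d\<in>D. \<Sum>a\<in>A. \<Sum>b\<in>B. f a b c d)"
  using sum.swap[of "\<lambda>x y. f (fst x) (snd x) (fst y) (snd y)" "C \<times> D" "A \<times> B"]
  by (simp only: sum.cartesian_product' fst_conv snd_conv)

lemma has_kernel_comp:
  assumes S: "has_kernel N S s" and T: "has_kernel N T t"
  shows "has_kernel N (S \<circ> T) (\<lambda>x y. \<Sum>u<N. \<Sum>v<N. s x (u, v) * t (u, v) y)"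
  unfolding has_kernel_def
proof (intro ballI conjI allI impI)
  fix \<xi> :: "complex mat" assume \<xi>: "\<xi> \<in> carrier_mat N N"
  note T\<xi> = has_kernelD(1)[OF T \<xi>]
  show "(S \<circ> T) \<xi> \<in> carrier_mat N N" using has_kernelD(1)[OF S T\<xi>] by simp
  fix i l assume il: "i < N" "l < N"
  have "(S \<circ> T) \<xi> $$ (i, l) = (\<Sum>u<N. \<Sum>v<N. \<Sum>p<N. \<Sum>q<N. s (i, l) (u, v) * t (u, v) (p, q) * \<xi> $$ (p, q))"
    using il by (simp add: has_kernelD(2)[OF S T\<xi>] has_kernelD(2)[OF T \<xi>] sum_distrib_left mult.assoc)
  also have "\<dots> = (\<Sum>p<N. \<Sum>q<N. \<Sum>u<N. \<Sum>v<N. s (i, l) (u, v) * t (u, v) (p, q) * \<xi> $$ (p, q))"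
    by (rule sum_sum_swap)
  finally show "(S \<circ> T) \<xi> $$ (i, l) = (\<Sum>p<N. \<Sum>q<N. (\<Sum>u<N. \<Sum>v<N. s (i, l) (u, v) * t (u, v) (p, q)) * \<xi> $$ (p, q))"
    by (simp add: sum_distrib_right)
qed

text \<open>The identity kernel minus a rank-one kernel; \<open>N\<close> is the squared
  Hilbert-Schmidt norm of the identity matrix.\<close>

definition one_minus_P_kernel :: "nat \<Rightarrow> nat \<times> nat \<Rightarrow> nat \<times> nat \<Rightarrow> complex" where
  "one_minus_P_kernel N = (\<lambda>x y. of_bool (x = y) - of_bool (fst x = snd x) * of_bool (fst y = snd y) / of_nat N)"

lemma has_kernel_one_minus_P: "has_kernel N (one_minus_P N) (one_minus_P_kernel N)"
  unfolding has_kernel_def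
proof (intro ballI conjI allI impI)
  fix \<xi> :: "complex mat" assume \<xi>: "\<xi> \<in> carrier_mat N N"
  have one: "(1\<^sub>m N :: complex mat) \<in> carrier_mat N N" by simp
  show "one_minus_P N \<xi> \<in> carrier_mat N N"
    using \<xi> by (auto simp: one_minus_P_def P_op_def line_proj_def)
  fix i l assume il: "i < N" "l < N"
  let ?d = "\<lambda>p q. of_bool (p = q) :: complex"
  have delta: "(\<Sum>q<N. f q * ?d p q) = f p" if "p < N" for f p
  proof -
    have "(\<Sum>q<N. f q * ?d p q) = (\<Sum>q<N. if q = p then f q else 0)" by (intro sum.cong) auto
    then show ?thesis using that by simp
  qed
  have tr: "hs_inner \<xi> (1\<^sub>m N) = (\<Sum>p<N. \<Sum>q<N. \<xi> $$ (p, q) * ?d p q)"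
    unfolding hs_inner_eq[OF \<xi> one] by (intro sum.cong refl) auto
  have "hs_inner (1\<^sub>m N) (1\<^sub>m N) = (\<Sum>p<N. \<Sum>q<N. ?d p q * ?d p q)"
    unfolding hs_inner_eq[OF one one] by (intro sum.cong refl) auto
  also have "\<dots> = (\<Sum>p<N. 1)"
    by (intro sum.cong refl) (use delta in \<open>auto simp del: sum_of_bool_eq sum_mult_of_bool_eq\<close>)
  also have "\<dots> = of_nat N" by simp
  finally have nn: "hs_inner (1\<^sub>m N) (1\<^sub>m N) = of_nat N" .
  have "one_minus_P N \<xi> $$ (i, l) = \<xi> $$ (i, l) - hs_inner \<xi> (1\<^sub>m N) / of_nat N * ?d i l"
    using il \<xi> nn by (simp add: one_minus_P_def P_op_def line_proj_def)
  moreover have "\<xi> $$ (i, l) = (\<Sum>p<N. \<Sum>q<N. \<xi> $$ (p, q) * (if p = i then if q = l then 1 else 0 else 0))"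
    using sum_sum_delta[OF il, of "\<lambda>p q. \<xi> $$ (p, q)"] by simp
  moreover have "hs_inner \<xi> (1\<^sub>m N) / of_nat N * ?d i l = (\<Sum>p<N. \<Sum>q<N. \<xi> $$ (p, q) * (?d i l * ?d p q / of_nat N))"
    unfolding tr sum_divide_distrib sum_distrib_right by (simp add: ac_simps)
  ultimately have "one_minus_P N \<xi> $$ (i, l) = (\<Sum>p<N. \<Sum>q<N. \<xi> $$ (p, q) * (if p = i then if q = l then 1 else 0 else 0) -
      \<xi> $$ (p, q) * (?d i l * ?d p q / of_nat N))"
    by (simp only: sum_subtractf)
  also have "\<dots> = (\<Sum>p<N. \<Sum>q<N. one_minus_P_kernel N (i, l) (p, q) * \<xi> $$ (p, q))"
    by (intro sum.cong refl) (auto simp: one_minus_P_kernel_def algebra_simps)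
  finally show "one_minus_P N \<xi> $$ (i, l) = (\<Sum>p<N. \<Sum>q<N. one_minus_P_kernel N (i, l) (p, q) * \<xi> $$ (p, q))" .
qed

definition S_hat_kernel :: "nat \<Rightarrow> nat \<Rightarrow> (nat \<Rightarrow> complex) \<Rightarrow> (nat \<Rightarrow> complex mat) \<Rightarrow> nat \<times> nat \<Rightarrow> nat \<times> nat \<Rightarrow> complex" where
  "S_hat_kernel N n a V = (\<lambda>x y. \<Sum>j\<in>{1..n}. a j * (\<Sum>u<N. \<Sum>v<N.
     (V j $$ (fst x, u) * cnj (V j $$ (snd x, v))) * one_minus_P_kernel N (u, v) y))"

lemma has_kernel_S_hat:
  assumes "\<And>j. j \<in> {1..n} \<Longrightarrow> U j \<omega> \<in> carrier_mat N N"
  shows "has_kernel N (S_hat N n a U \<omega>) (S_hat_kernel N n a (\<lambda>j. U j \<omega>))"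
proof -
  have "has_kernel N (S_hat N n a U \<omega>) (\<lambda>x y. \<Sum>j\<in>{1..n}. a j * (\<Sum>u<N. \<Sum>v<N.
     (\<lambda>(i, l) (p, q). U j \<omega> $$ (i, p) * cnj (U j \<omega> $$ (l, q))) x (u, v) * one_minus_P_kernel N (u, v) y))"
    unfolding S_hat_def
    by (intro has_kernel_lin_comb_op has_kernel_comp has_kernel_tensor_bar has_kernel_one_minus_P assms)
  then show ?thesis by (simp add: S_hat_kernel_def split_def)
qed

lemma has_kernel_gaussian_sum:
  assumes "\<And>j. j \<in> {1..n} \<Longrightarrow> Y j \<omega> \<in> carrier_mat N N" "\<And>j. j \<in> {1..n} \<Longrightarrow> Y' j \<omega> \<in> carrier_mat N N"
  shows "has_kernel N (gaussian_sum N n a Y Y' \<omega>)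
    (\<lambda>x y. \<Sum>j\<in>{1..n}. a j * (Y j \<omega> $$ (fst x, fst y) * cnj (Y' j \<omega> $$ (snd x, snd y))))"
proof -
  have "has_kernel N (gaussian_sum N n a Y Y' \<omega>)
    (\<lambda>x y. \<Sum>j\<in>{1..n}. a j * (\<lambda>(i, l) (p, q). Y j \<omega> $$ (i, p) * cnj (Y' j \<omega> $$ (l, q))) x y)"
    unfolding gaussian_sum_def by (intro has_kernel_lin_comb_op has_kernel_tensor_bar assms)
  then show ?thesis by (simp add: split_def)
qed

lemma sum_PiE_lessThan_Suc:
  fixes f :: "(nat \<Rightarrow> 'b) \<Rightarrow> 'c :: comm_monoid_add"
  assumes "finite S"
  shows "(\<Sum>K\<in>PiE {..<Suc m} (\<lambda>_. S). f K) = (\<Sum>K\<in>PiE {..<m} (\<lambda>_. S). \<Sum>b\<in>S. f (K(m := b)))"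
proof -
  have inj: "inj_on (\<lambda>(b, g). g(m := b)) (S \<times> PiE {..<m} (\<lambda>_. S))"
    by (rule inj_combinator) simp
  have "(\<Sum>K\<in>PiE {..<Suc m} (\<lambda>_. S). f K) = (\<Sum>(b, g)\<in>S \<times> PiE {..<m} (\<lambda>_. S). f (g(m := b)))"
    unfolding lessThan_Suc PiE_insert_eq by (subst sum.reindex[OF inj]) (auto intro!: sum.cong)
  also have "\<dots> = (\<Sum>b\<in>S. \<Sum>g\<in>PiE {..<m} (\<lambda>_. S). f (g(m := b)))"
    by (rule sum.cartesian_product[symmetric])
  finally show ?thesis by (subst sum.swap)
qed

text \<open>The Gram operator of a sum of elementary tensors is again such a sum, indexed by pairs
  of labels.\<close>

lemma letter_product:
  fixes Z Z' :: mat_family and a :: "nat \<Rightarrow> complex" and n :: nat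
  defines "t \<equiv> \<lambda>x y. \<Sum>j\<in>{1..n}. a j * (Z j (fst x) (fst y) * cnj (Z' j (snd x) (snd y)))"
  shows "(\<Sum>i<N. \<Sum>l<N. cnj (t (i, l) y) * t (i, l) y') =
    (\<Sum>b\<in>{1..n} \<times> {1..n}. cnj (a (fst b)) * a (snd b) * (letter N Z b (fst y) (fst y') * cnj (letter N Z' b (snd y) (snd y'))))"
proof -
  let ?g = "\<lambda>i l j k. cnj (a j) * a k * ((cnj (Z j i (fst y)) * Z k i (fst y')) * cnj (cnj (Z' j l (snd y)) * Z' k l (snd y')))"
  have "(\<Sum>i<N. \<Sum>l<N. cnj (t (i, l) y) * t (i, l) y') = (\<Sum>i<N. \<Sum>l<N. \<Sum>j\<in>{1..n}. \<Sum>k\<in>{1..n}. ?g i l j k)"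
    unfolding t_def cnj_sum sum_product by (simp add: ac_simps)
  also have "\<dots> = (\<Sum>j\<in>{1..n}. \<Sum>k\<in>{1..n}. \<Sum>i<N. \<Sum>l<N. ?g i l j k)" by (rule sum_sum_swap)
  also have "\<dots> = (\<Sum>b\<in>{1..n} \<times> {1..n}. \<Sum>i<N. \<Sum>l<N. ?g i l (fst b) (snd b))"
    by (simp only: sum.cartesian_product' fst_conv snd_conv)
  also have "\<dots> = (\<Sum>b\<in>{1..n} \<times> {1..n}. cnj (a (fst b)) * a (snd b) * (letter N Z b (fst y) (fst y') * cnj (letter N Z' b (snd y) (snd y'))))"
    unfolding letter_def cnj_sum unfolding sum_product unfolding sum_distrib_left ..
  finally show ?thesis .
qed

lemma coef_Suc: "coef a (K(m := b)) (Suc m) = coef a K m * (cnj (a (fst b)) * a (snd b))"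
  by (simp add: coef_def)

lemma word_upd_Suc: "word N Z (K(m := b)) (Suc m) = mat_mul N (word N Z K m) (letter N Z b)"
  using word_cong[of m "K(m := b)" K N Z] by simp

text \<open>Powers of the Gram operator stay sums of elementary tensors, one for each word, and the
  trace of an elementary tensor is a product of two traces. The two families thus end up in separate
  factors, ready for independence.\<close>

lemma schatten_trace_eq_words:
  assumes T: "has_kernel N T (\<lambda>x y. \<Sum>j\<in>{1..n}. a j * (Z j (fst x) (fst y) * cnj (Z' j (snd x) (snd y))))"
  shows "schatten_trace N m T =
    Re (\<Sum>K\<in>PiE {..<m} (\<lambda>_. {1..n} \<times> {1..n}). coef a K m * (word_trace N Z K m * cnj (word_trace N Z' K m)))"
proof -
  let ?t = "\<lambda>x y. \<Sum>j\<in>{1..n}. a j * (Z j (fst x) (fst y) * cnj (Z' j (snd x) (snd y)))"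
  let ?S = "{1..n} \<times> {1..n}"
  let ?P = "\<lambda>m. PiE {..<m} (\<lambda>_. ?S)"
  define A where "A = op_mat N T"
  define G where "G = mat_adjoint A * A"
  have A: "A \<in> carrier_mat (N\<^sup>2) (N\<^sup>2)" by (simp add: A_def)
  have G: "G \<in> carrier_mat (N\<^sup>2) (N\<^sup>2)" unfolding G_def using A by auto
  let ?w = "\<lambda>K m p q. word N Z K m (p div N) (q div N) * cnj (word N Z' K m (p mod N) (q mod N))"
  have Gpq: "G $$ (p, q) = (\<Sum>b\<in>?S. cnj (a (fst b)) * a (snd b) *
      (letter N Z b (p div N) (q div N) * cnj (letter N Z' b (p mod N) (q mod N))))"
    if pq: "p < N\<^sup>2" "q < N\<^sup>2" for p q
  proof -
    have "G $$ (p, q) = (\<Sum>r<N\<^sup>2. mat_adjoint A $$ (p, r) * A $$ (r, q))"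
      unfolding G_def using A pq by (subst index_mult_mat_sum) auto
    also have "\<dots> = (\<Sum>r<N\<^sup>2. cnj (?t (r div N, r mod N) (p div N, p mod N)) * ?t (r div N, r mod N) (q div N, q mod N))"
    proof (intro sum.cong refl)
      fix r assume "r \<in> {..<N\<^sup>2}"
      then have r: "r < N\<^sup>2" by simp
      have "mat_adjoint A $$ (p, r) = cnj (A $$ (r, p))" using A pq r by (intro index_mat_adjoint) auto
      moreover have "A $$ (r, p) = ?t (r div N, r mod N) (p div N, p mod N)"
        unfolding A_def by (rule op_mat_index[OF T r pq(1)])
      moreover have "A $$ (r, q) = ?t (r div N, r mod N) (q div N, q mod N)"
        unfolding A_def by (rule op_mat_index[OF T r pq(2)])
      ultimately show "mat_adjoint A $$ (p, r) * A $$ (r, q) =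
          cnj (?t (r div N, r mod N) (p div N, p mod N)) * ?t (r div N, r mod N) (q div N, q mod N)"
        by (simp only:)
    qed
    also have "\<dots> = (\<Sum>i<N. \<Sum>l<N. cnj (?t (i, l) (p div N, p mod N)) * ?t (i, l) (q div N, q mod N))"
      by (rule sum_div_mod)
    finally show ?thesis unfolding letter_product by simp
  qed
  have pow: "(G ^\<^sub>m m) $$ (p, q) = (\<Sum>K\<in>?P m. coef a K m * ?w K m p q)" if "p < N\<^sup>2" "q < N\<^sup>2" for m p q
    using that
  proof (induction m arbitrary: q)
    case 0
    have "p = q \<longleftrightarrow> p div N = q div N \<and> p mod N = q mod N"
      by (metis div_mult_mod_eq)
    then show ?case using 0 G by (auto simp: coef_def)
  next
    case (Suc m)
    have "(G ^\<^sub>m Suc m) $$ (p, q) = (\<Sum>d<N\<^sup>2. (G ^\<^sub>m m) $$ (p, d) * G $$ (d, q))"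
      using Suc.prems G pow_carrier_mat[OF G, of m] by (simp only: pow_mat.simps, subst index_mult_mat_sum) auto
    also have "\<dots> = (\<Sum>d<N\<^sup>2. \<Sum>K\<in>?P m. \<Sum>b\<in>?S. coef a K m * ?w K m p d * (cnj (a (fst b)) * a (snd b) *
      (letter N Z b (d div N) (q div N) * cnj (letter N Z' b (d mod N) (q mod N)))))"
      using Suc.prems by (simp add: Suc.IH Gpq sum_product)
    also have "\<dots> = (\<Sum>K\<in>?P m. \<Sum>b\<in>?S. \<Sum>d<N\<^sup>2. coef a K m * ?w K m p d * (cnj (a (fst b)) * a (snd b) *
      (letter N Z b (d div N) (q div N) * cnj (letter N Z' b (d mod N) (q mod N)))))"
      by (subst sum.swap, rule sum.cong[OF refl], rule sum.swap)
    also have "\<dots> = (\<Sum>K\<in>?P m. \<Sum>b\<in>?S. coef a (K(m := b)) (Suc m) * ?w (K(m := b)) (Suc m) p q)"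
    proof (intro sum.cong refl)
      fix K b
      let ?h = "\<lambda>i l. (word N Z K m (p div N) i * letter N Z b i (q div N)) * cnj (word N Z' K m (p mod N) l * letter N Z' b l (q mod N))"
      have "(\<Sum>d<N\<^sup>2. coef a K m * ?w K m p d * (cnj (a (fst b)) * a (snd b) *
          (letter N Z b (d div N) (q div N) * cnj (letter N Z' b (d mod N) (q mod N))))) =
        coef a (K(m := b)) (Suc m) * (\<Sum>d<N\<^sup>2. ?h (d div N) (d mod N))"
        unfolding coef_Suc sum_distrib_left by (intro sum.cong refl) (simp add: ac_simps)
      also have "(\<Sum>d<N\<^sup>2. ?h (d div N) (d mod N)) = (\<Sum>i<N. \<Sum>l<N. ?h i l)" by (rule sum_div_mod)
      also have "\<dots> = ?w (K(m := b)) (Suc m) p q"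
        unfolding word_upd_Suc mat_mul_def cnj_sum sum_product ..
      finally show "(\<Sum>d<N\<^sup>2. coef a K m * ?w K m p d * (cnj (a (fst b)) * a (snd b) *
          (letter N Z b (d div N) (q div N) * cnj (letter N Z' b (d mod N) (q mod N))))) =
        coef a (K(m := b)) (Suc m) * ?w (K(m := b)) (Suc m) p q" .
    qed
    also have "\<dots> = (\<Sum>K\<in>?P (Suc m). coef a K (Suc m) * ?w K (Suc m) p q)"
      by (rule sum_PiE_lessThan_Suc[symmetric]) simp
    finally show ?case .
  qed
  have "mat_trace (G ^\<^sub>m m) = (\<Sum>p<N\<^sup>2. \<Sum>K\<in>?P m. coef a K m * ?w K m p p)"
    using mat_trace_eq[OF pow_carrier_mat[OF G, of m]] by (simp add: pow)
  also have "\<dots> = (\<Sum>K\<in>?P m. coef a K m * (\<Sum>p<N\<^sup>2. ?w K m p p))"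
    by (subst sum.swap) (simp only: sum_distrib_left)
  also have "\<dots> = (\<Sum>K\<in>?P m. coef a K m * (word_trace N Z K m * cnj (word_trace N Z' K m)))"
  proof (intro sum.cong refl)
    fix K
    have "(\<Sum>p<N\<^sup>2. ?w K m p p) = (\<Sum>i<N. \<Sum>l<N. word N Z K m i i * cnj (word N Z' K m l l))"
      by (rule sum_div_mod)
    then show "coef a K m * (\<Sum>p<N\<^sup>2. ?w K m p p) = coef a K m * (word_trace N Z K m * cnj (word_trace N Z' K m))"
      unfolding word_trace_def cnj_sum sum_product by simp
  qed
  finally show ?thesis unfolding schatten_trace_def G_def A_def by simp
qed

section \<open>Random matrices\<close>

lemma space_mat_borel [simp]: "space (mat_borel N) = carrier_mat N N"
  unfolding mat_borel_def by (rule space_measure_of) auto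

lemma measurable_mat_entry:
  assumes "i < N" "l < N"
  shows "(\<lambda>A. A $$ (i, l)) \<in> borel_measurable (mat_borel N)"
proof (rule measurableI)
  fix B :: "complex set" assume "B \<in> sets borel"
  then have "{A \<in> carrier_mat N N. A $$ (i, l) \<in> B} \<in>
      {{A \<in> carrier_mat N N. A $$ (i, l) \<in> B} |i l B. i < N \<and> l < N \<and> B \<in> sets borel}"
    using assms by blast
  then have "{A \<in> carrier_mat N N. A $$ (i, l) \<in> B} \<in> sets (mat_borel N)"
    unfolding mat_borel_def by (subst sets_measure_of) auto
  moreover have "(\<lambda>A. A $$ (i, l)) -` B \<inter> space (mat_borel N) = {A \<in> carrier_mat N N. A $$ (i, l) \<in> B}"
    by auto
  ultimately show "(\<lambda>A. A $$ (i, l)) -` B \<inter> space (mat_borel N) \<in> sets (mat_borel N)" by simp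
qed auto

section \<open>Integrability on the unitary side\<close>

text \<open>Unitarity of a Haar matrix holds almost everywhere only, so its entries are merely
  essentially bounded. This class is closed under all operations that build a Schatten
  trace.\<close>

definition ess_bounded :: "'a measure \<Rightarrow> ('a \<Rightarrow> complex) \<Rightarrow> bool" where
  "ess_bounded M f \<longleftrightarrow> f \<in> borel_measurable M \<and> (\<exists>K. AE x in M. cmod (f x) \<le> K)"

lemma ess_bounded_const: "ess_bounded M (\<lambda>_. c)"
  unfolding ess_bounded_def by (auto intro: exI[of _ "cmod c"])

lemma borel_measurable_cnj: "f \<in> borel_measurable M \<Longrightarrow> (\<lambda>x. cnj (f x)) \<in> borel_measurable M"
  by (rule measurable_compose[OF _ borel_measurable_continuous_onI[OF continuous_on_cnj[OF continuous_on_id]]])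

lemma ess_bounded_cnj: "ess_bounded M f \<Longrightarrow> ess_bounded M (\<lambda>x. cnj (f x))"
  unfolding ess_bounded_def by (auto intro: borel_measurable_cnj)

lemma ess_bounded_add:
  assumes "ess_bounded M f" "ess_bounded M g"
  shows "ess_bounded M (\<lambda>x. f x + g x)"
proof -
  obtain K L where "AE x in M. cmod (f x) \<le> K" "AE x in M. cmod (g x) \<le> L"
    using assms unfolding ess_bounded_def by auto
  then have "AE x in M. cmod (f x + g x) \<le> K + L"
    by eventually_elim (metis add_mono norm_triangle_ineq order_trans)
  then show ?thesis using assms unfolding ess_bounded_def by auto
qed

lemma ess_bounded_mult:
  assumes "ess_bounded M f" "ess_bounded M g"
  shows "ess_bounded M (\<lambda>x. f x * g x)"
proof -
  obtain K L where "AE x in M. cmod (f x) \<le> K" "AE x in M. cmod (g x) \<le> L"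
    using assms unfolding ess_bounded_def by auto
  then have "AE x in M. cmod (f x * g x) \<le> \<bar>K\<bar> * \<bar>L\<bar>"
    by eventually_elim (auto simp: norm_mult intro!: mult_mono)
  then show ?thesis using assms unfolding ess_bounded_def by auto
qed

lemma ess_bounded_sum:
  assumes "finite S" "\<And>i. i \<in> S \<Longrightarrow> ess_bounded M (f i)"
  shows "ess_bounded M (\<lambda>x. \<Sum>i\<in>S. f i x)"
  using assms by (induction S rule: finite_induct) (auto intro: ess_bounded_const ess_bounded_add)

lemma ess_bounded_cong:
  assumes "ess_bounded M f" "\<And>x. x \<in> space M \<Longrightarrow> f x = g x"
  shows "ess_bounded M g"
proof -
  have "AE x in M. cmod (g x) \<le> K" if "AE x in M. cmod (f x) \<le> K" for K
    using that AE_space by eventually_elim (simp add: assms(2))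
  then show ?thesis using assms measurable_cong[of M f g borel] unfolding ess_bounded_def by auto
qed

lemma unitary_entry_le_1:
  assumes "V \<in> unitary_group N" "i < N" "l < N"
  shows "cmod (V $$ (i, l)) \<le> 1"
proof -
  note V = unitary_groupD[OF assms(1)]
  have "complex_of_real (\<Sum>k<N. (cmod (V $$ (i, k)))\<^sup>2) = (\<Sum>k<N. V $$ (i, k) * cnj (V $$ (i, k)))"
    unfolding of_real_sum by (intro sum.cong refl) (simp add: complex_norm_square del: of_real_power)
  also have "\<dots> = (V * mat_adjoint V) $$ (i, i)"
    using V(1) assms by (subst index_mult_mat_sum) auto
  also have "\<dots> = 1" using V(3) assms by simp
  finally have "(\<Sum>k<N. (cmod (V $$ (i, k)))\<^sup>2) = 1" using of_real_eq_1_iff by blast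
  moreover have "(cmod (V $$ (i, l)))\<^sup>2 \<le> (\<Sum>k<N. (cmod (V $$ (i, k)))\<^sup>2)"
    using assms by (intro member_le_sum) auto
  ultimately show ?thesis by (simp add: power_le_one_iff)
qed

lemma (in prob_space) haar_entry_ess_bounded:
  assumes U: "iid_haar_unitary M N U" and j: "j \<ge> 1" and il: "i < N" "l < N"
  shows "U j \<in> measurable M (mat_borel N)" "ess_bounded M (\<lambda>\<omega>. U j \<omega> $$ (i, l))"
proof -
  show meas: "U j \<in> measurable M (mat_borel N)"
    using U j unfolding iid_haar_unitary_def iid_seq_def indep_vars_def by auto
  have "AE A in distr M (mat_borel N) (U j). A \<in> unitary_group N"
    using U j unfolding iid_haar_unitary_def haar_measure_unitary_def by auto
  then have "AE \<omega> in M. U j \<omega> \<in> unitary_group N" by (rule AE_distrD[OF meas])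
  then have "AE \<omega> in M. cmod (U j \<omega> $$ (i, l)) \<le> 1"
    by eventually_elim (rule unitary_entry_le_1[OF _ il])
  then show "ess_bounded M (\<lambda>\<omega>. U j \<omega> $$ (i, l))"
    using measurable_compose[OF meas measurable_mat_entry[OF il]] unfolding ess_bounded_def by auto
qed

text \<open>Markov's inequality and the comparison of expectations are applied to this trace, so its
  integrability must be known.\<close>

lemma integrable_schatten_trace:
  assumes M: "prob_space M" and T: "\<And>\<omega>. \<omega> \<in> space M \<Longrightarrow> has_kernel N (T \<omega>) (t \<omega>)"
    and t: "\<And>i l p q. i < N \<Longrightarrow> l < N \<Longrightarrow> p < N \<Longrightarrow> q < N \<Longrightarrow> ess_bounded M (\<lambda>\<omega>. t \<omega> (i, l) (p, q))"
  shows "integrable M (\<lambda>\<omega>. schatten_trace N m (T \<omega>))"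
proof -
  interpret prob_space M by fact
  define A where "A \<omega> = op_mat N (T \<omega>)" for \<omega>
  define G where "G \<omega> = mat_adjoint (A \<omega>) * A \<omega>" for \<omega>
  have A: "A \<omega> \<in> carrier_mat (N\<^sup>2) (N\<^sup>2)" for \<omega> by (simp add: A_def)
  have G: "G \<omega> \<in> carrier_mat (N\<^sup>2) (N\<^sup>2)" for \<omega>
    unfolding G_def using A[of \<omega>] by auto
  have bA: "ess_bounded M (\<lambda>\<omega>. A \<omega> $$ (r, c))" if "r < N\<^sup>2" "c < N\<^sup>2" for r c
    by (rule ess_bounded_cong[OF t[of "r div N" "r mod N" "c div N" "c mod N"]])
      (use that div_mod_less_square in \<open>auto simp: A_def op_mat_index[OF T]\<close>)
  have bG: "ess_bounded M (\<lambda>\<omega>. G \<omega> $$ (p, q))" if pq: "p < N\<^sup>2" "q < N\<^sup>2" for p q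
  proof -
    have "G \<omega> $$ (p, q) = (\<Sum>r<N\<^sup>2. cnj (A \<omega> $$ (r, p)) * A \<omega> $$ (r, q))" for \<omega>
      unfolding G_def using A[of \<omega>] pq by (subst index_mult_mat_sum) auto
    then show ?thesis using pq by (auto intro!: ess_bounded_sum ess_bounded_mult ess_bounded_cnj bA)
  qed
  have bP: "ess_bounded M (\<lambda>\<omega>. (G \<omega> ^\<^sub>m m) $$ (p, q))" if "p < N\<^sup>2" "q < N\<^sup>2" for m p q
    using that
  proof (induction m arbitrary: q)
    case 0
    have "(G \<omega> ^\<^sub>m 0) $$ (p, q) = of_bool (p = q)" for \<omega>
      using 0 G[of \<omega>] by auto
    then show ?case by (simp add: ess_bounded_const del: pow_mat.simps)
  next
    case (Suc m)
    have "(G \<omega> ^\<^sub>m Suc m) $$ (p, q) = (\<Sum>d<N\<^sup>2. (G \<omega> ^\<^sub>m m) $$ (p, d) * G \<omega> $$ (d, q))" for \<omega>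
      using Suc.prems G[of \<omega>] pow_carrier_mat[OF G[of \<omega>], of m]
      by (simp only: pow_mat.simps, subst index_mult_mat_sum) auto
    then show ?case using Suc by (auto intro!: ess_bounded_sum ess_bounded_mult bG)
  qed
  have "mat_trace (G \<omega> ^\<^sub>m m) = (\<Sum>p<N\<^sup>2. (G \<omega> ^\<^sub>m m) $$ (p, p))" for \<omega>
    by (rule mat_trace_eq[OF pow_carrier_mat[OF G]])
  then have "ess_bounded M (\<lambda>\<omega>. mat_trace (G \<omega> ^\<^sub>m m))"
    by (auto intro!: ess_bounded_sum bP)
  then have meas: "(\<lambda>\<omega>. mat_trace (G \<omega> ^\<^sub>m m)) \<in> borel_measurable M"
    and "\<exists>K. AE \<omega> in M. cmod (mat_trace (G \<omega> ^\<^sub>m m)) \<le> K"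
    unfolding ess_bounded_def by auto
  then obtain K where "AE \<omega> in M. cmod (mat_trace (G \<omega> ^\<^sub>m m)) \<le> K" by auto
  then have "integrable M (\<lambda>\<omega>. mat_trace (G \<omega> ^\<^sub>m m))"
    by (intro integrable_const_bound[OF _ meas])
  then show ?thesis unfolding schatten_trace_def G_def A_def by (intro integrable_Re)
qed

lemma (in prob_space) S_hat_kernel_haar:
  assumes U: "iid_haar_unitary M N U" and N: "N \<ge> 1"
  shows "\<omega> \<in> space M \<Longrightarrow> has_kernel N (S_hat N n a U \<omega>) (S_hat_kernel N n a (\<lambda>j. U j \<omega>))"
    and "integrable M (\<lambda>\<omega>. schatten_trace N m (S_hat N n a U \<omega>))"
proof -
  have c: "U j \<omega> \<in> carrier_mat N N" if "\<omega> \<in> space M" "j \<in> {1..n}" for j \<omega>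
    using haar_entry_ess_bounded(1)[OF U, of j 0 0] measurable_space[of "U j" M "mat_borel N" \<omega>] that N by auto
  show "has_kernel N (S_hat N n a U \<omega>) (S_hat_kernel N n a (\<lambda>j. U j \<omega>))" if "\<omega> \<in> space M" for \<omega>
    using c that by (intro has_kernel_S_hat)
  then show "integrable M (\<lambda>\<omega>. schatten_trace N m (S_hat N n a U \<omega>))"
  proof (rule integrable_schatten_trace[OF prob_space_axioms])
    fix i l p q assume "i < N" "l < N" "p < N" "q < N"
    then show "ess_bounded M (\<lambda>\<omega>. S_hat_kernel N n a (\<lambda>j. U j \<omega>) (i, l) (p, q))"
      unfolding S_hat_kernel_def
      by (intro ess_bounded_sum ess_bounded_mult ess_bounded_const ess_bounded_cnj haar_entry_ess_bounded(2)[OF U]) auto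
  qed
qed

section \<open>From the random Gaussian matrices to the moment computation\<close>

lemma gauss_moment_even: "gauss_moment (2 * k) = fact (2 * k) / (2 ^ k * fact k)"
proof (induction k)
  case (Suc k)
  have "gauss_moment (2 * Suc k) = real (2 * k + 1) * (fact (2 * k) / (2 ^ k * fact k))"
    by (simp add: Suc.IH[symmetric])
  also have "\<dots> = (real (2 * k + 2) * (real (2 * k + 1) * fact (2 * k))) / (real (2 * k + 2) * (2 ^ k * fact k))"
    by simp
  also have "real (2 * k + 2) * (real (2 * k + 1) * fact (2 * k)) = fact (2 * Suc k)"
    by simp
  also have "real (2 * k + 2) * (2 ^ k * fact k) = 2 ^ Suc k * fact (Suc k)"
    by (simp add: algebra_simps)
  finally show ?case .
qed simp

lemma gauss_moment_odd: "gauss_moment (2 * k + 1) = 0"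
  by (induction k) auto

lemma (in prob_space) std_normal_power:
  assumes g: "distributed M lborel g std_normal_density"
  shows "has_bochner_integral M (\<lambda>\<omega>. g \<omega> ^ k) (gauss_moment k)"
proof -
  have "has_bochner_integral lborel (\<lambda>x. std_normal_density x * x ^ k) (gauss_moment k)"
  proof (cases "even k")
    case True
    then obtain i where "k = 2 * i" by auto
    then show ?thesis using std_normal_moment_even[of i] by (simp only: gauss_moment_even)
  next
    case False
    then obtain i where "k = 2 * i + 1" by (rule oddE)
    then show ?thesis using std_normal_moment_odd[of i] by (simp only: gauss_moment_odd)
  qed
  then show ?thesis
    using distributed_integrable[OF g, of "\<lambda>x. x ^ k"] distributed_integral[OF g, of "\<lambda>x. x ^ k"]
    by (simp add: has_bochner_integral_iff)
qed

lemma (in prob_space) indep_vars_prod_integral: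
  fixes X :: "'i \<Rightarrow> 'a \<Rightarrow> real"
  assumes "finite I" "indep_vars (\<lambda>_. borel) X I" "\<And>i. i \<in> I \<Longrightarrow> has_bochner_integral M (X i) (c i)"
  shows "has_bochner_integral M (\<lambda>\<omega>. \<Prod>i\<in>I. X i \<omega>) (\<Prod>i\<in>I. c i)"
proof -
  have "integrable M (X i)" "integral\<^sup>L M (X i) = c i" if "i \<in> I" for i
    using assms(3)[OF that] by (auto simp: has_bochner_integral_iff)
  then show ?thesis
    using indep_vars_lebesgue_integral[OF assms(1,2)] indep_vars_integrable[OF assms(1,2)]
    by (simp add: has_bochner_integral_iff)
qed

text \<open>The standard normal variables exist separately for each matrix. Recovering them from the
  matrix by undoing the scaling makes them functions of it, so that independence of the matrices
  carries over.\<close>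

definition real_entry :: "nat \<Rightarrow> nat \<times> nat \<times> bool \<Rightarrow> complex mat \<Rightarrow> real" where
  "real_entry N = (\<lambda>(r, c, b) A. sqrt (2 * real N) * (if b then Im else Re) (A $$ (r, c)))"

lemma (in prob_space) gaussian_matrix_moments:
  assumes Y: "gaussian_matrix M N Y" and N: "N \<ge> 1"
  shows "has_bochner_integral M (\<lambda>\<omega>. \<Prod>e\<in>{..<N} \<times> {..<N} \<times> UNIV. real_entry N e (Y \<omega>) ^ k e)
    (\<Prod>e\<in>{..<N} \<times> {..<N} \<times> UNIV. gauss_moment (k e))"
proof -
  let ?E = "{..<N} \<times> {..<N} \<times> (UNIV :: bool set)"
  obtain g g' :: "nat \<Rightarrow> nat \<Rightarrow> 'a \<Rightarrow> real" where
    ind: "indep_vars (\<lambda>_. borel) (\<lambda>(i, l, b). if b then g' i l else g i l) ?E"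
    and dist: "\<forall>i<N. \<forall>l<N. distributed M lborel (g i l) std_normal_density \<and> distributed M lborel (g' i l) std_normal_density"
    and eq: "\<forall>\<omega>\<in>space M. \<forall>i<N. \<forall>l<N. Y \<omega> $$ (i, l) = complex_of_real ((2 * real N) powr (- 1 / 2)) * Complex (g i l \<omega>) (g' i l \<omega>)"
    using Y unfolding gaussian_matrix_def by auto
  let ?g = "\<lambda>(i, l, b). if b then g' i l else g i l"
  have sq: "sqrt (2 * real N) * (2 * real N) powr (- 1 / 2) = 1"
    using N by (simp add: powr_half_sqrt[symmetric] flip: powr_add)
  have e: "real_entry N e (Y \<omega>) = ?g e \<omega>" if "e \<in> ?E" "\<omega> \<in> space M" for e \<omega>
    using that eq sq by (auto simp: real_entry_def mult.assoc[symmetric])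
  have "indep_vars (\<lambda>_. borel) (\<lambda>e \<omega>. ?g e \<omega> ^ k e) ?E"
    by (rule indep_vars_compose2[OF ind, of "\<lambda>e x. x ^ k e"]) auto
  moreover have "has_bochner_integral M (\<lambda>\<omega>. ?g e \<omega> ^ k e) (gauss_moment (k e))" if "e \<in> ?E" for e
    using that dist std_normal_power by auto
  ultimately have "has_bochner_integral M (\<lambda>\<omega>. \<Prod>e\<in>?E. ?g e \<omega> ^ k e) (\<Prod>e\<in>?E. gauss_moment (k e))"
    by (intro indep_vars_prod_integral) auto
  then show ?thesis
    by (subst has_bochner_integral_cong[OF refl _ refl]) (auto simp: e intro!: prod.cong)
qed

text \<open>Joint moments factor first over the independent matrices, then over the real entries
  inside each.\<close>

lemma (in prob_space) iid_gaussian_family: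
  fixes Y :: "nat \<Rightarrow> 'a \<Rightarrow> complex mat"
  assumes Y: "iid_gaussian M N Y" and N: "N \<ge> 1" and n: "n \<ge> 1"
  shows "ginibre_family M n N (1 / sqrt (2 * real N)) (\<lambda>((j, r, c), b) \<omega>. real_entry N (r, c, b) (Y j \<omega>))"
proof -
  let ?X = "\<lambda>((j, r, c), b) \<omega>. real_entry N (r, c, b) (Y j \<omega>)"
  let ?E = "{..<N} \<times> {..<N} \<times> (UNIV :: bool set)"
  let ?R = "({1..n} \<times> {..<N} \<times> {..<N}) \<times> (UNIV :: bool set)"
  {
  fix k :: "(nat \<times> nat \<times> nat) \<times> bool \<Rightarrow> nat"
  let ?f = "\<lambda>j A. \<Prod>e\<in>?E. real_entry N e A ^ k ((j, fst e, fst (snd e)), snd (snd e))"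
  have re: "(\<Prod>r\<in>?R. F r) = (\<Prod>j=1..n. \<Prod>e\<in>?E. F ((j, fst e, fst (snd e)), snd (snd e)))" for F :: "_ \<Rightarrow> real"
    unfolding prod.cartesian_product
    by (rule prod.reindex_bij_witness[of _ "\<lambda>(j, r, c, b). ((j, r, c), b)" "\<lambda>((j, r, c), b). (j, r, c, b)"]) auto
  have "indep_vars (\<lambda>_. mat_borel N) Y {1..n}"
    using Y unfolding iid_gaussian_def iid_seq_def by (auto intro: indep_vars_subset)
  moreover have "?f j \<in> borel_measurable (mat_borel N)" for j
  proof (intro borel_measurable_prod borel_measurable_power)
    fix e assume "e \<in> ?E"
    then show "real_entry N e \<in> borel_measurable (mat_borel N)"
      using measurable_mat_entry[of "fst e" N "fst (snd e)"]
      by (auto simp: real_entry_def intro!: borel_measurable_times measurable_compose[OF _ borel_measurable_Re] measurable_compose[OF _ borel_measurable_Im])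
  qed
  ultimately have "indep_vars (\<lambda>_. borel) (\<lambda>j \<omega>. ?f j (Y j \<omega>)) {1..n}"
    by (rule indep_vars_compose2)
  then have "has_bochner_integral M (\<lambda>\<omega>. \<Prod>j=1..n. ?f j (Y j \<omega>)) (\<Prod>j=1..n. \<Prod>e\<in>?E. gauss_moment (k ((j, fst e, fst (snd e)), snd (snd e))))"
    using Y N unfolding iid_gaussian_def by (intro indep_vars_prod_integral gaussian_matrix_moments) auto
  then have "has_bochner_integral M (\<lambda>\<omega>. \<Prod>r\<in>?R. ?X r \<omega> ^ k r) (\<Prod>r\<in>?R. gauss_moment (k r))"
    unfolding re by simp
  } note moments = this
  show ?thesis
    by unfold_locales (fact moments | use N n in \<open>simp add: power_divide\<close>)+
qed

definition mat_fam :: "(nat \<Rightarrow> complex mat) \<Rightarrow> mat_family" where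
  "mat_fam A = (\<lambda>j r c. A j $$ (r, c))"

lemma letter_cong: "(\<And>x p. Z (fst jk) x p = Z' (fst jk) x p) \<Longrightarrow> (\<And>x p. Z (snd jk) x p = Z' (snd jk) x p) \<Longrightarrow>
    letter N Z jk = letter N Z' jk"
  by (simp add: letter_def)

lemma word_family_cong:
  assumes "\<And>i x p. i < m \<Longrightarrow> Z (fst (K i)) x p = Z' (fst (K i)) x p \<and> Z (snd (K i)) x p = Z' (snd (K i)) x p"
  shows "word N Z K m = word N Z' K m"
  using assms
proof (induction m)
  case (Suc m)
  have "letter N Z (K m) = letter N Z' (K m)" by (rule letter_cong) (use Suc.prems in auto)
  then show ?case using Suc by simp
qed simp

text \<open>Independence and equality in law of the two families are statements about random points
  of this product space.\<close>

lemma measurable_word_trace: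
  assumes K: "\<And>i. i < m \<Longrightarrow> K i \<in> {1..n} \<times> {1..n}"
  shows "(\<lambda>A. word_trace N (mat_fam A) K m) \<in> borel_measurable (PiM {1..} (\<lambda>_. mat_borel N))"
proof -
  let ?P = "PiM {1..} (\<lambda>_::nat. mat_borel N)"
  have e: "(\<lambda>A. A j $$ (r, c)) \<in> borel_measurable ?P" if "j \<ge> 1" "r < N" "c < N" for j r c
    using that measurable_compose[of "\<lambda>A. A j" ?P "mat_borel N" "\<lambda>A. A $$ (r, c)" borel]
      measurable_component_singleton[of j "{1..}" "\<lambda>_. mat_borel N"] measurable_mat_entry[of r N c] by auto
  have "(\<lambda>A. word N (mat_fam A) K m p q) \<in> borel_measurable ?P" if "p < N" "q < N" for p q
    using that K
  proof (induction m arbitrary: q)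
    case (Suc m)
    have "K m \<in> {1..n} \<times> {1..n}" using Suc.prems by auto
    then have "fst (K m) \<ge> 1" "snd (K m) \<ge> 1" by auto
    then have "(\<lambda>A. letter N (mat_fam A) (K m) d q) \<in> borel_measurable ?P" if "d < N" for d
      unfolding letter_def mat_fam_def using Suc.prems that
      by (intro borel_measurable_sum borel_measurable_times borel_measurable_cnj e) auto
    then show ?case using Suc
      by (auto simp: mat_mul_def intro!: borel_measurable_sum borel_measurable_times)
  qed simp
  then show ?thesis unfolding word_trace_def by (intro borel_measurable_sum) auto
qed

text \<open>For each word the two traces are independent with the same mean, so the expectation of
  the word expansion is the sum estimated in \<open>decoupled_moment_le\<close>.\<close>

lemma (in prob_space) gaussian_sum_trace_mean_le:
  fixes Y Y' :: "nat \<Rightarrow> 'a \<Rightarrow> complex mat"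
  assumes Y: "iid_gaussian M N Y" and copy: "independent_copy M (mat_borel N) Y Y'"
    and N: "N \<ge> 1" and n: "n \<ge> 1"
  shows "expectation (\<lambda>\<omega>. schatten_trace N m (gaussian_sum N n a Y Y' \<omega>)) \<le>
    (\<Sum>j=1..n. (cmod (a j))\<^sup>2) ^ m * (real N * (4 * growth N m) ^ m)\<^sup>2"
proof -
  define s where "s = 1 / sqrt (2 * real N)"
  define X where "X = (\<lambda>((j, r, c), b) \<omega>. real_entry N (r, c, b) (Y j \<omega>))"
  interpret ginibre_family M n N s X
    unfolding s_def X_def by (rule iid_gaussian_family[OF Y N n])
  let ?P = "PiM {1..} (\<lambda>_::nat. mat_borel N)"
  define V where "V \<omega> = (\<lambda>j\<in>{1..}. Y j \<omega>)" for \<omega>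
  define V' where "V' \<omega> = (\<lambda>j\<in>{1..}. Y' j \<omega>)" for \<omega>
  let ?S = "PiE {..<m} (\<lambda>_. {1..n} \<times> {1..n})"
  let ?F = "\<lambda>K A. word_trace N (mat_fam A) K m"
  have Zeq: "Z \<omega> = mat_fam (\<lambda>j. Y j \<omega>)" for \<omega>
  proof -
    have "s * sqrt (2 * real N) = 1" using N by (simp add: s_def)
    then have "complex_of_real s * (complex_of_real (sqrt (2 * real N) * Re z) + \<i> * complex_of_real (sqrt (2 * real N) * Im z)) = z" for z
      by (simp add: complex_eq_iff mult.assoc[symmetric])
    then show ?thesis
      unfolding Z_def fam_def y_def cfg_def unfolding X_def by (simp add: real_entry_def mat_fam_def)
  qed
  \<comment> \<open>All labels of a word are at least 1, so the restriction that yields points of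
    the product space goes unnoticed.\<close>
  have restr: "?F K (\<lambda>j\<in>{1..}. W j) = ?F K W" if K: "K \<in> ?S" for K W
  proof -
    have "fst (K i) \<ge> 1 \<and> snd (K i) \<ge> 1" if "i < m" for i
      using PiE_mem[OF K, of i] that by auto
    then show ?thesis
      unfolding word_trace_def using word_family_cong[of m "mat_fam (\<lambda>j\<in>{1..}. W j)" K "mat_fam W" N]
      by (simp add: mat_fam_def)
  qed
  have ind: "indep_var ?P V ?P V'" and dist: "distr M ?P V' = distr M ?P V"
    using copy unfolding independent_copy_def V_def V'_def by auto
  have mV: "V \<in> measurable M ?P" and mV': "V' \<in> measurable M ?P"
    using indep_var_rv1[OF ind] indep_var_rv2[OF ind] by auto
  have main: "has_bochner_integral M (\<lambda>\<omega>. ?F K (V \<omega>) * cnj (?F K (V' \<omega>)))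
      (of_real (word_mean K m) * cnj (of_real (word_mean K m)))" if K: "K \<in> ?S" for K
  proof -
    have mF: "?F K \<in> borel_measurable ?P"
      using PiE_mem[OF K] by (intro measurable_word_trace[of m K n]) auto
    have "has_bochner_integral M (\<lambda>\<omega>. word_trace N (Z \<omega>) K m) (of_real (word_mean K m))"
      using PiE_mem[OF K] by (intro word_trace_integral) auto
    then have 1: "has_bochner_integral M (\<lambda>\<omega>. ?F K (V \<omega>)) (of_real (word_mean K m))"
      unfolding Zeq V_def restr[OF K] .
    \<comment> \<open>The mean for the copy is transported along the equality of laws.\<close>
    then have 2: "has_bochner_integral M (\<lambda>\<omega>. ?F K (V' \<omega>)) (of_real (word_mean K m))"
      using integral_distr[OF mV mF] integral_distr[OF mV' mF] integrable_distr_eq[OF mV mF] integrable_distr_eq[OF mV' mF]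
      unfolding dist has_bochner_integral_iff by simp
    have 3: "has_bochner_integral M (\<lambda>\<omega>. cnj (?F K (V' \<omega>))) (cnj (of_real (word_mean K m)))"
      using 2 by (rule has_bochner_integral_bounded_linear[OF bounded_linear_cnj])
    have "indep_var borel (?F K \<circ> V) borel ((\<lambda>A. cnj (?F K A)) \<circ> V')"
      by (rule indep_var_compose[OF ind mF borel_measurable_cnj[OF mF]])
    then show ?thesis
      using indep_var_lebesgue_integral[of "?F K \<circ> V" "(\<lambda>A. cnj (?F K A)) \<circ> V'"]
        indep_var_integrable[of "?F K \<circ> V" "(\<lambda>A. cnj (?F K A)) \<circ> V'"] 1 3
      by (simp add: has_bochner_integral_iff comp_def)
  qed
  have car: "Y j \<omega> \<in> carrier_mat N N" "Y' j \<omega> \<in> carrier_mat N N" if "\<omega> \<in> space M" "j \<in> {1..n}" for j \<omega>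
  proof -
    have "V \<omega> \<in> space ?P" "V' \<omega> \<in> space ?P"
      using measurable_space[OF mV that(1)] measurable_space[OF mV' that(1)] by auto
    then have "V \<omega> j \<in> carrier_mat N N" "V' \<omega> j \<in> carrier_mat N N"
      using that(2) PiE_mem[of _ "{1..}" "\<lambda>_. carrier_mat N N" j] by (auto simp: space_PiM)
    then show "Y j \<omega> \<in> carrier_mat N N" "Y' j \<omega> \<in> carrier_mat N N"
      using that(2) by (auto simp: V_def V'_def)
  qed
  have eq: "schatten_trace N m (gaussian_sum N n a Y Y' \<omega>) =
      Re (\<Sum>K\<in>?S. coef a K m * (?F K (V \<omega>) * cnj (?F K (V' \<omega>))))" if "\<omega> \<in> space M" for \<omega>
  proof -
    have "schatten_trace N m (gaussian_sum N n a Y Y' \<omega>) =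
      Re (\<Sum>K\<in>?S. coef a K m * (word_trace N (mat_fam (\<lambda>j. Y j \<omega>)) K m * cnj (word_trace N (mat_fam (\<lambda>j. Y' j \<omega>)) K m)))"
      using has_kernel_gaussian_sum[of n Y \<omega> N Y' a] car[OF that]
      by (intro schatten_trace_eq_words) (simp add: mat_fam_def)
    also have "\<dots> = Re (\<Sum>K\<in>?S. coef a K m * (?F K (V \<omega>) * cnj (?F K (V' \<omega>))))"
      unfolding V_def V'_def by (intro arg_cong[of _ _ Re] sum.cong refl) (simp only: restr)
    finally show ?thesis .
  qed
  have "has_bochner_integral M (\<lambda>\<omega>. \<Sum>K\<in>?S. coef a K m * (?F K (V \<omega>) * cnj (?F K (V' \<omega>))))
      (\<Sum>K\<in>?S. coef a K m * (of_real (word_mean K m) * cnj (of_real (word_mean K m))))"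
    by (intro has_bochner_integral_sum has_bochner_integral_mult_right main)
  then have "has_bochner_integral M (\<lambda>\<omega>. Re (\<Sum>K\<in>?S. coef a K m * (?F K (V \<omega>) * cnj (?F K (V' \<omega>)))))
      (Re (\<Sum>K\<in>?S. coef a K m * (of_real (word_mean K m) * cnj (of_real (word_mean K m)))))"
    by (rule has_bochner_integral_bounded_linear[OF bounded_linear_Re])
  then have "expectation (\<lambda>\<omega>. Re (\<Sum>K\<in>?S. coef a K m * (?F K (V \<omega>) * cnj (?F K (V' \<omega>))))) =
      Re (\<Sum>K\<in>?S. coef a K m * (of_real (word_mean K m) * cnj (of_real (word_mean K m))))"
    by (rule has_bochner_integral_integral_eq)
  moreover have "expectation (\<lambda>\<omega>. schatten_trace N m (gaussian_sum N n a Y Y' \<omega>)) =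
      expectation (\<lambda>\<omega>. Re (\<Sum>K\<in>?S. coef a K m * (?F K (V \<omega>) * cnj (?F K (V' \<omega>)))))"
    by (intro Bochner_Integration.integral_cong refl) (rule eq)
  ultimately have "expectation (\<lambda>\<omega>. schatten_trace N m (gaussian_sum N n a Y Y' \<omega>)) \<le>
      (\<Sum>j=1..n. (cmod (a j))\<^sup>2) ^ m * (total_weight m)\<^sup>2"
    using decoupled_moment_le[of a m] by simp
  also have "\<dots> \<le> (\<Sum>j=1..n. (cmod (a j))\<^sup>2) ^ m * (real N * (4 * growth N m) ^ m)\<^sup>2"
    by (intro mult_left_mono power_mono total_weight_le total_weight_nonneg zero_le_power sum_nonneg) auto
  finally show ?thesis .
qed

section \<open>The limit\<close>

definition moment_degree :: "nat \<Rightarrow> nat" where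
  "moment_degree N = nat \<lfloor>sqrt (real N)\<rfloor>"

lemma moment_degree_bounds:
  shows "real (moment_degree N) \<le> sqrt (real N)" "sqrt (real N) - 1 \<le> real (moment_degree N)"
proof -
  have "real (moment_degree N) = real_of_int \<lfloor>sqrt (real N)\<rfloor>" by (simp add: moment_degree_def)
  then show "real (moment_degree N) \<le> sqrt (real N)" "sqrt (real N) - 1 \<le> real (moment_degree N)" by linarith+
qed

lemma moment_degree_ge_1: "N \<ge> 1 \<Longrightarrow> moment_degree N \<ge> 1"
  unfolding moment_degree_def by (simp add: le_nat_iff le_floor_iff)

lemma growth_moment_degree_le:
  assumes "N \<ge> 1"
  shows "growth N (moment_degree N) \<le> 1 + sqrt (real N) * (sqrt (real N) + 1)\<^sup>2 / (real N)\<^sup>2"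
  unfolding growth_def using moment_degree_bounds(1)[of N]
  by (intro add_left_mono divide_right_mono mult_mono power_mono) auto

text \<open>With \<rho> the ratio of \<open>4 * L\<close> to \<open>t\<close>, a slightly larger
  number below 1 absorbs \<open>growth\<close>, which tends to 1. Its power with exponent about
  twice the square root of \<open>N\<close> then decays faster than any power of
  \<open>N\<close>.\<close>

lemma moment_ratio_eventually_le:
  fixes L t :: real
  assumes L: "L \<ge> 0" and t: "t > 4 * L"
  shows "\<forall>\<^sub>F N in sequentially.
    (real N)\<^sup>2 * (4 * growth N (moment_degree N) * L) ^ (2 * moment_degree N) / t ^ (2 * moment_degree N) \<le> 1 / (real N)\<^sup>2"
proof -
  have t0: "t > 0" using L t by linarith
  define \<rho> where "\<rho> = 4 * L / t"
  have \<rho>: "0 \<le> \<rho>" "\<rho> < 1" using L t t0 by (auto simp: \<rho>_def)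
  then obtain \<rho>' where \<rho>': "\<rho> < \<rho>'" "\<rho>' < 1" using dense by blast
  have "((\<lambda>N. (1 + sqrt (real N) * (sqrt (real N) + 1)\<^sup>2 / (real N)\<^sup>2) * \<rho>) \<longlongrightarrow> 1 * \<rho>) sequentially"
    by (intro tendsto_mult_right) real_asymp
  then have ev1: "\<forall>\<^sub>F N in sequentially. (1 + sqrt (real N) * (sqrt (real N) + 1)\<^sup>2 / (real N)\<^sup>2) * \<rho> < \<rho>'"
    using \<rho>'(1) by (intro order_tendstoD(2)[where y = "1 * \<rho>"]) auto
  define c where "c = ln \<rho>'"
  have c: "c < 0" using \<rho> \<rho>' by (simp add: c_def)
  \<comment> \<open>The exponent 4 covers the \<open>N^2\<close> of the moment bound and another
    \<open>N^2\<close> that leaves a summable remainder; the \<open>- 1\<close> is the rounding in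
    \<open>moment_degree\<close>.\<close>
  have "((\<lambda>N. real N ^ 4 * exp (c * (2 * (sqrt (real N) - 1)))) \<longlongrightarrow> 0) sequentially"
    using c by real_asymp
  then have ev2: "\<forall>\<^sub>F N in sequentially. real N ^ 4 * exp (c * (2 * (sqrt (real N) - 1))) < 1"
    by (rule order_tendstoD) simp
  show ?thesis
    using ev1 ev2 eventually_ge_at_top[of 1]
  proof eventually_elim
    case (elim N)
    let ?m = "moment_degree N"
    have "growth N ?m * \<rho> \<le> \<rho>'"
      using mult_right_mono[OF growth_moment_degree_le[OF elim(3)] \<rho>(1)] elim(1) by linarith
    then have "(growth N ?m * \<rho>) ^ (2 * ?m) \<le> \<rho>' ^ (2 * ?m)"
      using growth_ge_1[of N ?m] \<rho> by (intro power_mono) auto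
    also have "\<dots> = exp (c * (2 * real ?m))"
      using \<rho> \<rho>' by (subst powr_realpow[symmetric]) (auto simp: powr_def c_def mult.commute)
    also have "\<dots> \<le> exp (c * (2 * (sqrt (real N) - 1)))"
      using c moment_degree_bounds(2)[of N] by (simp add: mult_left_mono_neg)
    finally have "(real N)\<^sup>2 * (growth N ?m * \<rho>) ^ (2 * ?m) \<le> (real N)\<^sup>2 * exp (c * (2 * (sqrt (real N) - 1)))"
      by (intro mult_left_mono) auto
    also have "\<dots> = real N ^ 4 * exp (c * (2 * (sqrt (real N) - 1))) / (real N)\<^sup>2"
      using elim(3) by (simp add: field_simps power2_eq_square power4_eq_xxxx)
    also have "\<dots> \<le> 1 / (real N)\<^sup>2"
      using elim(2) by (intro divide_right_mono) auto
    also have "(real N)\<^sup>2 * (growth N ?m * \<rho>) ^ (2 * ?m) = (real N)\<^sup>2 * (4 * growth N ?m * L) ^ (2 * ?m) / t ^ (2 * ?m)"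
      by (simp add: \<rho>_def power_divide power_mult_distrib)
    finally show ?case .
  qed
qed

text \<open>If \<open>u\<close> exceeds \<open>t\<close>, then \<open>u / t\<close> is at most its
  own \<open>2m\<close>-th power. The bound is linear in \<open>x\<close>, so after integration it
  involves the same ratio as Markov's inequality, and one estimate serves both claims.\<close>

lemma le_add_power_ratio:
  fixes u t x :: real
  assumes u: "u \<le> root (2 * m) x" and t: "t > 0" and m: "m \<ge> 1" and x: "x \<ge> 0"
  shows "u \<le> t + t * (x / t ^ (2 * m))"
proof (cases "u \<le> t")
  case True
  then show ?thesis using t x by (simp add: add_increasing2)
next
  case False
  have "u ^ (2 * m) \<le> root (2 * m) x ^ (2 * m)"
    using u t False by (intro power_mono) auto
  also have "\<dots> = x" using m x by (intro real_root_pow_pos2) auto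
  finally have "(u / t) ^ (2 * m) \<le> x / t ^ (2 * m)"
    using t by (simp add: power_divide divide_right_mono)
  moreover have "u / t \<le> (u / t) ^ (2 * m)"
    using False t m power_increasing[of 1 "2 * m" "u / t"] by simp
  ultimately have "t * (u / t) \<le> t * (x / t ^ (2 * m))"
    using t by (intro mult_left_mono) auto
  then show ?thesis using t by simp
qed

lemma ereal_le_from_greater:
  fixes x :: ereal
  assumes "\<And>t. t > c \<Longrightarrow> x \<le> ereal t"
  shows "x \<le> ereal c"
proof (rule dense_ge)
  fix z assume z: "ereal c < z"
  then show "x \<le> z"
  proof (cases z)
    case (real r)
    then show ?thesis using assms[of r] z by simp
  qed auto
qed

theorem theorem0p2:
  fixes \<Omega> :: "'a measure" and \<Omega>' :: "nat \<Rightarrow> 'b measure"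
    and U :: "nat \<Rightarrow> nat \<Rightarrow> 'a \<Rightarrow> complex mat"
    and Y Y' :: "nat \<Rightarrow> nat \<Rightarrow> 'b \<Rightarrow> complex mat"
    and C :: real and n :: nat and a :: "nat \<Rightarrow> complex"
  assumes "prob_space \<Omega>"
    and "\<And>N. N \<ge> 1 \<Longrightarrow> prob_space (\<Omega>' N)"
    and "\<And>N. N \<ge> 1 \<Longrightarrow> iid_haar_unitary \<Omega> N (U N)"
    and "\<And>N. N \<ge> 1 \<Longrightarrow> iid_gaussian (\<Omega>' N) N (Y N)"
    and "\<And>N. N \<ge> 1 \<Longrightarrow> independent_copy (\<Omega>' N) (mat_borel N) (Y N) (Y' N)"
    and "C \<ge> 0"
    and "\<And>(N::nat) (m::nat) (p::real) (q::ereal) (b::nat \<Rightarrow> complex).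
           N \<ge> 1 \<Longrightarrow> m \<ge> 1 \<Longrightarrow> p \<ge> 1 \<Longrightarrow> q \<ge> 1 \<Longrightarrow>
           prob_space.expectation \<Omega> (\<lambda>\<omega>. schatten_norm N q (S_hat N m b (U N) \<omega>) powr p)
           \<le> C powr p *
             prob_space.expectation (\<Omega>' N)
               (\<lambda>\<omega>. schatten_norm N q (gaussian_sum N m b (Y N) (Y' N) \<omega>) powr p)"
    and "n \<ge> 1"
  shows "limsup (\<lambda>N. ereal (prob_space.expectation \<Omega> (\<lambda>\<omega>. op_norm N (S_hat N n a (U N) \<omega>))))
           \<le> ereal (4 * C * sqrt (\<Sum>j=1..n. (cmod (a j))\<^sup>2))
         \<and> (AE \<omega> in \<Omega>. limsup (\<lambda>N. ereal (op_norm N (S_hat N n a (U N) \<omega>)))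
           \<le> ereal (4 * C * sqrt (\<Sum>j=1..n. (cmod (a j))\<^sup>2)))"
proof -
  interpret prob_space \<Omega> by fact
  define A where "A = (\<Sum>j=1..n. (cmod (a j))\<^sup>2)"
  define L where "L = C * sqrt A"
  define X where "X N \<omega> = schatten_trace N (moment_degree N) (S_hat N n a (U N) \<omega>)" for N \<omega>
  have A: "A \<ge> 0" unfolding A_def by (intro sum_nonneg) auto
  have L: "L \<ge> 0" using A \<open>C \<ge> 0\<close> by (simp add: L_def)
  have X0: "X N \<omega> \<ge> 0" if "N \<ge> 1" for N \<omega>
    unfolding X_def by (intro schatten_trace_nonneg moment_degree_ge_1 that)
  have iX: "integrable \<Omega> (X N)" if "N \<ge> 1" for N
    unfolding X_def using assms(3)[OF that] that by (rule S_hat_kernel_haar(2))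
  have op: "op_norm N (S_hat N n a (U N) \<omega>) \<le> root (2 * moment_degree N) (X N \<omega>)" if "N \<ge> 1" "\<omega> \<in> space \<Omega>" for N \<omega>
    unfolding X_def using S_hat_kernel_haar(1)[OF assms(3)[OF that(1)] that] moment_degree_ge_1[OF that(1)]
    by (rule op_norm_le_schatten_trace)
  have EX: "expectation (X N) \<le> (real N)\<^sup>2 * (4 * growth N (moment_degree N) * L) ^ (2 * moment_degree N)" if N: "N \<ge> 1" for N
  proof -
    let ?m = "moment_degree N"
    interpret G: prob_space "\<Omega>' N" by (rule assms(2)[OF N])
    note m = moment_degree_ge_1[OF N]
    have "expectation (X N) = expectation (\<lambda>\<omega>. schatten_norm N (ereal (2 * real ?m)) (S_hat N n a (U N) \<omega>) powr (2 * real ?m))"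
      unfolding X_def schatten_norm_even_powr[OF m] ..
    also have "\<dots> \<le> C powr (2 * real ?m) * G.expectation (\<lambda>\<omega>. schatten_norm N (ereal (2 * real ?m)) (gaussian_sum N n a (Y N) (Y' N) \<omega>) powr (2 * real ?m))"
      using m by (intro assms(7) N \<open>n \<ge> 1\<close>) (auto simp: one_ereal_def)
    also have "\<dots> = C ^ (2 * ?m) * G.expectation (\<lambda>\<omega>. schatten_trace N ?m (gaussian_sum N n a (Y N) (Y' N) \<omega>))"
      unfolding schatten_norm_even_powr[OF m] using powr_realpow'[of C "2 * ?m"] m \<open>C \<ge> 0\<close> by simp
    also have "\<dots> \<le> C ^ (2 * ?m) * (A ^ ?m * (real N * (4 * growth N ?m) ^ ?m)\<^sup>2)"
      unfolding A_def
      by (intro mult_left_mono G.gaussian_sum_trace_mean_le assms(4) assms(5) N \<open>n \<ge> 1\<close> zero_le_power \<open>C \<ge> 0\<close>)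
    also have "\<dots> = (real N)\<^sup>2 * (4 * growth N ?m * L) ^ (2 * ?m)"
    proof -
      have "A ^ ?m = sqrt A ^ (2 * ?m)" using A by (simp add: power_mult)
      then show ?thesis by (simp add: L_def power_mult_distrib mult_ac flip: power_mult)
    qed
    finally show ?thesis .
  qed
  have ratio: "\<forall>\<^sub>F N in sequentially. N \<ge> 1 \<and> expectation (X N) / t ^ (2 * moment_degree N) \<le> 1 / (real N)\<^sup>2" if "t > 4 * L" for t
    using moment_ratio_eventually_le[OF L that] eventually_ge_at_top[of 1]
  proof eventually_elim
    case (elim N)
    have "t > 0" using that L by linarith
    then have "expectation (X N) / t ^ (2 * moment_degree N) \<le> (real N)\<^sup>2 * (4 * growth N (moment_degree N) * L) ^ (2 * moment_degree N) / t ^ (2 * moment_degree N)"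
      using elim by (intro divide_right_mono EX) auto
    then show ?case using elim by linarith
  qed
  have 1: "limsup (\<lambda>N. ereal (expectation (\<lambda>\<omega>. op_norm N (S_hat N n a (U N) \<omega>)))) \<le> ereal (4 * L)"
  proof (rule ereal_le_from_greater)
    fix t assume t: "t > 4 * L"
    then have t0: "t > 0" using L by linarith
    have "\<forall>\<^sub>F N in sequentially. ereal (expectation (\<lambda>\<omega>. op_norm N (S_hat N n a (U N) \<omega>))) \<le> ereal (t + t * (1 / (real N)\<^sup>2))"
      using ratio[OF t]
    proof eventually_elim
      case (elim N)
      let ?u = "\<lambda>\<omega>. op_norm N (S_hat N n a (U N) \<omega>)"
      let ?B = "\<lambda>\<omega>. t + t * (X N \<omega> / t ^ (2 * moment_degree N))"
      have iB: "integrable \<Omega> ?B" using iX elim by auto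
      have "expectation ?u \<le> expectation ?B"
      proof (cases "integrable \<Omega> ?u")
        case True
        show ?thesis
          using True iB
        proof (rule integral_mono)
          fix \<omega> assume "\<omega> \<in> space \<Omega>"
          then show "?u \<omega> \<le> ?B \<omega>"
            using elim by (intro le_add_power_ratio op t0 moment_degree_ge_1 X0) auto
        qed
      next
        \<comment> \<open>A non-integrable function has Bochner integral 0, below the integral of
          the nonnegative majorant.\<close>
        case False
        have "0 \<le> expectation ?B"
          using t0 X0 elim by (intro Bochner_Integration.integral_nonneg) auto
        then show ?thesis using False by (simp add: not_integrable_integral_eq)
      qed
      also have "\<dots> = t + t * (expectation (X N) / t ^ (2 * moment_degree N))"
        using iX elim by (simp add: prob_space)
      also have "\<dots> \<le> t + t * (1 / (real N)\<^sup>2)"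
        using elim t0 by (intro add_left_mono mult_left_mono) auto
      finally show ?case by simp
    qed
    then have "limsup (\<lambda>N. ereal (expectation (\<lambda>\<omega>. op_norm N (S_hat N n a (U N) \<omega>)))) \<le> limsup (\<lambda>N. ereal (t + t * (1 / (real N)\<^sup>2)))"
      by (rule Limsup_mono)
    also have "(\<lambda>N. t + t * (1 / (real N)\<^sup>2)) \<longlonglongrightarrow> t" by real_asymp
    then have "limsup (\<lambda>N. ereal (t + t * (1 / (real N)\<^sup>2))) = ereal t"
      by (intro lim_imp_Limsup) auto
    finally show "limsup (\<lambda>N. ereal (expectation (\<lambda>\<omega>. op_norm N (S_hat N n a (U N) \<omega>)))) \<le> ereal t" .
  qed
  have as: "AE \<omega> in \<Omega>. limsup (\<lambda>N. ereal (op_norm N (S_hat N n a (U N) \<omega>))) \<le> ereal t" if t: "t > 4 * L" for t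
  proof -
    have t0: "t > 0" using t L by linarith
    \<comment> \<open>The events are phrased with \<open>X N\<close>, whose measurability is known,
      instead of the operator norm that it dominates. The empty set at \<open>N = 0\<close> fills
      the index not covered by the estimates.\<close>
    define E where "E N = (if N \<ge> 1 then {\<omega> \<in> space \<Omega>. t ^ (2 * moment_degree N) \<le> X N \<omega>} else {})" for N
    have E: "E N \<in> sets \<Omega>" for N
      using borel_measurable_integrable[OF iX[of N]] unfolding E_def by auto
    have "\<forall>\<^sub>F N in sequentially. norm (prob (E N)) \<le> 1 / (real N)\<^sup>2"
      using ratio[OF t]
    proof eventually_elim
      case (elim N)
      have "prob (E N) \<le> expectation (X N) / t ^ (2 * moment_degree N)"
        unfolding E_def using elim t0 X0 integral_Markov_inequality_measure[OF iX[of N], of "{}" "t ^ (2 * moment_degree N)"] by auto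
      then show ?case using elim by simp
    qed
    then have "summable (\<lambda>N. prob (E N))"
      by (rule summable_comparison_test_ev) (use inverse_power_summable[of 2, where 'a = real] in \<open>simp add: inverse_eq_divide\<close>)
    then have "AE \<omega> in \<Omega>. \<forall>\<^sub>F N in sequentially. \<omega> \<in> space \<Omega> - E N"
      by (intro borel_cantelli_AE1 E) (auto simp: less_top[symmetric])
    then show ?thesis
    proof eventually_elim
      case (elim \<omega>)
      then have "\<forall>\<^sub>F N in sequentially. ereal (op_norm N (S_hat N n a (U N) \<omega>)) \<le> ereal t"
        using eventually_ge_at_top[of 1]
      proof eventually_elim
        case (elim N)
        then have "X N \<omega> < t ^ (2 * moment_degree N)" by (auto simp: E_def)
        then have "root (2 * moment_degree N) (X N \<omega>) \<le> root (2 * moment_degree N) (t ^ (2 * moment_degree N))"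
          using moment_degree_ge_1[of N] elim by (intro real_root_le_mono) auto
        also have "\<dots> = t" using moment_degree_ge_1[of N] elim t0 by (intro real_root_power_cancel) auto
        finally show ?case using op[of N \<omega>] elim by auto
      qed
      then show ?case by (rule Limsup_bounded)
    qed
  qed
  \<comment> \<open>The exceptional null set depends on the threshold, so only countably many
    thresholds decreasing to \<open>4 * L\<close> are used.\<close>
  have "AE \<omega> in \<Omega>. \<forall>k::nat. limsup (\<lambda>N. ereal (op_norm N (S_hat N n a (U N) \<omega>))) \<le> ereal (4 * L + 1 / real (Suc k))"
    unfolding AE_all_countable by (intro allI as) simp
  then have 2: "AE \<omega> in \<Omega>. limsup (\<lambda>N. ereal (op_norm N (S_hat N n a (U N) \<omega>))) \<le> ereal (4 * L)"
  proof eventually_elim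
    case (elim \<omega>)
    show ?case
    proof (rule ereal_le_from_greater)
      fix t assume "t > 4 * L"
      then obtain k where "1 / real (Suc k) < t - 4 * L"
        using reals_Archimedean[of "t - 4 * L"] by (auto simp: inverse_eq_divide)
      then have "ereal (4 * L + 1 / real (Suc k)) \<le> ereal t" by simp
      then show "limsup (\<lambda>N. ereal (op_norm N (S_hat N n a (U N) \<omega>))) \<le> ereal t"
        using elim order_trans by blast
    qed
  qed
  have eq: "4 * C * sqrt (\<Sum>j=1..n. (cmod (a j))\<^sup>2) = 4 * L" by (simp add: L_def A_def)
  show ?thesis unfolding eq using 1 2 by (rule conjI)
qed

end
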